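(* Let $I\subset\mathbb{R}$ be a compact interval of positive length, $T\colon I\to I$ a map, and $\mu$ a $T$-invariant Borel probability measure on $I$ (regarded also as a measure on $\mathbb{R}$). Assume that there are positive constants $t_1$ and $c_1$ with \[ \mu(D)\le c_12^{-t_1n}\qquad\text{whenever }D\in\mathscr{D}_n, \] and that there is a function $p$ with $\sum_{n=0}^\infty p(n)<\infty$ such that \[ \biggl|\int f\circ T^n\cdot g\,\mathrm{d}\mu-\int f\,\mathrm{d}\mu\int g\,\mathrm{d}\mu\biggr|\le p(n)\,\lVert f\rVert_1\,\lVert g\rVert \] for all $n\ge 0$, all $f\in L^1(\mu)$ and all $g\colon I\to\mathbb{R}$ of bounded variation, where $\lVert f\rVert_1=\int|f|\,\mathrm{d}\mu$ and $\lVert g\rVert=\int|g|\,\mathrm{d}\mu+\operatorname{var}g$. For $\alpha>0$ and $x\in I$ put \[ E_\alpha(x)=\{\,y:|T^n(x)-y|<n^{-\alpha}\text{ for infinitely many }n\in\mathbb{N}\,\}. \] Let \[ s=s(\mu)=\lim_{\varepsilon\to0^+}\sup\{\,t:G_\mu(t)\ge t-\varepsilon\,\}, \] and let $\alpha>0$ be such that $1/\alpha\le s$. Then, for $\mu$-almost every $x\in I$, $E_\alpha(x)\in\mathscr{G}_\mu^\theta$, where $\theta=(\alpha s)^{-1}$. In particular, there is a set $A\subset I$ of full $\mu$ measure such that if $x_1,x_2,\dots$ is a finite or countable sequence of points in $A$, then \[ \frac1\alpha\,\frac{\overline{\dim}_{\mathrm H}\,\mu}{s}\le\dim_{\mathrm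 H}\bigcap_nE_\alpha(x_n)\le\frac1\alpha. \]
   Context: $\dim_{\mathrm H}$ denotes Hausdorff dimension; $\operatorname{var}g$ is the total variation of $g$. Fix a point $P\in\mathbb{R}$. For $n\in\mathbb{Z}$, $\mathscr{D}_n$ is the collection of intervals $[P+k2^{-n},\,P+(k+1)2^{-n})$, $k\in\mathbb{Z}$, and $\mathscr{D}=\bigcup_{n\in\mathbb{Z}}\mathscr{D}_n$. For $0<\theta\le1$ and $E\subset\mathbb{R}$, $\mathscr{M}_\mu^\theta(E)=\inf\{\sum_k\mu(D_k)^\theta : D_k\in\mathscr{D},\ E\subset\bigcup_kD_k\}$ (infimum over countable covers). For $0<\theta\le1$, a set $E\subset\mathbb{R}$ belongs to the class $\mathscr{G}_\mu^\theta$ if $E$ is a $G_\delta$-set and $\mathscr{M}_\mu^\eta(E\cap D)=\mathscr{M}_\mu^\eta(D)$ for every $0<\eta<\theta$ and every $D\in\mathscr{D}$. The upper coarse multifractal spectrum of $\mu$ is \[ G_\mu(s)=\lim_{\varepsilon\to0}\limsup_{r\to0}\frac{\log(N(s+\varepsilon,r)-N(s-\varepsilon,r))}{-\log r}, \] where $N(s,r)$ is the number of intervals $[kr,(k+1)r)$, $k\in\mathbb{Z}$, with $\mu([kr,(k+1)r))\ge r^s$; here $\log0=-\infty$. The lower local dimension of $\mu$ at $x$ is $\underline{d}_\mu(x)=\liminf_{r\to0}\frac{\log\mu(B(x,r))}{\log r}$, with $B(x,r)$ the open ball, and the upper Hausdorff dimension of $\mu$ is $\overline{\dim}_{\mathrm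 H}\,\mu=\operatorname{ess\,sup}_\mu\underline{d}_\mu=\inf\{\dim_{\mathrm H}A:\mu(A^\complement)=0\}$. *)

theory Defs
  imports "HOL-Probability.Probability"
begin

definition line_measure :: "real measure \<Rightarrow> real measure" where
  \<comment> \<open>a Borel measure on a Borel subset of the line, regarded as a Borel measure on the whole line\<close>
  "line_measure \<mu> = distr \<mu> borel (\<lambda>x. x)"

definition total_variation :: "real set \<Rightarrow> (real \<Rightarrow> real) \<Rightarrow> ennreal" where
  \<comment> \<open>a finite partition is an initial segment of a nondecreasing sequence of points\<close>
  "total_variation S g =
     (SUP (t, n) \<in> {t. incseq t \<and> range t \<subseteq> S} \<times> (UNIV :: nat set).
        \<Sum>i<n. ennreal \<bar>g (t (Suc i)) - g (t i)\<bar>)"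

definition bounded_variation_on :: "real set \<Rightarrow> (real \<Rightarrow> real) \<Rightarrow> bool" where
  "bounded_variation_on S g \<longleftrightarrow> total_variation S g < \<infinity>"

definition dyadic_level :: "real \<Rightarrow> int \<Rightarrow> real set set" where
  "dyadic_level P n =
     {{P + real_of_int k * 2 powi (- n) ..< P + (real_of_int k + 1) * 2 powi (- n)} | k :: int. True}"

definition dyadic :: "real \<Rightarrow> real set set" where
  "dyadic P = (\<Union>n. dyadic_level P n)"

text \<open>Below, \<open>\<mu>\<close> is always a finite Borel measure on the line, so that the
  real-valued \<^const>\<open>measure\<close> loses nothing.\<close>

definition net_content :: "real \<Rightarrow> real measure \<Rightarrow> real \<Rightarrow> real set \<Rightarrow> ennreal" where
  "net_content P \<mu> \<theta> E =
     (INF C \<in> {C. countable C \<and> C \<subseteq> dyadic P \<and> E \<subseteq> \<Union>C}.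
        \<Sum>\<^sub>\<infinity>D\<in>C. ennreal (measure \<mu> D powr \<theta>))"

definition large_intersection_class :: "real \<Rightarrow> real measure \<Rightarrow> real \<Rightarrow> real set set" where
  "large_intersection_class P \<mu> \<theta> =
     {E. gdelta E \<and>
         (\<forall>\<eta> D. 0 < \<eta> \<and> \<eta> < \<theta> \<and> D \<in> dyadic P \<longrightarrow>
            net_content P \<mu> \<eta> (E \<inter> D) = net_content P \<mu> \<eta> D)}"

definition elog :: "real \<Rightarrow> ereal" where
  \<comment> \<open>logarithm with the convention that the logarithm of \<open>0\<close> is \<open>- \<infinity>\<close>\<close>
  "elog x = (if x \<le> 0 then - \<infinity> else ereal (ln x))"

definition coarse_count :: "real measure \<Rightarrow> real \<Rightarrow> real \<Rightarrow> nat" where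
  \<comment> \<open>the set is finite for a finite measure and \<open>r > 0\<close>, so \<^const>\<open>card\<close> is the true count\<close>
  "coarse_count \<mu> s r =
     card {k :: int. measure \<mu> {real_of_int k * r ..< (real_of_int k + 1) * r} \<ge> r powr s}"

definition upper_coarse_spectrum :: "real measure \<Rightarrow> real \<Rightarrow> ereal" where
  "upper_coarse_spectrum \<mu> s =
     Lim (at_right 0) (\<lambda>\<epsilon>. Limsup (at_right 0) (\<lambda>r.
       elog (real (coarse_count \<mu> (s + \<epsilon>) r) - real (coarse_count \<mu> (s - \<epsilon>) r)) / ereal (- ln r)))"

definition spectrum_exponent :: "real measure \<Rightarrow> ereal" where
  "spectrum_exponent \<mu> =
     Lim (at_right 0) (\<lambda>\<epsilon>. SUP t \<in> {t. upper_coarse_spectrum \<mu> t \<ge> ereal (t - \<epsilon>)}. ereal t)"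

definition lower_local_dim :: "real measure \<Rightarrow> real \<Rightarrow> ereal" where
  "lower_local_dim \<mu> x =
     Liminf (at_right 0) (\<lambda>r. elog (measure \<mu> (ball x r)) / ereal (ln r))"

definition upper_hausdorff_dim_measure :: "real measure \<Rightarrow> ereal" where
  \<comment> \<open>\<^const>\<open>esssup\<close> defaults to \<open>top\<close> on non-measurable functions; the lower local dimension of a
    finite Borel measure is Borel measurable\<close>
  "upper_hausdorff_dim_measure \<mu> = esssup \<mu> (lower_local_dim \<mu>)"

definition hausdorff_premeasure :: "real \<Rightarrow> real \<Rightarrow> 'a::metric_space set \<Rightarrow> ennreal" where
  \<comment> \<open>\<^const>\<open>diameter\<close> is unspecified on unbounded sets, which are therefore excluded\<close>
  "hausdorff_premeasure \<delta> t A =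
     (INF U \<in> {U :: nat \<Rightarrow> 'a set. A \<subseteq> (\<Union>i. U i) \<and> (\<forall>i. bounded (U i) \<and> diameter (U i) \<le> \<delta>)}.
        \<Sum>i. ennreal (diameter (U i) powr t))"

definition hausdorff_measure :: "real \<Rightarrow> 'a::metric_space set \<Rightarrow> ennreal" where
  "hausdorff_measure t A = (SUP \<delta> \<in> {0<..}. hausdorff_premeasure \<delta> t A)"

definition hausdorff_dim :: "'a::metric_space set \<Rightarrow> ereal" where
  \<comment> \<open>the exponent \<open>t = 0\<close> is left out because \<open>0 powr 0 = 0\<close>; this does not affect the infimum\<close>
  "hausdorff_dim A = (INF t \<in> {t. 0 < t \<and> hausdorff_measure t A = 0}. ereal t)"

definition orbit_limsup_set :: "(real \<Rightarrow> real) \<Rightarrow> real \<Rightarrow> real \<Rightarrow> real set" where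
  "orbit_limsup_set T \<alpha> x = {y. \<exists>\<^sub>\<infinity>n::nat. \<bar>(T ^^ n) x - y\<bar> < real n powr (- \<alpha>)}"

end

theory Submission
  imports Defs
begin

text \<open>Write \<open>x\<^sub>k\<close> for the iterates of \<open>x\<close>. To see that covers of the limsup set by dyadic cells are
  expensive, redistribute \<open>\<mu>\<close>, or its restriction to a Borel set \<open>F\<close>, inside the balls around \<open>x\<^sub>k\<close>,
  \<open>n \<le> k < 2 n\<close>: each \<open>x\<^sub>k\<close> in \<open>F\<close> receives mass \<open>1/n\<close>, spread over its dyadic cell of length about
  \<open>n powr (- \<alpha>)\<close>. Decay of correlations bounds the variance of the number of \<open>x\<^sub>k\<close> in an interval, so
  the new measure is close to the old one on coarse cells, and by Markov's inequality all but a small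
  proportion of the \<open>x\<^sub>k\<close> avoid overcrowded cells. By the definition of \<open>s\<close>, most of \<open>\<mu>\<close> sits on cells of
  measure at least \<open>n powr (- \<alpha> s')\<close>, for any \<open>s' > s\<close>; there the new measure of a cell \<open>Q\<close> is at most
  \<open>\<mu>(Q) powr \<eta>\<close> as long as \<open>\<eta> < 1 / (\<alpha> s')\<close>. Redistributing again and again, once for each open set of
  a countable family, and using compactness gives the lower bound for the cost of covers of the
  intersection. Level sets of the lower local dimension in place of \<open>F\<close> give the bound for the Hausdorff
  dimension.\<close>

section \<open>Dyadic cells and redistribution of a measure\<close>

text \<open>The obstacle is uniformity over all cells at once. A law of large numbers controls only
  finitely many cells, so it is used at a single level \<open>L\<close>. Between \<open>L\<close>
  and the level \<open>l\<close> of the visited cells only an upper bound for the number of visits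
  is available; it comes from adding second moments over all cells of all these levels. The sum does
  not see the number of cells, because the correlation error for the indicator of a cell is at most
  a constant times the measure of the cell. Losses of a factor
  \<open>2 powr (\<epsilon> * j)\<close> on level \<open>j\<close> are paid from two reserves: the
  gap between s' * \<eta> and 1 / \<alpha>, and the decay of cell measures with exponent
  \<open>t1\<close>, raised to 1 - \<eta>. This is why \<epsilon> is a third of the smaller reserve:
  one \<epsilon> for crowding, one for cells of which \<open>F\<close> fills little, one left over
  to make the bound small.

  The exceptional null set must serve every sequence of points. Hence \<open>fills\<close> speaks of
  one open set, is proved for countably many parameters, and only \<open>fills_cover\<close>
  combines several open sets, whichever orbits they come from.\<close>

definition cell_index :: "real \<Rightarrow> int \<Rightarrow> real \<Rightarrow> int" where
  "cell_index P n y = \<lfloor>(y - P) * 2 powi n\<rfloor>"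

definition dcell :: "real \<Rightarrow> int \<Rightarrow> int \<Rightarrow> real set" where
  "dcell P n k = {P + real_of_int k * 2 powi (- n) ..< P + (real_of_int k + 1) * 2 powi (- n)}"

lemma dyadic_level_eq: "dyadic_level P n = range (dcell P n)"
  by (auto simp: dyadic_level_def dcell_def)

lemma mem_dcell: "y \<in> dcell P n k \<longleftrightarrow> cell_index P n y = k"
proof -
  have "(0::real) < 2 powi n" by simp
  then show ?thesis
    by (auto simp: dcell_def cell_index_def floor_eq_iff power_int_minus field_simps)
qed

lemma dcell_sets [measurable, simp]: "dcell P n k \<in> sets borel"
  by (simp add: dcell_def)

lemma cell_index_mono: "x \<le> y \<Longrightarrow> cell_index P n x \<le> cell_index P n y"
  by (simp add: cell_index_def floor_mono mult_right_mono)

text \<open>Levels are nested because the ratio of the scalings is an integer: rounding down at the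
  fine level first does not change the coarse rounding.\<close>

lemma cell_index_coarser:
  assumes "m \<le> n"
  shows "cell_index P m y = cell_index P n y div 2 ^ nat (n - m)"
proof -
  have "(2::real) powi n = 2 powi m * 2 ^ nat (n - m)"
    using assms by (simp add: power_int_add [symmetric] flip: power_int_of_nat)
  then have "(y - P) * 2 powi m = (y - P) * 2 powi n / real_of_int (2 ^ nat (n - m))"
    by simp
  then show ?thesis
    unfolding cell_index_def by (simp only:) (rule floor_divide_real_eq_div, simp)
qed

lemma cell_index_eq_coarser:
  "cell_index P n x = cell_index P n y \<Longrightarrow> m \<le> n \<Longrightarrow> cell_index P m x = cell_index P m y"
  by (simp add: cell_index_coarser)

lemma measurable_cell_index [measurable]: "cell_index P n \<in> measurable borel (count_space UNIV)"
  unfolding cell_index_def by measurable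

lemma dist_same_cell:
  assumes "cell_index P n x = cell_index P n y"
  shows "\<bar>x - y\<bar> < 2 powi (- n)"
proof -
  have "x \<in> dcell P n (cell_index P n x)" "y \<in> dcell P n (cell_index P n x)"
    using assms by (simp_all add: mem_dcell)
  then show ?thesis by (auto simp: dcell_def algebra_simps)
qed

text \<open>All densities of the construction are of this kind. Products stay in the class, and
  against a measure carried by a bounded interval their integrals are finite sums over
  cells.\<close>

definition step_fun :: "real \<Rightarrow> int \<Rightarrow> (real \<Rightarrow> real) \<Rightarrow> bool" where
  "step_fun P n h \<longleftrightarrow> (\<forall>x y. cell_index P n x = cell_index P n y \<longrightarrow> h x = h y)"

lemma step_funD: "step_fun P n h \<Longrightarrow> cell_index P n x = cell_index P n y \<Longrightarrow> h x = h y"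
  unfolding step_fun_def by blast

lemma step_fun_finer: "step_fun P m h \<Longrightarrow> m \<le> n \<Longrightarrow> step_fun P n h"
  unfolding step_fun_def using cell_index_eq_coarser by blast

lemma step_fun_mult: "step_fun P n g \<Longrightarrow> step_fun P n h \<Longrightarrow> step_fun P n (\<lambda>x. g x * h x)"
  unfolding step_fun_def by metis

lemma step_fun_indicator: "m \<le> n \<Longrightarrow> step_fun P n (indicator (dcell P m k))"
  unfolding step_fun_def indicator_def mem_dcell using cell_index_eq_coarser by metis

lemma step_fun_factor:
  assumes "step_fun P n h"
  obtains \<phi> where "h = (\<lambda>y. \<phi> (cell_index P n y))"
proof
  show "h = (\<lambda>y. (\<lambda>k. h (SOME z. cell_index P n z = k)) (cell_index P n y))"
  proof
    fix y
    have "cell_index P n (SOME z. cell_index P n z = cell_index P n y) = cell_index P n y"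
      by (rule someI [of _ y]) simp
    then show "h y = (\<lambda>k. h (SOME z. cell_index P n z = k)) (cell_index P n y)"
      using assms by (auto dest: step_funD)
  qed
qed

lemma step_fun_measurable:
  assumes "step_fun P n h"
  shows "h \<in> borel_measurable borel"
proof -
  obtain \<phi> where "h = (\<lambda>y. \<phi> (cell_index P n y))"
    using assms by (rule step_fun_factor)
  then show ?thesis by simp
qed

text \<open>\<open>fills_at P N \<tau> U G \<delta>\<close>: the measure \<open>N\<close> can be redistributed inside a compact part of \<open>U\<close>, nearly
  without changing it down to some level beyond \<open>G\<close>, and with masses small compared to \<open>\<tau>\<close> on all
  finer levels.\<close>

definition fills_at ::
  "real \<Rightarrow> real measure \<Rightarrow> (real set \<Rightarrow> real) \<Rightarrow> real set \<Rightarrow> int \<Rightarrow> real \<Rightarrow> bool" where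
  "fills_at P N \<tau> U G \<delta> \<longleftrightarrow> (\<exists>L g K n W. G \<le> L \<and> compact K \<and> K \<subseteq> U \<and> step_fun P n g
      \<and> (\<forall>y. 0 \<le> g y \<and> g y \<le> W) \<and> (\<forall>y. y \<notin> K \<longrightarrow> g y = 0)
      \<and> (\<forall>Q\<in>dyadic_level P L. (\<integral>y. indicator Q y * g y \<partial>N) \<le> (1 + \<delta>) * measure N Q)
      \<and> measure N UNIV - \<delta> \<le> (\<integral>y. g y \<partial>N)
      \<and> (\<forall>l>L. \<forall>Q\<in>dyadic_level P l. (\<integral>y. indicator Q y * g y \<partial>N) \<le> \<delta> * \<tau> Q))"

text \<open>Both parameters stay free because each use multiplies \<open>g\<close> into a density
  built before: \<open>G\<close> has to reach the level of that density, and \<delta> has to beat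
  its upper bound.\<close>

definition fills :: "real \<Rightarrow> real measure \<Rightarrow> (real set \<Rightarrow> real) \<Rightarrow> real set \<Rightarrow> bool" where
  "fills P N \<tau> U \<longleftrightarrow> (\<forall>G. \<forall>\<delta>>0. fills_at P N \<tau> U G \<delta>)"

text \<open>Being carried by a bounded interval leaves finitely many cells of each level to sum
  over. The instances are the given measure and its restrictions to Borel sets.\<close>

locale bounded_line_measure = finite_measure N for N :: "real measure" +
  fixes a b :: real
  assumes sets_N [measurable_cong, simp]: "sets N = sets borel"
    and AE_bounded: "AE y in N. y \<in> {a..b}"
begin

lemma space_N [simp]: "space N = UNIV"
  using sets_eq_imp_space_eq [OF sets_N] by simp

lemma integrable_bounded:
  assumes "f \<in> borel_measurable borel" "\<And>y. 0 \<le> f y \<and> f y \<le> (W::real)"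
  shows "integrable N f"
proof (rule integrable_const_bound)
  show "AE x in N. norm (f x) \<le> W" using assms(2) by simp
  show "f \<in> borel_measurable N"
    using assms(1) measurable_cong_sets [OF sets_N refl] by auto
qed

lemma integral_indicator_null:
  fixes g :: "real \<Rightarrow> real"
  assumes "Q \<in> sets borel" "measure N Q = 0"
  shows "(\<integral>y. indicator Q y * g y \<partial>N) = 0"
proof (rule integral_eq_zero_AE)
  have "Q \<in> null_sets N"
    using assms by (intro null_setsI) (auto simp: emeasure_eq_measure)
  then show "AE y in N. indicator Q y * g y = 0"
    by (rule AE_mp [OF AE_not_in]) (auto intro!: AE_I2)
qed

lemma step_decompose:
  fixes h :: "real \<Rightarrow> real"
  assumes "h = (\<lambda>y. \<phi> (cell_index P n y))"
  shows "AE y in N. h y = (\<Sum>k\<in>{cell_index P n a..cell_index P n b}. \<phi> k * indicator (dcell P n k) y)"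
  using AE_bounded
proof eventually_elim
  case (elim y)
  have "(\<Sum>k\<in>{cell_index P n a..cell_index P n b}. \<phi> k * indicator (dcell P n k) y)
      = (\<Sum>k\<in>{cell_index P n y}. \<phi> k * indicator (dcell P n k) y)"
    using elim cell_index_mono [of a y P n] cell_index_mono [of y b P n]
    by (intro sum.mono_neutral_right) (auto simp: mem_dcell)
  then show ?case using assms by (simp add: mem_dcell)
qed

lemma integral_step_mult:
  fixes h f :: "real \<Rightarrow> real"
  assumes h: "h = (\<lambda>y. \<phi> (cell_index P n y))"
    and f: "f \<in> borel_measurable borel" "\<And>y. 0 \<le> f y \<and> f y \<le> W"
  shows "(\<integral>y. h y * f y \<partial>N)
    = (\<Sum>k\<in>{cell_index P n a..cell_index P n b}. \<phi> k * (\<integral>y. indicator (dcell P n k) y * f y \<partial>N))"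
proof -
  have int: "integrable N (\<lambda>y. indicator (dcell P n k) y * f y)" for k
    using f by (intro integrable_bounded [where W = W])
      (auto simp: indicator_def intro: order_trans)
  have hm: "h \<in> borel_measurable borel"
    unfolding h by measurable
  have "(\<integral>y. h y * f y \<partial>N)
    = (\<integral>y. (\<Sum>k\<in>{cell_index P n a..cell_index P n b}. \<phi> k * (indicator (dcell P n k) y * f y)) \<partial>N)"
  proof (rule integral_cong_AE)
    show "AE y in N. h y * f y =
      (\<Sum>k\<in>{cell_index P n a..cell_index P n b}. \<phi> k * (indicator (dcell P n k) y * f y))"
      using step_decompose [OF h] by eventually_elim (simp only: sum_distrib_right mult.assoc)
  qed (use f hm in measurable)
  also have "\<dots> = (\<Sum>k\<in>{cell_index P n a..cell_index P n b}.
      \<phi> k * (\<integral>y. indicator (dcell P n k) y * f y \<partial>N))"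
    using int by (simp add: Bochner_Integration.integral_sum)
  finally show ?thesis .
qed

text \<open>Both integrals are combinations of cell integrals with the same nonnegative
  coefficients, so a comparison on single cells suffices.\<close>

lemma integral_step_mono:
  assumes h: "step_fun P n h" "\<And>y. 0 \<le> h y"
    and f: "f \<in> borel_measurable borel" "\<And>y. 0 \<le> f y \<and> f y \<le> V"
    and g: "g \<in> borel_measurable borel" "\<And>y. 0 \<le> g y \<and> g y \<le> W"
    and le: "\<And>Q. Q \<in> dyadic_level P n \<Longrightarrow>
      (\<integral>y. indicator Q y * f y \<partial>N) \<le> (\<integral>y. indicator Q y * g y \<partial>N)"
  shows "(\<integral>y. h y * f y \<partial>N) \<le> (\<integral>y. h y * g y \<partial>N)"
proof -
  obtain \<phi>0 where \<phi>0: "h = (\<lambda>y. \<phi>0 (cell_index P n y))" using h(1) by (rule step_fun_factor)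
  \<comment> \<open>Truncation gives nonnegative coefficients without asking which indices are
    attained.\<close>
  define \<phi> where "\<phi> k = max 0 (\<phi>0 k)" for k
  have \<phi>: "h = (\<lambda>y. \<phi> (cell_index P n y))" using \<phi>0 h(2) by (auto simp: \<phi>_def max_def fun_eq_iff)
  show ?thesis
    unfolding integral_step_mult [OF \<phi> f] integral_step_mult [OF \<phi> g]
    by (intro sum_mono mult_left_mono le) (auto simp: \<phi>_def dyadic_level_eq)
qed

text \<open>The new density is \<open>h\<close> times the \<open>g\<close> of \<open>fills\<close>.
  Up to level \<open>L\<close>, \<open>h\<close> times the indicator of a cell is constant on cells
  of level \<open>L\<close>, so \<open>g\<close> costs a factor 1 + \<delta>. On finer levels
  \<open>h\<close> is merely bounded by \<open>W\<close>, and the smallness of \<open>g\<close>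
  against \<tau> takes over. Hence the maximum in the conclusion.\<close>

lemma fills_step:
  assumes U: "fills P N \<tau> U" and h: "step_fun P n h" "\<And>y. 0 \<le> h y \<and> h y \<le> W" and e: "0 < e"
    and \<tau>: "\<And>Q. 0 \<le> \<tau> Q"
  obtains h' n' W' K where "compact K" "K \<subseteq> U" "step_fun P n' h'" "\<And>y. 0 \<le> h' y \<and> h' y \<le> W'"
    "\<And>y. h' y \<noteq> 0 \<Longrightarrow> y \<in> K \<and> h y \<noteq> 0" "(\<integral>y. h y \<partial>N) - e \<le> (\<integral>y. h' y \<partial>N)"
    "\<And>Q. Q \<in> dyadic P \<Longrightarrow> (\<integral>y. indicator Q y * h' y \<partial>N)
        \<le> max ((1 + e) * (\<integral>y. indicator Q y * h y \<partial>N)) (e * \<tau> Q)"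
proof -
  have W: "0 \<le> W" using h(2) [of 0] by linarith
  define m where "m = measure N UNIV"
  have m: "0 \<le> m" by (simp add: m_def)
  \<comment> \<open>Small enough for three uses: \<delta> on coarse cells, \<delta> * W on fine
    cells and \<delta> * (W * (1 + m)) for the total mass are all at most \<open>e\<close>.\<close>
  define \<delta> where "\<delta> = e / (1 + W * (1 + m))"
  have pos: "1 + W * (1 + m) > 0" using W m by (simp add: add_pos_nonneg)
  have \<delta>: "0 < \<delta>" using e pos by (simp add: \<delta>_def)
  have "0 \<le> W * m" using W m by simp
  then have "\<delta> \<le> e / 1" "\<delta> * W \<le> e" "\<delta> * (W * (1 + m)) \<le> e"
    using e W m pos mult_nonneg_nonneg [of e "W * m"] mult_nonneg_nonneg [of e W]
    unfolding \<delta>_def by (simp_all add: field_simps)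
  note \<delta>_le = this
  \<comment> \<open>The level \<open>n\<close> of \<open>h\<close> is taken for \<open>G\<close>,
    which makes \<open>h\<close> a step function at level \<open>L\<close>.\<close>
  obtain L g K n' V where L: "n \<le> L" and K: "compact K" "K \<subseteq> U" and g: "step_fun P n' g"
    "\<And>y. 0 \<le> g y \<and> g y \<le> V" "\<And>y. y \<notin> K \<Longrightarrow> g y = 0"
    and A: "\<And>Q. Q \<in> dyadic_level P L \<Longrightarrow> (\<integral>y. indicator Q y * g y \<partial>N) \<le> (1 + \<delta>) * measure N Q"
    and A': "m - \<delta> \<le> (\<integral>y. g y \<partial>N)"
    and B: "\<And>l Q. L < l \<Longrightarrow> Q \<in> dyadic_level P l \<Longrightarrow> (\<integral>y. indicator Q y * g y \<partial>N) \<le> \<delta> * \<tau> Q"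
    using U [unfolded fills_def, rule_format, OF \<delta>, of n] unfolding m_def fills_at_def by blast
  have hm [measurable]: "h \<in> borel_measurable borel" and gm [measurable]: "g \<in> borel_measurable borel"
    using h g by (auto intro: step_fun_measurable)
  have V: "0 \<le> V" using g(2) [of 0] by linarith
  have hL: "step_fun P L h" using h(1) L by (rule step_fun_finer)
  have upper: "(\<integral>y. k y * g y \<partial>N) \<le> (1 + \<delta>) * (\<integral>y. k y \<partial>N)"
    if "step_fun P L k" "\<And>y. 0 \<le> k y" for k
  proof -
    have "(\<integral>y. k y * g y \<partial>N) \<le> (\<integral>y. k y * (1 + \<delta>) \<partial>N)"
      by (rule integral_step_mono [OF that gm g(2), where W = "1 + \<delta>"])
        (use A \<delta> in \<open>auto simp: mult.commute dyadic_level_eq\<close>)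
    then show ?thesis by (simp add: mult.commute)
  qed
  define h' where "h' = (\<lambda>y. h y * g y)"
  have h'b: "0 \<le> h' y \<and> h' y \<le> W * V" for y
    unfolding h'_def using h(2) [of y] g(2) [of y] W by (auto intro: mult_mono)
  have inth: "integrable N h" using hm h(2) by (rule integrable_bounded)
  have intg: "integrable N g" using gm g(2) by (rule integrable_bounded)
  have inth': "integrable N h'" using h'b by (intro integrable_bounded) (auto simp: h'_def)
  have lower: "(\<integral>y. h y \<partial>N) - e \<le> (\<integral>y. h' y \<partial>N)"
  proof -
    \<comment> \<open>The lower bound for \<open>h'\<close> is an upper bound for the complementary
      density \<open>W - h\<close>: the mass of \<open>g\<close> is nearly \<open>m\<close>, and
      what \<open>W - h\<close> does not receive goes to \<open>h\<close>.\<close>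
    have "(\<integral>y. (W - h y) * g y \<partial>N) \<le> (1 + \<delta>) * (\<integral>y. W - h y \<partial>N)"
    proof (rule upper)
      show "step_fun P L (\<lambda>y. W - h y)"
        using hL unfolding step_fun_def by metis
      show "0 \<le> W - h y" for y using h(2) [of y] by simp
    qed
    also have "(\<integral>y. W - h y \<partial>N) = W * m - (\<integral>y. h y \<partial>N)"
      using inth by (simp add: m_def)
    also have "(\<integral>y. (W - h y) * g y \<partial>N) = (\<integral>y. W * g y - h' y \<partial>N)"
      by (simp add: h'_def left_diff_distrib)
    also have "\<dots> = W * (\<integral>y. g y \<partial>N) - (\<integral>y. h' y \<partial>N)"
      using intg inth' by simp
    finally have 1: "W * (\<integral>y. g y \<partial>N) - (\<integral>y. h' y \<partial>N) \<le> (1 + \<delta>) * (W * m - (\<integral>y. h y \<partial>N))" .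
    have 2: "W * (m - \<delta>) \<le> W * (\<integral>y. g y \<partial>N)" using A' W by (rule mult_left_mono)
    have 3: "0 \<le> \<delta> * (\<integral>y. h y \<partial>N)" using \<delta> h(2) by (simp add: integral_nonneg_AE)
    show ?thesis using 1 2 3 \<delta>_le(3) by (simp add: algebra_simps)
  qed
  have Q: "(\<integral>y. indicator Q y * h' y \<partial>N)
          \<le> max ((1 + e) * (\<integral>y. indicator Q y * h y \<partial>N)) (e * \<tau> Q)" if Qd: "Q \<in> dyadic P" for Q
  proof -
    obtain l k where lk: "Q = dcell P l k" using Qd unfolding dyadic_def dyadic_level_eq by blast
    show ?thesis
    proof (cases "l \<le> L")
      case True
      have "(\<integral>y. indicator Q y * h' y \<partial>N) = (\<integral>y. (indicator Q y * h y) * g y \<partial>N)"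
        by (simp add: h'_def mult.assoc)
      also have "\<dots> \<le> (1 + \<delta>) * (\<integral>y. indicator Q y * h y \<partial>N)"
      proof (rule upper)
        show "step_fun P L (\<lambda>y. indicator Q y * h y)"
          unfolding lk by (rule step_fun_mult [OF step_fun_indicator [OF True] hL])
        show "0 \<le> indicator Q y * h y" for y using h(2) [of y] by simp
      qed
      also have "\<dots> \<le> (1 + e) * (\<integral>y. indicator Q y * h y \<partial>N)"
        using \<delta>_le h(2) by (intro mult_right_mono integral_nonneg_AE) auto
      finally show ?thesis by simp
    next
      case False
      have Qm [measurable]: "Q \<in> sets borel" by (simp add: lk)
      have "(\<integral>y. indicator Q y * h' y \<partial>N) \<le> (\<integral>y. W * (indicator Q y * g y) \<partial>N)"
      proof (rule integral_mono)
        show "integrable N (\<lambda>y. indicator Q y * h' y)"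
          using h'b V W by (intro integrable_bounded [where W = "W * V"]) (auto simp: h'_def indicator_def)
        show "integrable N (\<lambda>y. W * (indicator Q y * g y))"
          using g(2) V by (intro integrable_mult_right integrable_bounded [where W = V]) (auto simp: indicator_def)
        show "indicator Q y * h' y \<le> W * (indicator Q y * g y)" for y
          using h(2) [of y] g(2) [of y] by (auto simp: h'_def indicator_def intro: mult_right_mono)
      qed
      also have "\<dots> = W * (\<integral>y. indicator Q y * g y \<partial>N)" by simp
      also have "\<dots> \<le> W * (\<delta> * \<tau> Q)"
        using B [of l Q] False W lk by (intro mult_left_mono) (auto simp: dyadic_level_eq)
      also have "\<dots> = (\<delta> * W) * \<tau> Q" by simp
      also have "\<dots> \<le> e * \<tau> Q" using \<delta>_le \<tau> by (intro mult_right_mono) auto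
      finally show ?thesis by simp
    qed
  qed
  have st: "step_fun P (max L n') h'"
    unfolding h'_def using hL g(1) by (intro step_fun_mult) (auto intro: step_fun_finer)
  have nz: "y \<in> K \<and> h y \<noteq> 0" if "h' y \<noteq> 0" for y
    using g(3) [of y] that by (auto simp: h'_def)
  show thesis
    by (rule that [OF K st h'b nz lower Q])
qed

text \<open>Starting from the indicator of \<open>D\<close>, \<open>fills_step\<close> is applied to
  \<open>U 0\<close>, \<open>U 1\<close> and so on with summable losses. Supports shrink, so
  \<open>h i\<close> lives on all compact sets chosen before it. No limit density is formed, since a
  compactness argument will involve only finitely many of these sets.\<close>

lemma fills_sequence:
  assumes U: "\<And>i. fills P N \<tau> (U i)" and D: "D \<in> dyadic P" and e: "0 < e" "e < 1"
    and \<tau>: "\<And>Q. 0 \<le> \<tau> Q" and A: "0 < A" "\<And>Q. Q \<in> dyadic P \<Longrightarrow> measure N (Q \<inter> D) \<le> A * \<tau> Q"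
  obtains h and K :: "nat \<Rightarrow> real set" where "\<And>i. compact (K i)" "\<And>i. K i \<subseteq> U i"
    "\<And>i. h i \<in> borel_measurable borel" "\<And>i. \<exists>W. \<forall>y. 0 \<le> h i y \<and> h i y \<le> (W::real)"
    "\<And>i y. h i y \<noteq> 0 \<Longrightarrow> y \<in> D \<and> (\<forall>j<i. y \<in> K j)" "\<And>i. measure N D - e \<le> (\<integral>y. h i y \<partial>N)"
    "\<And>i Q. Q \<in> dyadic P \<Longrightarrow> (\<integral>y. indicator Q y * h i y \<partial>N) \<le> (1 + e) * A * \<tau> Q"
proof -
  obtain d k where D_eq: "D = dcell P d k" using D unfolding dyadic_def dyadic_level_eq by blast
  have Dm: "D \<in> sets borel" by (simp add: D_eq)
  \<comment> \<open>The accumulated loss after \<open>i\<close> steps, always below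
    \<open>e\<close>.\<close>
  define c where "c i = e * (1 - (1/2)^i)" for i :: nat
  \<comment> \<open>A state holds a density, its level, its upper bound and the compact set used
    last.\<close>
  define R where "R i s \<longleftrightarrow> (case s of (h, n, W, K) \<Rightarrow> step_fun P n h \<and> (\<forall>y. 0 \<le> h y \<and> h y \<le> W)
      \<and> (\<forall>y. h y \<noteq> 0 \<longrightarrow> y \<in> D) \<and> measure N D - c i \<le> (\<integral>y. h y \<partial>N)
      \<and> (\<forall>Q\<in>dyadic P. (\<integral>y. indicator Q y * h y \<partial>N) \<le> (1 + c i) * A * \<tau> Q))"
    for i :: nat and s :: "(real \<Rightarrow> real) \<times> int \<times> real \<times> real set"
  define S where "S i s s' \<longleftrightarrow> (case s of (h, n, W, K) \<Rightarrow> case s' of (h', n', W', K') \<Rightarrow>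
      compact K' \<and> K' \<subseteq> U i \<and> (\<forall>y. h' y \<noteq> 0 \<longrightarrow> y \<in> K' \<and> h y \<noteq> 0))"
    for i :: nat and s s' :: "(real \<Rightarrow> real) \<times> int \<times> real \<times> real set"
  have c_less: "0 \<le> c i" "c i < e" for i
    using e by (auto simp: c_def power_le_one)
  have ind: "(\<integral>y. indicator Q y * indicator D y \<partial>N) = measure N (Q \<inter> D)" for Q
    by (simp flip: indicator_inter_arith)
  have "R 0 (indicator D, d, 1, {})"
    unfolding R_def prod.case
  proof (intro conjI allI ballI impI)
    show "step_fun P d (indicat_real D)" unfolding D_eq by (rule step_fun_indicator) simp
    show "measure N D - c 0 \<le> integral\<^sup>L N (indicat_real D)" by (simp add: c_def)
    show "(\<integral>y. indicator Q y * indicator D y \<partial>N) \<le> (1 + c 0) * A * \<tau> Q" if "Q \<in> dyadic P" for Q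
      unfolding ind using A(2) [OF that] by (simp add: c_def)
  qed (auto simp: indicator_def split: if_splits)
  then have ex0: "\<exists>s. R 0 s" ..
  have exS: "\<exists>s'. R (Suc i) s' \<and> S i s s'" if Rs: "R i s" for i s
  proof -
    obtain h n W K where s: "s = (h, n, W, K)" by (cases s)
    have R: "step_fun P n h" "\<And>y. 0 \<le> h y \<and> h y \<le> W" "\<And>y. h y \<noteq> 0 \<Longrightarrow> y \<in> D"
      "measure N D - c i \<le> (\<integral>y. h y \<partial>N)"
      "\<And>Q. Q \<in> dyadic P \<Longrightarrow> (\<integral>y. indicator Q y * h y \<partial>N) \<le> (1 + c i) * A * \<tau> Q"
      using Rs unfolding s R_def by auto
    \<comment> \<open>The bound \<open>A\<close> keeps \<epsilon> * \<tau> Q below A * \<tau> Q; the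
      other bound keeps (1 + \<epsilon>) * (1 + c i) below 1 + c (Suc i).\<close>
    define \<epsilon> where "\<epsilon> = min A (e * (1/2)^Suc i / (1 + e))"
    have \<epsilon>: "0 < \<epsilon>" using A e by (simp add: \<epsilon>_def)
    have "\<epsilon> * (1 + e) \<le> e * (1/2)^Suc i / (1 + e) * (1 + e)"
      using e unfolding \<epsilon>_def by (intro mult_right_mono) auto
    also have "\<dots> = e * (1/2)^Suc i"
    proof -
      have "q / (1 + e) * (1 + e) = q" for q using e by simp
      then show ?thesis .
    qed
    finally have \<epsilon>1: "\<epsilon> * (1 + e) \<le> e * (1/2)^Suc i" .
    have cS: "c (Suc i) = c i + e * (1/2)^Suc i" by (simp add: c_def algebra_simps)
    have "\<epsilon> * 1 \<le> \<epsilon> * (1 + e)" using \<epsilon> e by (intro mult_left_mono) auto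
    then have \<epsilon>2: "c i + \<epsilon> \<le> c (Suc i)" using \<epsilon>1 cS by simp
    have "\<epsilon> * (1 + c i) \<le> \<epsilon> * (1 + e)" using \<epsilon> c_less [of i] by (intro mult_left_mono) auto
    then have \<epsilon>3: "(1 + \<epsilon>) * (1 + c i) \<le> 1 + c (Suc i)" using \<epsilon>1 cS by (simp add: algebra_simps)
    obtain h' n' W' K' where h': "compact K'" "K' \<subseteq> U i" "step_fun P n' h'" "\<And>y. 0 \<le> h' y \<and> h' y \<le> W'"
      "\<And>y. h' y \<noteq> 0 \<Longrightarrow> y \<in> K' \<and> h y \<noteq> 0" "(\<integral>y. h y \<partial>N) - \<epsilon> \<le> (\<integral>y. h' y \<partial>N)"
      "\<And>Q. Q \<in> dyadic P \<Longrightarrow> (\<integral>y. indicator Q y * h' y \<partial>N)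
          \<le> max ((1 + \<epsilon>) * (\<integral>y. indicator Q y * h y \<partial>N)) (\<epsilon> * \<tau> Q)"
      by (rule fills_step [OF U [of i] R(1,2) \<epsilon> \<tau>]) (rule that)
    have "(\<integral>y. indicator Q y * h' y \<partial>N) \<le> (1 + c (Suc i)) * A * \<tau> Q" if "Q \<in> dyadic P" for Q
    proof -
      have "(1 + \<epsilon>) * (\<integral>y. indicator Q y * h y \<partial>N) \<le> (1 + \<epsilon>) * ((1 + c i) * A * \<tau> Q)"
        using R(5) [OF that] \<epsilon> by (intro mult_left_mono) auto
      also have "\<dots> = ((1 + \<epsilon>) * (1 + c i)) * (A * \<tau> Q)" by simp
      also have "\<dots> \<le> (1 + c (Suc i)) * (A * \<tau> Q)"
        using \<epsilon>3 A \<tau> by (intro mult_right_mono) auto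
      finally have 1: "(1 + \<epsilon>) * (\<integral>y. indicator Q y * h y \<partial>N) \<le> (1 + c (Suc i)) * A * \<tau> Q" by simp
      have "\<epsilon> * \<tau> Q \<le> 1 * (A * \<tau> Q)" using \<tau> by (auto simp: \<epsilon>_def intro: mult_right_mono)
      also have "\<dots> \<le> (1 + c (Suc i)) * (A * \<tau> Q)"
        using c_less [of "Suc i"] A \<tau> by (intro mult_right_mono) auto
      finally have 2: "\<epsilon> * \<tau> Q \<le> (1 + c (Suc i)) * A * \<tau> Q" by simp
      show ?thesis using h'(7) [OF that] 1 2 by linarith
    qed
    then have "R (Suc i) (h', n', W', K')"
      unfolding R_def prod.case
    proof (intro conjI allI ballI impI)
      show "y \<in> D" if "h' y \<noteq> 0" for y using R(3) h'(5) that by blast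
      show "measure N D - c (Suc i) \<le> integral\<^sup>L N h'" using h'(6) R(4) \<epsilon>2 by linarith
    qed (use h' in auto)
    moreover have "S i s (h', n', W', K')"
      unfolding S_def s prod.case using h'(1,2,5) by (intro conjI allI impI) auto
    ultimately show ?thesis by blast
  qed
  obtain f where f: "\<And>i. R i (f i)" "\<And>i. S i (f i) (f (Suc i))"
    using dependent_nat_choice [of R S, OF ex0 exS] by blast
  define h where "h i = fst (f i)" for i
  define K where "K i = snd (snd (snd (f (Suc i))))" for i
  have nz: "h i y \<noteq> 0 \<longrightarrow> y \<in> D \<and> (\<forall>j<i. y \<in> K j)" for i y
  proof (induction i)
    case 0
    then show ?case using f(1) [of 0] by (auto simp: R_def h_def split: prod.splits)
  next
    case (Suc i)
    have "h (Suc i) y \<noteq> 0 \<longrightarrow> y \<in> K i \<and> h i y \<noteq> 0"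
      using f(2) [of i] by (auto simp: S_def h_def K_def split: prod.splits)
    then show ?case using Suc by (auto simp: less_Suc_eq)
  qed
  have K: "compact (K i) \<and> K i \<subseteq> U i" for i
    using f(2) [of i] by (auto simp: S_def K_def split: prod.splits)
  have h: "h i \<in> borel_measurable borel \<and> (\<exists>W. \<forall>y. 0 \<le> h i y \<and> h i y \<le> W)
      \<and> measure N D - e \<le> (\<integral>y. h i y \<partial>N)
      \<and> (\<forall>Q\<in>dyadic P. (\<integral>y. indicator Q y * h i y \<partial>N) \<le> (1 + e) * A * \<tau> Q)" for i
  proof -
    obtain n W where R: "step_fun P n (h i)" "\<And>y. 0 \<le> h i y \<and> h i y \<le> W"
      "measure N D - c i \<le> (\<integral>y. h i y \<partial>N)"
      "\<And>Q. Q \<in> dyadic P \<Longrightarrow> (\<integral>y. indicator Q y * h i y \<partial>N) \<le> (1 + c i) * A * \<tau> Q"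
      using f(1) [of i] unfolding R_def h_def by (cases "f i") (simp, blast)
    have le: "(1 + c i) * A * \<tau> Q \<le> (1 + e) * A * \<tau> Q" for Q
      using c_less [of i] A \<tau> by (intro mult_right_mono) auto
    have "measure N D - e \<le> (\<integral>y. h i y \<partial>N)" using R(3) c_less(2) [of i] by linarith
    moreover have "\<forall>Q\<in>dyadic P. (\<integral>y. indicator Q y * h i y \<partial>N) \<le> (1 + e) * A * \<tau> Q"
      using R(4) le by (blast intro: order_trans)
    ultimately show ?thesis using step_fun_measurable [OF R(1)] R(2) by blast
  qed
  show thesis
    by (rule that [of K h]) (use nz K h in blast)+
qed

end

section \<open>Covers of countable intersections of filled sets\<close>

lemma sum_Un_le:
  fixes f :: "'a \<Rightarrow> real"
  assumes "finite A" "finite B" "\<And>x. 0 \<le> f x"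
  shows "sum f (A \<union> B) \<le> sum f A + sum f B"
  using assms by (simp add: sum_Un sum_nonneg)

lemma sum_UN_le:
  fixes f :: "'a \<Rightarrow> real"
  assumes "finite I" "\<And>i. finite (A i)" "\<And>x. 0 \<le> f x"
  shows "sum f (\<Union>i\<in>I. A i) \<le> (\<Sum>i\<in>I. sum f (A i))"
  using assms(1)
proof (induction rule: finite_induct)
  case (insert i I)
  have "sum f (A i \<union> (\<Union>i\<in>I. A i)) \<le> sum f (A i) + sum f (\<Union>i\<in>I. A i)"
    using insert assms by (intro sum_Un_le) auto
  then show ?case using insert by simp
qed simp

lemma ball_subset_cells:
  "ball u (2 powi (- n)) \<subseteq> (\<Union>i\<in>{-1, 0, 1}. dcell P n (cell_index P n u + i))"
proof
  fix y assume "y \<in> ball u (2 powi (- n))"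
  then have "\<bar>u - y\<bar> * 2 powi n < 2 powi (- n) * 2 powi n"
    by (intro mult_strict_right_mono) (auto simp: dist_real_def)
  then have "\<bar>(u - P) * 2 powi n - (y - P) * 2 powi n\<bar> < 1"
    by (simp add: power_int_minus abs_mult flip: left_diff_distrib)
  then have "\<bar>cell_index P n u - cell_index P n y\<bar> \<le> 1"
    unfolding cell_index_def by linarith
  then have "cell_index P n y - cell_index P n u \<in> {-1, 0, 1}" by auto
  moreover have "y \<in> dcell P n (cell_index P n u + (cell_index P n y - cell_index P n u))"
    unfolding mem_dcell by simp
  ultimately show "y \<in> (\<Union>i\<in>{-1, 0, 1}. dcell P n (cell_index P n u + i))" by blast
qed

lemma dcell_dyadic [simp]: "dcell P n k \<in> dyadic P"
  unfolding dyadic_def dyadic_level_eq by blast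

context bounded_line_measure
begin

text \<open>The closure of \<open>D\<close> is covered by open sets: the cells of \<open>C\<close>
  enlarged at their left endpoints, a ball at the right endpoint of \<open>D\<close>, and the
  complements of all \<open>K j\<close>. A finite subcover involves only \<open>K j\<close> with
  \<open>j < i\<close> for some \<open>i\<close>, and the support of \<open>h i\<close> lies in all
  of these. So finitely many cells cover this support, and their \<tau>-sum, up to the factor (1 +
  e) * A, dominates the mass of \<open>h i\<close>.\<close>

lemma fills_cover_approx:
  assumes U: "\<And>i. fills P N \<tau> (U i)" and D: "D \<in> dyadic P" and e: "0 < e" "e < 1"
    and \<tau>: "\<And>Q. 0 \<le> \<tau> Q" and A: "0 < A" "\<And>Q. Q \<in> dyadic P \<Longrightarrow> measure N (Q \<inter> D) \<le> A * \<tau> Q"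
    and small: "\<And>e. 0 < e \<Longrightarrow> \<exists>n. \<forall>k. \<tau> (dcell P n k) \<le> e"
    and C: "countable C" "C \<subseteq> dyadic P" "D \<inter> (\<Inter>i::nat. U i) \<subseteq> \<Union>C"
    and S: "\<And>C0. finite C0 \<Longrightarrow> C0 \<subseteq> C \<Longrightarrow> sum \<tau> C0 \<le> S"
  shows "measure N D - e \<le> (1 + e) * A * (S + 9 * e)"
proof -
  obtain h K where hK: "\<And>i. compact (K i)" "\<And>i. K i \<subseteq> U i" "\<And>i. h i \<in> borel_measurable borel"
    "\<And>i. \<exists>W. \<forall>y. 0 \<le> h i y \<and> h i y \<le> (W::real)"
    "\<And>i y. h i y \<noteq> 0 \<Longrightarrow> y \<in> D \<and> (\<forall>j<i. y \<in> K j)" "\<And>i. measure N D - e \<le> (\<integral>y. h i y \<partial>N)"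
    "\<And>i Q. Q \<in> dyadic P \<Longrightarrow> (\<integral>y. indicator Q y * h i y \<partial>N) \<le> (1 + e) * A * \<tau> Q"
    by (rule fills_sequence [of P \<tau> U D e A];
        (rule U D e \<tau> A(1) | erule A(2) | (rule that; assumption)))
  obtain d k where D_eq: "D = dcell P d k" using D unfolding dyadic_def dyadic_level_eq by blast
  define lo where "lo = P + real_of_int k * 2 powi (- d)"
  define hi where "hi = P + (real_of_int k + 1) * 2 powi (- d)"
  have D_ivl: "D = {lo..<hi}" by (simp add: D_eq dcell_def lo_def hi_def)
  \<comment> \<open>A level on which every cell costs at most \<open>e\<close>; it supplies cheap
    neighbourhoods of endpoints.\<close>
  define nu where "nu e = (SOME n. \<forall>k. \<tau> (dcell P n k) \<le> e)" for e
  have nu: "\<tau> (dcell P (nu e) k) \<le> e" if "0 < e" for e k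
    using someI_ex [OF small [OF that]] unfolding nu_def by blast
  define left where "left Q = Inf Q" for Q :: "real set"
  have left: "\<exists>r. left Q < r \<and> Q = {left Q..<r}" if QC: "Q \<in> C" for Q
  proof -
    obtain n k where Q: "Q = dcell P n k" using QC C(2) unfolding dyadic_def dyadic_level_eq by blast
    have less: "P + real_of_int k * 2 powi (- n) < P + (real_of_int k + 1) * 2 powi (- n)" by simp
    then show ?thesis unfolding left_def Q dcell_def
      by (intro exI [of _ "P + (real_of_int k + 1) * 2 powi (- n)"]) (simp add: cInf_atLeastLessThan)
  qed
  \<comment> \<open>The allowance for enlarging the cell \<open>Q\<close>; over all of
    \<open>C\<close> it adds up to at most 2 * e.\<close>
  define w where "w Q = e * (1/2) ^ to_nat_on C Q" for Q
  have w: "0 < w Q" for Q using e by (simp add: w_def)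
  define B where "B u \<epsilon> = ball u (2 powi (- nu \<epsilon>))" for u \<epsilon> :: real
  define Nb where "Nb u \<epsilon> = (\<lambda>i. dcell P (nu \<epsilon>) (cell_index P (nu \<epsilon>) u + i)) ` {-1, 0, 1}" for u \<epsilon> :: real
  have B_sub: "B u \<epsilon> \<subseteq> \<Union>(Nb u \<epsilon>)" for u \<epsilon>
    unfolding B_def Nb_def using ball_subset_cells by blast
  have B_open: "open (B u \<epsilon>)" and B_self: "u \<in> B u \<epsilon>" for u \<epsilon> by (simp_all add: B_def)
  have Nb: "finite (Nb u \<epsilon>)" "Nb u \<epsilon> \<subseteq> dyadic P" for u \<epsilon> by (auto simp: Nb_def)
  have Nb_sum: "sum \<tau> (Nb u \<epsilon>) \<le> 3 * \<epsilon>" if "0 < \<epsilon>" for u \<epsilon>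
  proof -
    have "sum \<tau> (Nb u \<epsilon>) \<le> (\<Sum>i\<in>{-1, 0, 1}. \<tau> (dcell P (nu \<epsilon>) (cell_index P (nu \<epsilon>) u + i)))"
      unfolding Nb_def by (rule order_trans [OF sum_image_le]) (use \<tau> in \<open>auto simp: o_def\<close>)
    also have "\<dots> \<le> (\<Sum>i\<in>{-1, 0, 1::int}. \<epsilon>)" by (intro sum_mono nu that)
    finally show ?thesis by simp
  qed
  \<comment> \<open>\<open>Inl\<close> marks cells of \<open>C\<close>, \<open>Inr 0\<close> the
    right endpoint of \<open>D\<close>, \<open>Inr (Suc j)\<close> the complement of
    \<open>K j\<close>.\<close>
  define O' where "O' z = (case z of Inl Q \<Rightarrow> Q \<union> B (left Q) (w Q)
      | Inr n \<Rightarrow> (case n of 0 \<Rightarrow> B hi e | Suc j \<Rightarrow> - K j))" for z :: "real set + nat"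
  have O_open: "open (O' z)" if "z \<in> Inl ` C \<union> range Inr" for z
  proof (cases z)
    case (Inl Q)
    then have "Q \<in> C" using that by auto
    then obtain r where Q: "Q = {left Q..<r}" using left by blast
    have "{x..<r} \<union> B x \<epsilon> = {x<..<r} \<union> B x \<epsilon>" for x \<epsilon>
      using B_self [of x \<epsilon>] by (auto simp: order_less_le)
    then have "O' z = {left Q<..<r} \<union> B (left Q) (w Q)"
      unfolding O'_def Inl sum.case by (metis Q)
    then show ?thesis using B_open by auto
  next
    case (Inr n)
    then show ?thesis using B_open hK(1) by (cases n) (auto simp: O'_def compact_imp_closed)
  qed
  have "{lo..hi} \<subseteq> (\<Union>z\<in>Inl ` C \<union> range Inr. O' z)"
  proof
    fix y assume y: "y \<in> {lo..hi}"
    show "y \<in> (\<Union>z\<in>Inl ` C \<union> range Inr. O' z)"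
    proof (cases "y = hi")
      case True
      then have "y \<in> O' (Inr 0)" using B_self by (simp add: O'_def)
      then show ?thesis by blast
    next
      case False
      then have yD: "y \<in> D" using y by (simp add: D_ivl)
      show ?thesis
      proof (cases "\<forall>j. y \<in> K j")
        case True
        then have "y \<in> \<Union>C" using yD C(3) hK(2) by blast
        then obtain Q where "Q \<in> C" "y \<in> O' (Inl Q)" by (auto simp: O'_def)
        then show ?thesis by blast
      next
        case False
        then obtain j where "y \<in> O' (Inr (Suc j))" by (auto simp: O'_def)
        then show ?thesis by blast
      qed
    qed
  qed
  then obtain Z where Z: "Z \<subseteq> Inl ` C \<union> range Inr" "finite Z" "{lo..hi} \<subseteq> (\<Union>z\<in>Z. O' z)"
    using compactE_image [of "{lo..hi}" "Inl ` C \<union> range Inr" O'] O_open by (metis compact_Icc)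
  define C0 where "C0 = {Q. Inl Q \<in> Z}"
  have C0: "finite C0" "C0 \<subseteq> C"
  proof -
    have "finite (Inl -` Z)" using Z(2) by (rule finite_vimageI) simp
    then show "finite C0" by (simp add: C0_def vimage_def)
    show "C0 \<subseteq> C" using Z(1) by (auto simp: C0_def)
  qed
  have "finite (Inr -` Z)" using Z(2) by (rule finite_vimageI) simp
  then obtain i where i: "\<And>j. Inr j \<in> Z \<Longrightarrow> j < i" by (metis bounded_nat_set_is_finite finite_nat_set_iff_bounded vimageI2)
  define \<C> where "\<C> = C0 \<union> (\<Union>Q\<in>C0. Nb (left Q) (w Q)) \<union> Nb hi e"
  have \<C>: "finite \<C>" "\<C> \<subseteq> dyadic P" unfolding \<C>_def using C0 C(2) Nb by (simp, blast)
  have cov: "y \<in> \<Union>\<C>" if "h i y \<noteq> 0" for y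
  proof -
    have "y \<in> D" and yK: "\<And>j. j < i \<Longrightarrow> y \<in> K j" using hK(5) that by auto
    then have "y \<in> {lo..hi}" by (simp add: D_ivl)
    then obtain z where z: "z \<in> Z" "y \<in> O' z" using Z(3) by blast
    show ?thesis
    proof (cases z)
      case (Inl Q)
      then have "Q \<in> C0" using z by (simp add: C0_def)
      moreover have "y \<in> Q \<or> y \<in> \<Union>(Nb (left Q) (w Q))"
        using z(2) Inl B_sub [of "left Q" "w Q"] by (auto simp: O'_def)
      ultimately show ?thesis by (auto simp: \<C>_def)
    next
      case (Inr n)
      have n: "n < i" using i z Inr by auto
      show ?thesis
      proof (cases n)
        case 0
        then have "y \<in> \<Union>(Nb hi e)" using z(2) Inr B_sub [of hi e] by (auto simp: O'_def)
        then show ?thesis by (auto simp: \<C>_def)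
      next
        case (Suc j)
        then show ?thesis using z(2) Inr yK [of j] n by (auto simp: O'_def)
      qed
    qed
  qed
  obtain W where W: "\<And>y. 0 \<le> h i y \<and> h i y \<le> W" using hK(4) by blast
  have Qint: "integrable N (\<lambda>y. indicator Q y * h i y)" if "Q \<in> \<C>" for Q
  proof (rule integrable_bounded)
    have "Q \<in> sets borel" using that \<C>(2) unfolding dyadic_def dyadic_level_eq by auto
    then show "(\<lambda>y. indicator Q y * h i y) \<in> borel_measurable borel" using hK(3) by measurable
    show "0 \<le> indicator Q y * h i y \<and> indicator Q y * h i y \<le> W" for y
      using W [of y] by (auto simp: indicator_def)
  qed
  have "(\<integral>y. h i y \<partial>N) \<le> (\<integral>y. (\<Sum>Q\<in>\<C>. indicator Q y * h i y) \<partial>N)"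
  proof (rule integral_mono)
    show "integrable N (h i)" using hK(3) W by (rule integrable_bounded)
    show "integrable N (\<lambda>y. \<Sum>Q\<in>\<C>. indicator Q y * h i y)" using Qint by auto
    show "h i y \<le> (\<Sum>Q\<in>\<C>. indicator Q y * h i y)" for y
    proof (cases "h i y = 0")
      case False
      then obtain Q where Q: "Q \<in> \<C>" "y \<in> Q" using cov by blast
      have "indicator Q y * h i y \<le> (\<Sum>Q\<in>\<C>. indicator Q y * h i y)"
        using Q \<C>(1) W by (intro member_le_sum) auto
      then show ?thesis using Q by simp
    qed simp
  qed
  also have "\<dots> = (\<Sum>Q\<in>\<C>. \<integral>y. indicator Q y * h i y \<partial>N)"
    using Qint by (simp add: Bochner_Integration.integral_sum)
  also have "\<dots> \<le> (\<Sum>Q\<in>\<C>. (1 + e) * A * \<tau> Q)"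
    using hK(7) \<C>(2) by (intro sum_mono) auto
  also have "\<dots> = (1 + e) * A * sum \<tau> \<C>" by (simp add: sum_distrib_left)
  also have "\<dots> \<le> (1 + e) * A * (S + 9 * e)"
  proof (intro mult_left_mono)
    have "sum \<tau> \<C> \<le> sum \<tau> (C0 \<union> (\<Union>Q\<in>C0. Nb (left Q) (w Q))) + sum \<tau> (Nb hi e)"
      unfolding \<C>_def using C0 Nb \<tau> by (intro sum_Un_le) auto
    also have "sum \<tau> (C0 \<union> (\<Union>Q\<in>C0. Nb (left Q) (w Q))) \<le> sum \<tau> C0 + sum \<tau> (\<Union>Q\<in>C0. Nb (left Q) (w Q))"
      using C0 Nb \<tau> by (intro sum_Un_le) auto
    also have "sum \<tau> (\<Union>Q\<in>C0. Nb (left Q) (w Q)) \<le> (\<Sum>Q\<in>C0. sum \<tau> (Nb (left Q) (w Q)))"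
      using C0(1) Nb \<tau> by (intro sum_UN_le) auto
    also have "\<dots> \<le> (\<Sum>Q\<in>C0. 3 * w Q)" by (intro sum_mono Nb_sum w)
    also have "\<dots> = 3 * e * (\<Sum>Q\<in>C0. (1/2) ^ to_nat_on C Q)"
      by (simp add: w_def sum_distrib_left mult.assoc)
    also have "(\<Sum>Q\<in>C0. (1/2) ^ to_nat_on C Q) = (\<Sum>n\<in>to_nat_on C ` C0. (1/2::real) ^ n)"
      using inj_on_subset [OF inj_on_to_nat_on [OF C(1)] C0(2)] by (simp add: sum.reindex)
    also have "\<dots> \<le> (\<Sum>n. (1/2::real) ^ n)"
      using C0(1) by (intro sum_le_suminf) auto
    also have "\<dots> = 2" by (simp add: suminf_geometric)
    \<comment> \<open>The enlargements at left endpoints cost three cells each, 3 * (2 * e) in all;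
      the ball at \<open>hi\<close> adds 3 * e.\<close>
    finally show "sum \<tau> \<C> \<le> S + 9 * e"
      using S [OF C0] Nb_sum [OF e(1), of hi] e by simp
  qed (use e A in auto)
  finally show ?thesis using hK(6) [of i] by linarith
qed

text \<open>The limit of \<open>fills_cover_approx\<close> as \<open>e\<close> tends to 0. Bounding
  the cost of \<open>C\<close> through its finite partial sums serves both net contents and
  Hausdorff sums.\<close>

theorem fills_cover:
  assumes U: "\<And>i. fills P N \<tau> (U i)" and D: "D \<in> dyadic P"
    and \<tau>: "\<And>Q. 0 \<le> \<tau> Q" and A: "0 < A" "\<And>Q. Q \<in> dyadic P \<Longrightarrow> measure N (Q \<inter> D) \<le> A * \<tau> Q"
    and small: "\<And>e. 0 < e \<Longrightarrow> \<exists>n. \<forall>k. \<tau> (dcell P n k) \<le> e"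
    and C: "countable C" "C \<subseteq> dyadic P" "D \<inter> (\<Inter>i::nat. U i) \<subseteq> \<Union>C"
    and S: "\<And>C0. finite C0 \<Longrightarrow> C0 \<subseteq> C \<Longrightarrow> sum \<tau> C0 \<le> S"
  shows "measure N D \<le> A * S"
proof -
  have ev: "eventually (\<lambda>e. measure N D \<le> e + (1 + e) * A * (S + 9 * e)) (at_right 0)"
    unfolding eventually_at_right_field
  proof (intro exI [of _ 1] conjI allI impI)
    fix e :: real assume "0 < e" "e < 1"
    from fills_cover_approx [OF U D this \<tau> A small C S]
    show "measure N D \<le> e + (1 + e) * A * (S + 9 * e)" by linarith
  qed simp
  have "((\<lambda>e. e + (1 + e) * A * (S + 9 * e)) \<longlongrightarrow> 0 + (1 + 0) * A * (S + 9 * 0)) (at_right 0)"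
    by (intro tendsto_intros)
  from tendsto_lowerbound [OF this ev] show ?thesis by simp
qed

end

section \<open>Functions of bounded variation\<close>

text \<open>Partitions run through the whole line and the bound is real, so one \<open>B\<close>
  bounds \<open>total_variation\<close> on every set and the estimates stay out of
  \<open>ennreal\<close>.\<close>

definition variation_le :: "(real \<Rightarrow> real) \<Rightarrow> real \<Rightarrow> bool" where
  "variation_le g B \<longleftrightarrow> (\<forall>t n. incseq t \<longrightarrow> (\<Sum>i<n. \<bar>g (t (Suc i)) - g (t (i::nat))\<bar>) \<le> B)"

lemma variation_le_nonneg: "variation_le g B \<Longrightarrow> 0 \<le> B"
  unfolding variation_le_def by (metis incseq_const lessThan_0 sum.empty)

lemma total_variation_le:
  assumes "variation_le g B"
  shows "total_variation S g \<le> ennreal B"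
  unfolding total_variation_def
proof (rule SUP_least, clarify)
  fix t :: "nat \<Rightarrow> real" and n :: nat
  assume "incseq t"
  then have "(\<Sum>i<n. \<bar>g (t (Suc i)) - g (t i)\<bar>) \<le> B" using assms by (simp add: variation_le_def)
  then show "(\<Sum>i<n. ennreal \<bar>g (t (Suc i)) - g (t i)\<bar>) \<le> ennreal B"
    by (subst sum_ennreal) (auto intro: ennreal_leI)
qed

lemma bounded_variation_onI: "variation_le g B \<Longrightarrow> bounded_variation_on S g"
  unfolding bounded_variation_on_def
  using total_variation_le by (metis ennreal_less_top infinity_ennreal_def order_le_less_trans)

lemma variation_le_add:
  assumes "variation_le g B" "variation_le h B'"
  shows "variation_le (\<lambda>x. g x + h x) (B + B')"
  unfolding variation_le_def
proof (intro allI impI)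
  fix t :: "nat \<Rightarrow> real" and n :: nat assume t: "incseq t"
  have "(\<Sum>i<n. \<bar>g (t (Suc i)) + h (t (Suc i)) - (g (t i) + h (t i))\<bar>)
    \<le> (\<Sum>i<n. \<bar>g (t (Suc i)) - g (t i)\<bar> + \<bar>h (t (Suc i)) - h (t i)\<bar>)"
    by (intro sum_mono) linarith
  also have "\<dots> \<le> B + B'"
    using assms t unfolding variation_le_def sum.distrib by (intro add_mono) auto
  finally show "(\<Sum>i<n. \<bar>g (t (Suc i)) + h (t (Suc i)) - (g (t i) + h (t i))\<bar>) \<le> B + B'" .
qed

lemma variation_le_uminus: "variation_le g B \<Longrightarrow> variation_le (\<lambda>x. - g x) B"
  unfolding variation_le_def by (simp add: abs_minus_commute)

lemma variation_le_const: "variation_le (\<lambda>x. c) 0"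
  by (simp add: variation_le_def)

lemma variation_le_lessThan: "variation_le (indicator {..<c}) 1"
  unfolding variation_le_def
proof (intro allI impI)
  fix t :: "nat \<Rightarrow> real" and n :: nat assume t: "incseq t"
  define g where "g = (indicator {..<c} :: real \<Rightarrow> real)"
  have "g (t (Suc i)) \<le> g (t i)" for i
    using incseq_SucD [OF t, of i] by (auto simp: g_def indicator_def)
  then have "(\<Sum>i<n. \<bar>g (t (Suc i)) - g (t i)\<bar>) = (\<Sum>i<n. g (t i) - g (t (Suc i)))"
    by (intro sum.cong refl) (simp add: abs_of_nonpos)
  also have "\<dots> = g (t 0) - g (t n)" by (rule sum_lessThan_telescope')
  also have "\<dots> \<le> 1" by (auto simp: g_def indicator_def)
  finally show "(\<Sum>i<n. \<bar>indicat_real {..<c} (t (Suc i)) - indicat_real {..<c} (t i)\<bar>) \<le> 1"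
    by (simp add: g_def)
qed

text \<open>The indicator is a difference of indicators of two rays, each with a single
  jump.\<close>

lemma variation_le_interval: "u \<le> v \<Longrightarrow> variation_le (indicator {u..<v}) 2"
proof -
  assume "u \<le> v"
  then have "(indicator {u..<v} :: real \<Rightarrow> real) = (\<lambda>x. indicator {..<v} x + - indicator {..<u} x)"
    by (auto simp: indicator_def fun_eq_iff)
  then show ?thesis
    using variation_le_add [OF variation_le_lessThan variation_le_uminus [OF variation_le_lessThan]]
    by simp
qed

text \<open>The bounds are left existential: the approximation of Borel sets needs closure under
  sums and complements, not the size of the bounds.\<close>

definition bv :: "(real \<Rightarrow> real) \<Rightarrow> bool" where
  "bv u \<longleftrightarrow> u \<in> borel_measurable borel \<and> (\<exists>W. \<forall>y. \<bar>u y\<bar> \<le> W) \<and> (\<exists>B. variation_le u B)"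

lemma bv_add: "bv u \<Longrightarrow> bv v \<Longrightarrow> bv (\<lambda>x. u x + v x)"
proof -
  assume u: "bv u" and v: "bv v"
  obtain W W' where "\<And>y. \<bar>u y\<bar> \<le> W" "\<And>y. \<bar>v y\<bar> \<le> W'" using u v unfolding bv_def by blast
  then have "\<bar>u y + v y\<bar> \<le> W + W'" for y
    using abs_triangle_ineq [of "u y" "v y"] by (meson add_mono order_trans)
  moreover obtain B B' where "variation_le u B" "variation_le v B'" using u v unfolding bv_def by blast
  ultimately show ?thesis
    using u v variation_le_add unfolding bv_def by (blast intro: borel_measurable_add)
qed

lemma bv_const: "bv (\<lambda>x. c)"
  unfolding bv_def using variation_le_const by auto

lemma bv_uminus: "bv u \<Longrightarrow> bv (\<lambda>x. - u x)"
  unfolding bv_def using variation_le_uminus by auto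

lemma bv_lessThan: "bv (indicator {..<c})"
  unfolding bv_def using variation_le_lessThan by (auto simp: indicator_def intro!: exI [of _ 1])

lemma bv_sum: "finite I \<Longrightarrow> (\<And>i. i \<in> I \<Longrightarrow> bv (u i)) \<Longrightarrow> bv (\<lambda>x. \<Sum>i\<in>I. u i x)"
  by (induction rule: finite_induct) (auto intro: bv_const bv_add)

context bounded_line_measure
begin

lemma integrable_bv:
  assumes "bv u"
  shows "integrable N u"
proof -
  obtain W where W: "\<And>y. \<bar>u y\<bar> \<le> W" using assms by (auto simp: bv_def)
  have "u \<in> borel_measurable N" using assms measurable_cong_sets [OF sets_N refl] by (auto simp: bv_def)
  then show ?thesis using W by (intro integrable_const_bound [where B = W]) auto
qed

text \<open>The mixing hypothesis admits only \<open>g\<close> of bounded variation, and the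
  indicator of a Borel set need not be one; it is reached by approximation in L1. Rays form an
  intersection-stable generator, so the property has to be passed only to complements and disjoint
  unions.\<close>

lemma bv_dense:
  assumes "S \<in> sets borel" "0 < \<kappa>"
  shows "\<exists>u. bv u \<and> (\<integral>y. \<bar>indicator S y - u y\<bar> \<partial>N) \<le> \<kappa>"
proof -
  have gen: "sets borel = sigma_sets UNIV (range (lessThan :: real \<Rightarrow> real set))"
    unfolding borel_Iio by (rule sets_measure_of) simp
  have int_ind: "integrable N (indicat_real S)" if "S \<in> sets borel" for S
    using that by (intro integrable_bounded [where W = 1]) (auto simp: indicator_def)
  have intS: "integrable N (\<lambda>y. \<bar>indicator S y - u y\<bar>)" if "S \<in> sets borel" "bv u" for S u
    using that by (intro integrable_abs Bochner_Integration.integrable_diff int_ind integrable_bv)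
  have "Int_stable (range (lessThan :: real \<Rightarrow> real set))"
  proof (rule Int_stableI, clarify)
    fix x y :: real
    have "{..<x} \<inter> {..<y} = {..<min x y}" by auto
    then show "{..<x} \<inter> {..<y} \<in> range lessThan" by blast
  qed
  moreover have "range (lessThan :: real \<Rightarrow> real set) \<subseteq> Pow UNIV" by simp
  moreover have "S \<in> sigma_sets UNIV (range lessThan)" using assms(1) gen by simp
  ultimately have "\<forall>\<kappa>>0. \<exists>u. bv u \<and> (\<integral>y. \<bar>indicator S y - u y\<bar> \<partial>N) \<le> \<kappa>"
  proof (induction rule: sigma_sets_induct_disjoint)
    fix A :: "real set" assume "A \<in> range lessThan"
    then obtain c where "A = {..<c}" by blast
    then show "\<forall>\<kappa>>0. \<exists>u. bv u \<and> (\<integral>y. \<bar>indicator A y - u y\<bar> \<partial>N) \<le> \<kappa>"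
      by (intro allI impI exI [of _ "indicator {..<c}"]) (simp add: bv_lessThan)
  next
    show "\<forall>\<kappa>>0. \<exists>u. bv u \<and> (\<integral>y. \<bar>indicator {} y - u y\<bar> \<partial>N) \<le> \<kappa>"
      by (intro allI impI exI [of _ "\<lambda>_. 0"]) (simp add: bv_const)
  next
    fix A :: "real set"
    assume IH: "\<forall>\<kappa>>0. \<exists>u. bv u \<and> (\<integral>y. \<bar>indicator A y - u y\<bar> \<partial>N) \<le> \<kappa>"
    show "\<forall>\<kappa>>0. \<exists>u. bv u \<and> (\<integral>y. \<bar>indicator (UNIV - A) y - u y\<bar> \<partial>N) \<le> \<kappa>"
    proof (intro allI impI)
      fix \<kappa> :: real assume "0 < \<kappa>"
      then obtain u where u: "bv u" "(\<integral>y. \<bar>indicator A y - u y\<bar> \<partial>N) \<le> \<kappa>" using IH by blast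
      have "\<bar>indicator (UNIV - A) y - (1 + - u y)\<bar> = \<bar>indicator A y - u y\<bar>" for y
        by (auto simp: indicator_def)
      then show "\<exists>u. bv u \<and> (\<integral>y. \<bar>indicator (UNIV - A) y - u y\<bar> \<partial>N) \<le> \<kappa>"
        using u bv_add [OF bv_const [of 1] bv_uminus [OF u(1)]]
        by (intro exI [of _ "\<lambda>y. 1 + - u y"]) auto
    qed
  next
    fix A :: "nat \<Rightarrow> real set"
    assume dis: "disjoint_family A" and sigma: "range A \<subseteq> sigma_sets UNIV (range (lessThan :: real \<Rightarrow> real set))"
      and IH: "\<And>i. \<forall>\<kappa>>0. \<exists>u. bv u \<and> (\<integral>y. \<bar>indicator (A i) y - u y\<bar> \<partial>N) \<le> \<kappa>"
    have A [measurable]: "A i \<in> sets borel" for i using sigma gen by auto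
    show "\<forall>\<kappa>>0. \<exists>u. bv u \<and> (\<integral>y. \<bar>indicator (\<Union>i. A i) y - u y\<bar> \<partial>N) \<le> \<kappa>"
    proof (intro allI impI)
      fix \<kappa> :: real assume \<kappa>: "0 < \<kappa>"
      have "(\<lambda>i. measure N (A i)) sums measure N (\<Union>i. A i)"
        using dis by (intro finite_measure_UNION) auto
      then have "(\<lambda>n. \<Sum>i<n. measure N (A i)) \<longlonglongrightarrow> measure N (\<Union>i. A i)" by (simp add: sums_def)
      then have "\<forall>\<^sub>F n in sequentially. measure N (\<Union>i. A i) - \<kappa> / 2 < (\<Sum>i<n. measure N (A i))"
        using \<kappa> by (intro order_tendstoD) auto
      then obtain n where n: "measure N (\<Union>i. A i) - \<kappa> / 2 < (\<Sum>i<n. measure N (A i))"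
        using eventually_happens' by force
      \<comment> \<open>Half of \<kappa> pays for cutting the union off after \<open>n\<close> sets,
        the other half for approximating these sets.\<close>
      define \<epsilon> where "\<epsilon> = \<kappa> / (2 * (real n + 1))"
      have "0 < \<epsilon>" using \<kappa> by (simp add: \<epsilon>_def)
      then have "\<forall>i. \<exists>u. bv u \<and> (\<integral>y. \<bar>indicator (A i) y - u y\<bar> \<partial>N) \<le> \<epsilon>"
        using IH by blast
      from choice [OF this] obtain u where
        u: "\<And>i. bv (u i)" "\<And>i. (\<integral>y. \<bar>indicator (A i) y - u i y\<bar> \<partial>N) \<le> \<epsilon>" by blast
      have sum_ind: "(\<Sum>i<n. indicator (A i) y) = indicat_real (\<Union>i<n. A i) y" for y
        using dis by (simp add: indicator_UN_disjoint disjoint_family_on_def)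
      have bound: "\<bar>indicator (\<Union>i. A i) y - (\<Sum>i<n. u i y)\<bar>
        \<le> (indicator (\<Union>i. A i) y - (\<Sum>i<n. indicator (A i) y)) + (\<Sum>i<n. \<bar>indicator (A i) y - u i y\<bar>)" for y
      proof -
        have "\<bar>(\<Sum>i<n. indicator (A i) y) - (\<Sum>i<n. u i y)\<bar> \<le> (\<Sum>i<n. \<bar>indicator (A i) y - u i y\<bar>)"
          unfolding sum_subtractf [symmetric] by (rule sum_abs)
        moreover have "indicat_real (\<Union>i<n. A i) y \<le> indicator (\<Union>i. A i) y"
          by (auto simp: indicator_def)
        ultimately show ?thesis unfolding sum_ind by linarith
      qed
      have "(\<integral>y. \<bar>indicator (\<Union>i. A i) y - (\<Sum>i<n. u i y)\<bar> \<partial>N)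
        \<le> (\<integral>y. (indicator (\<Union>i. A i) y - (\<Sum>i<n. indicator (A i) y))
            + (\<Sum>i<n. \<bar>indicator (A i) y - u i y\<bar>) \<partial>N)"
      proof (rule integral_mono [OF _ _ bound])
        show "integrable N (\<lambda>y. \<bar>indicator (\<Union>i. A i) y - (\<Sum>i<n. u i y)\<bar>)"
          using u(1) by (intro intS bv_sum) auto
        show "integrable N (\<lambda>y. (indicator (\<Union>i. A i) y - (\<Sum>i<n. indicator (A i) y))
            + (\<Sum>i<n. \<bar>indicator (A i) y - u i y\<bar>))"
          by (intro Bochner_Integration.integrable_add Bochner_Integration.integrable_diff
              Bochner_Integration.integrable_sum int_ind intS u(1)) auto
      qed
      also have "\<dots> = (measure N (\<Union>i. A i) - (\<Sum>i<n. measure N (A i)))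
            + (\<Sum>i<n. (\<integral>y. \<bar>indicator (A i) y - u i y\<bar> \<partial>N))"
        using intS [OF A u(1)] int_ind
        by (subst Bochner_Integration.integral_add) (auto simp: Bochner_Integration.integral_diff Bochner_Integration.integral_sum)
      also have "\<dots> \<le> \<kappa> / 2 + real n * \<epsilon>"
        using n u(2) sum_bounded_above [of "{..<n}" "\<lambda>i. \<integral>y. \<bar>indicator (A i) y - u i y\<bar> \<partial>N" \<epsilon>]
        by simp
      also have "\<dots> \<le> \<kappa>" using \<kappa> unfolding \<epsilon>_def by (simp add: field_simps)
      finally show "\<exists>u. bv u \<and> (\<integral>y. \<bar>indicator (\<Union>i. A i) y - u y\<bar> \<partial>N) \<le> \<kappa>"
        using u(1) by (intro exI [of _ "\<lambda>y. \<Sum>i<n. u i y"]) (auto intro: bv_sum)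
    qed
  qed
  then show ?thesis using assms(2) by blast
qed

end

section \<open>The coarse spectrum\<close>

text \<open>\<open>Lim\<close> is a description and says something only once the limit exists;
  monotonicity provides that. The spectrum and its exponent are both limits of monotone
  functions.\<close>

lemma Lim_at_right_0_mono:
  fixes f :: "real \<Rightarrow> ereal"
  assumes mono: "\<And>x y. 0 < x \<Longrightarrow> x \<le> y \<Longrightarrow> f x \<le> f y"
  shows "Lim (at_right 0) f = (INF x\<in>{0<..}. f x)"
proof (rule tendsto_Lim)
  show "(f \<longlongrightarrow> (INF x\<in>{0<..}. f x)) (at_right 0)"
  proof (rule order_tendstoI)
    fix c assume c: "c < (INF x\<in>{0<..}. f x)"
    have "c < f x" if "0 < x" for x
      using c that by (auto intro: less_le_trans INF_lower)
    then show "\<forall>\<^sub>F x in at_right 0. c < f x"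
      by (auto simp: eventually_at_right_field intro: exI [of _ 1])
  next
    fix c assume "(INF x\<in>{0<..}. f x) < c"
    then obtain x0 where "0 < x0" "f x0 < c" by (auto simp: INF_less_iff)
    then show "\<forall>\<^sub>F x in at_right 0. f x < c"
      unfolding eventually_at_right_field using mono by (meson le_less_trans less_imp_le)
  qed
qed simp

lemma Lim_at_right_0_mono_less:
  fixes f :: "real \<Rightarrow> ereal"
  assumes mono: "\<And>x y. 0 < x \<Longrightarrow> x \<le> y \<Longrightarrow> f x \<le> f y"
    and "Lim (at_right 0) f < c" "0 < e"
  shows "\<exists>x. 0 < x \<and> x \<le> e \<and> f x < c"
proof -
  have "Lim (at_right 0) f = (INF x\<in>{0<..}. f x)"
    by (rule Lim_at_right_0_mono) (rule mono)
  then obtain x where x: "0 < x" "f x < c"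
    using assms(2) by (auto simp: INF_less_iff)
  then have "f (min x e) < c"
    using mono [of "min x e" x] \<open>0 < e\<close> by (auto intro: le_less_trans)
  then show ?thesis using x \<open>0 < e\<close> by (intro exI [of _ "min x e"]) auto
qed

lemma powr_less_iff_base_less_1:
  "0 < r \<Longrightarrow> r < 1 \<Longrightarrow> r powr x < r powr y \<longleftrightarrow> y < (x :: real)"
  by (auto simp: powr_def mult_less_cancel_right)

definition grid_cell :: "real \<Rightarrow> int \<Rightarrow> real set" where
  "grid_cell r k = {real_of_int k * r ..< (real_of_int k + 1) * r}"

lemma mem_grid_cell: "0 < r \<Longrightarrow> y \<in> grid_cell r k \<longleftrightarrow> \<lfloor>y / r\<rfloor> = k"
  by (auto simp: grid_cell_def floor_eq_iff field_simps)

context bounded_line_measure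
begin

definition grid_index :: "real \<Rightarrow> int set" where
  "grid_index r = {\<lfloor>a / r\<rfloor>..\<lfloor>b / r\<rfloor>}"

lemma finite_grid_index [simp]: "finite (grid_index r)" by (simp add: grid_index_def)

lemma measure_grid_cell_0:
  assumes "0 < r" "k \<notin> grid_index r"
  shows "measure N (grid_cell r k) = 0"
proof -
  have "AE y in N. y \<notin> grid_cell r k"
    using AE_bounded
  proof eventually_elim
    case (elim y)
    then have "\<lfloor>y / r\<rfloor> \<in> grid_index r"
      using assms by (auto simp: grid_index_def intro!: floor_mono divide_right_mono)
    then show ?case using assms by (auto simp: mem_grid_cell)
  qed
  then have "measure N (grid_cell r k) = measure N {}"
    by (intro measure_eq_AE) (auto simp: grid_cell_def)
  then show ?thesis by simp
qed

lemma sum_measure_grid_le: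
  assumes "0 < r" "finite A"
  shows "(\<Sum>k\<in>A. measure N (grid_cell r k)) \<le> measure N UNIV"
proof -
  have "disjoint_family_on (grid_cell r) A"
    using assms by (auto simp: disjoint_family_on_def mem_grid_cell)
  then have "(\<Sum>k\<in>A. measure N (grid_cell r k)) = measure N (\<Union>k\<in>A. grid_cell r k)"
    using assms by (subst finite_measure_finite_Union) (auto simp: grid_cell_def)
  also have "\<dots> \<le> measure N UNIV" by (intro finite_measure_mono) auto
  finally show ?thesis .
qed

text \<open>Half-open because this is what remains when the count at exponent \<open>u\<close> is
  subtracted from the count at exponent \<open>v\<close>.\<close>

definition grid_band :: "real \<Rightarrow> real \<Rightarrow> real \<Rightarrow> int set" where
  "grid_band u v r = {k. r powr v \<le> measure N (grid_cell r k) \<and> measure N (grid_cell r k) < r powr u}"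

lemma finite_heavy:
  assumes "0 < r"
  shows "finite {k. r powr s \<le> measure N (grid_cell r k)}"
proof (rule finite_subset)
  show "{k. r powr s \<le> measure N (grid_cell r k)} \<subseteq> grid_index r"
    using assms measure_grid_cell_0 [of r] by (auto simp: not_le intro: ccontr)
qed simp

lemma coarse_count_diff:
  assumes "0 < r" "r < 1" "u \<le> v"
  shows "real (coarse_count N v r) - real (coarse_count N u r) = real (card (grid_band u v r))"
proof -
  have le: "r powr v \<le> r powr u" using assms by (intro powr_mono') auto
  have "grid_band u v r = {k. r powr v \<le> measure N (grid_cell r k)} - {k. r powr u \<le> measure N (grid_cell r k)}"
    by (auto simp: grid_band_def)
  also have "card \<dots> = card {k. r powr v \<le> measure N (grid_cell r k)} - card {k. r powr u \<le> measure N (grid_cell r k)}"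
    using finite_heavy [OF assms(1)] le by (intro card_Diff_subset) auto
  finally have "card (grid_band u v r) = coarse_count N v r - coarse_count N u r"
    by (simp add: coarse_count_def grid_cell_def)
  moreover have "coarse_count N u r \<le> coarse_count N v r"
    unfolding coarse_count_def grid_cell_def [symmetric]
    using finite_heavy [OF assms(1)] le by (intro card_mono) auto
  ultimately show ?thesis by simp
qed

lemma finite_grid_band: "0 < r \<Longrightarrow> finite (grid_band u v r)"
  by (rule finite_subset [OF _ finite_heavy [of r v]]) (auto simp: grid_band_def)

lemma elog_mono: "x \<le> y \<Longrightarrow> elog x \<le> elog y"
  by (auto simp: elog_def)

text \<open>For small \<open>r\<close> the band holds at most \<open>r powr - (t - e)\<close> cells,
  each of measure below \<open>r powr (t - \<epsilon>)\<close>. Together they carry at most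
  \<open>r powr (e - \<epsilon>)\<close>, and \<epsilon> \<le> e / 2.\<close>

lemma spectrum_band_mass:
  assumes less: "upper_coarse_spectrum N t < ereal (t - e)" and e: "0 < e"
  shows "\<exists>\<epsilon>>0. \<forall>\<^sub>F r in at_right 0.
    (\<Sum>k\<in>grid_band (t - \<epsilon>) (t + \<epsilon>) r. measure N (grid_cell r k)) \<le> r powr (e / 2)"
proof -
  define f where "f \<epsilon> = Limsup (at_right 0) (\<lambda>r.
       elog (real (coarse_count N (t + \<epsilon>) r) - real (coarse_count N (t - \<epsilon>) r)) / ereal (- ln r))" for \<epsilon>
  have small: "\<forall>\<^sub>F r :: real in at_right 0. 0 < r \<and> r < 1"
    by (auto simp: eventually_at_right_field intro: exI [of _ 1])
  have mono: "f x \<le> f y" if "0 < x" "x \<le> y" for x y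
    unfolding f_def
  proof (rule Limsup_mono)
    show "\<forall>\<^sub>F r in at_right 0. elog (real (coarse_count N (t + x) r) - real (coarse_count N (t - x) r)) / ereal (- ln r)
      \<le> elog (real (coarse_count N (t + y) r) - real (coarse_count N (t - y) r)) / ereal (- ln r)"
      using small
    proof eventually_elim
      case (elim r)
      have "r powr (t + y) \<le> r powr (t + x)" "r powr (t - x) \<le> r powr (t - y)"
        using elim that by (auto intro: powr_mono')
      then have "grid_band (t - x) (t + x) r \<subseteq> grid_band (t - y) (t + y) r"
        by (auto simp: grid_band_def)
      then have "card (grid_band (t - x) (t + x) r) \<le> card (grid_band (t - y) (t + y) r)"
        using elim by (intro card_mono finite_grid_band) auto
      then show ?case
        using elim that by (intro ereal_divide_right_mono) (auto simp: coarse_count_diff intro!: elog_mono)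
    qed
  qed
  have "Lim (at_right 0) f < ereal (t - e)"
    using less unfolding upper_coarse_spectrum_def f_def .
  from Lim_at_right_0_mono_less [OF mono this, of "e / 2"] e
  obtain \<epsilon> where \<epsilon>: "0 < \<epsilon>" "\<epsilon> \<le> e / 2" "f \<epsilon> < ereal (t - e)" by auto
  have "\<forall>\<^sub>F r in at_right 0. elog (real (coarse_count N (t + \<epsilon>) r) - real (coarse_count N (t - \<epsilon>) r)) / ereal (- ln r)
      < ereal (t - e)"
    using \<epsilon>(3) unfolding f_def by (rule Limsup_lessD)
  with small have "\<forall>\<^sub>F r in at_right 0.
    (\<Sum>k\<in>grid_band (t - \<epsilon>) (t + \<epsilon>) r. measure N (grid_cell r k)) \<le> r powr (e / 2)"
  proof eventually_elim
    case (elim r)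
    define c where "c = card (grid_band (t - \<epsilon>) (t + \<epsilon>) r)"
    have c_less: "elog (real c) / ereal (- ln r) < ereal (t - e)"
      using elim \<epsilon> coarse_count_diff [of r "t - \<epsilon>" "t + \<epsilon>"] by (simp add: c_def)
    have c: "real c \<le> r powr - (t - e)"
    proof (cases "c = 0")
      case False
      have "ln (real c) / - ln r < t - e"
        using c_less False elim by (simp add: elog_def)
      then have "ln (real c) < (t - e) * - ln r"
        using elim pos_divide_less_eq [of "- ln r" "ln (real c)" "t - e"] by simp
      also have "\<dots> = ln (r powr - (t - e))" using elim by (simp add: ln_powr algebra_simps)
      finally have "ln (real c) < ln (r powr - (t - e))" .
      then show ?thesis using False elim ln_less_cancel_iff [of "real c" "r powr - (t - e)"]
        by (simp del: ln_powr)
    qed simp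
    have "(\<Sum>k\<in>grid_band (t - \<epsilon>) (t + \<epsilon>) r. measure N (grid_cell r k))
      \<le> real c * r powr (t - \<epsilon>)"
      unfolding c_def by (rule sum_bounded_above) (auto simp: grid_band_def)
    also have "\<dots> \<le> r powr - (t - e) * r powr (t - \<epsilon>)"
      using c by (intro mult_right_mono) auto
    also have "\<dots> = r powr (e - \<epsilon>)" using elim by (simp flip: powr_add)
    also have "\<dots> \<le> r powr (e / 2)" using elim \<epsilon> by (intro powr_mono') auto
    finally show ?case .
  qed
  then show ?thesis using \<epsilon>(1) by blast
qed

text \<open>The limit in the definition of the exponent yields one gap \<open>e\<close> for all
  \<open>t\<close> above \<open>s\<close>, which makes the masses of all bands decay at the same
  rate.\<close>

lemma spectrum_exponent_less:
  assumes "spectrum_exponent N < ereal s"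
  obtains e where "0 < e" "\<And>t. s \<le> t \<Longrightarrow> upper_coarse_spectrum N t < ereal (t - e)"
proof -
  define f where "f \<epsilon> = (SUP t \<in> {t. upper_coarse_spectrum N t \<ge> ereal (t - \<epsilon>)}. ereal t)" for \<epsilon>
  have mono: "f x \<le> f y" if "0 < x" "x \<le> y" for x y
    unfolding f_def
  proof (rule SUP_subset_mono)
    show "{t. ereal (t - x) \<le> upper_coarse_spectrum N t} \<subseteq> {t. ereal (t - y) \<le> upper_coarse_spectrum N t}"
      using that by (auto intro: order_trans [rotated])
  qed simp
  have "Lim (at_right 0) f < ereal s"
    using assms unfolding spectrum_exponent_def f_def .
  from Lim_at_right_0_mono_less [OF mono this, of 1]
  obtain e where e: "0 < e" "f e < ereal s" by auto
  have "upper_coarse_spectrum N t < ereal (t - e)" if "s \<le> t" for t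
  proof (rule ccontr)
    assume "\<not> upper_coarse_spectrum N t < ereal (t - e)"
    then have "ereal t \<le> f e" unfolding f_def by (intro SUP_upper) auto
    then have "ereal t < ereal s" using e(2) by (rule le_less_trans)
    then show False using that by simp
  qed
  with e(1) show ?thesis by (rule that)
qed

text \<open>Cells are split by measure. Those of measure at least \<open>r powr s\<close> contribute
  at most a fraction \<open>r powr (s' - s)\<close> of the total mass. Those of measure at most
  \<open>r powr 2\<close> contribute little because there are only about 1 / r cells. The rest have
  exponents in a compact interval, which finitely many bands cover. The minimum is subadditive in
  the measure, which allows a change of grid afterwards.\<close>

lemma grid_min_mass_tendsto_0:
  assumes less: "spectrum_exponent N < ereal s" and ss': "s < s'" and ab: "a \<le> b"
  shows "((\<lambda>r. \<Sum>k\<in>grid_index r. min (r powr s') (measure N (grid_cell r k))) \<longlongrightarrow> 0) (at_right 0)"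
proof -
  obtain e where e: "0 < e" "\<And>t. s \<le> t \<Longrightarrow> upper_coarse_spectrum N t < ereal (t - e)"
    using spectrum_exponent_less [OF less] by blast
  \<comment> \<open>Exponents above 2 are harmless by counting cells, so [s, S] is all that the
    bands must cover; the maximum with \<open>s\<close> keeps this interval nonempty.\<close>
  define S where "S = max s 2"
  have "\<forall>t\<in>{s..S}. \<exists>\<epsilon>>0. \<forall>\<^sub>F r in at_right 0.
    (\<Sum>k\<in>grid_band (t - \<epsilon>) (t + \<epsilon>) r. measure N (grid_cell r k)) \<le> r powr (e / 2)"
    using spectrum_band_mass e by auto
  from bchoice [OF this] obtain \<epsilon> where \<epsilon>: "\<And>t. t \<in> {s..S} \<Longrightarrow> 0 < \<epsilon> t"
    "\<And>t. t \<in> {s..S} \<Longrightarrow> \<forall>\<^sub>F r in at_right 0.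
    (\<Sum>k\<in>grid_band (t - \<epsilon> t) (t + \<epsilon> t) r. measure N (grid_cell r k)) \<le> r powr (e / 2)" by blast
  have "{s..S} \<subseteq> (\<Union>t\<in>{s..S}. ball t (\<epsilon> t))" using \<epsilon>(1) by force
  then obtain C where C: "C \<subseteq> {s..S}" "finite C" "{s..S} \<subseteq> (\<Union>t\<in>C. ball t (\<epsilon> t))"
    using compactE_image [of "{s..S}" "{s..S}" "\<lambda>t. ball t (\<epsilon> t)"] by (metis compact_Icc open_ball)
  define m where "m = measure N UNIV"
  have small: "\<forall>\<^sub>F r :: real in at_right 0. 0 < r \<and> r < 1"
    by (auto simp: eventually_at_right_field intro: exI [of _ 1])
  have "\<forall>\<^sub>F r in at_right 0. \<forall>t\<in>C.
    (\<Sum>k\<in>grid_band (t - \<epsilon> t) (t + \<epsilon> t) r. measure N (grid_cell r k)) \<le> r powr (e / 2)"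
    using C(1,2) \<epsilon>(2) by (intro eventually_ball_finite) auto
  with small have bound: "\<forall>\<^sub>F r in at_right 0.
    (\<Sum>k\<in>grid_index r. min (r powr s') (measure N (grid_cell r k)))
    \<le> m * r powr (s' - s) + ((b - a) * r + 2 * r powr 2) + real (card C) * r powr (e / 2)"
  proof eventually_elim
    case (elim r)
    define M where "M k = measure N (grid_cell r k)" for k
    have M0: "0 \<le> M k" for k by (simp add: M_def)
    define B where "B t = grid_band (t - \<epsilon> t) (t + \<epsilon> t) r" for t
    have fB: "finite (B t)" for t using elim by (simp add: B_def finite_grid_band)
    have pt: "min (r powr s') (M k) \<le> r powr (s' - s) * M k + r powr 2
        + (\<Sum>t\<in>C. if k \<in> B t then M k else 0)" for k
    proof -
      have sum0: "0 \<le> (\<Sum>t\<in>C. if k \<in> B t then M k else 0)" using M0 by (intro sum_nonneg) auto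
      consider "r powr s \<le> M k" | "M k \<le> r powr 2" | "M k < r powr s" "r powr 2 < M k" by linarith
      then show ?thesis
      proof cases
        case 1
        have "r powr s' = r powr (s' - s) * r powr s" using elim by (simp flip: powr_add)
        also have "\<dots> \<le> r powr (s' - s) * M k" using 1 by (intro mult_left_mono) auto
        finally show ?thesis using sum0 by (smt (verit) powr_ge_zero)
      next
        case 2
        then show ?thesis using sum0 M0 [of k] by (smt (verit) powr_ge_zero mult_nonneg_nonneg)
      next
        case 3
        \<comment> \<open>The exponent of the cell at scale \<open>r\<close>; it selects a
          band.\<close>
        define \<tau> where "\<tau> = ln (M k) / ln r"
        have pos: "0 < M k" using 3(2) by (smt (verit) powr_ge_zero)
        have lnr: "ln r < 0" using elim by simp
        have Mk: "M k = r powr \<tau>" using pos elim lnr by (simp add: \<tau>_def powr_def)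
        have "s < \<tau>" "\<tau> < 2"
          using 3 elim Mk powr_less_iff_base_less_1 [of r \<tau> s] powr_less_iff_base_less_1 [of r 2 \<tau>]
          by auto
        then have "\<tau> \<in> {s..S}" by (auto simp: S_def)
        then obtain t where t: "t \<in> C" "\<tau> \<in> ball t (\<epsilon> t)" using C(3) by blast
        then have "t - \<epsilon> t < \<tau>" "\<tau> < t + \<epsilon> t" by (auto simp: dist_real_def)
        then have "r powr (t + \<epsilon> t) \<le> M k" "M k < r powr (t - \<epsilon> t)"
          unfolding Mk using elim by (auto simp: powr_less_iff_base_less_1 intro: powr_mono')
        then have "k \<in> B t" by (simp add: B_def grid_band_def M_def)
        then have "M k \<le> (\<Sum>t\<in>C. if k \<in> B t then M k else 0)"
          using t(1) C(2) M0 member_le_sum [of t C "\<lambda>t. if k \<in> B t then M k else 0"] by auto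
        then show ?thesis using M0 [of k] by (smt (verit) powr_ge_zero mult_nonneg_nonneg)
      qed
    qed
    have card: "real (card (grid_index r)) \<le> (b - a) / r + 2"
    proof -
      have "a / r \<le> b / r" using ab elim by (simp add: divide_right_mono)
      then have "\<lfloor>a / r\<rfloor> \<le> \<lfloor>b / r\<rfloor>" by (rule floor_mono)
      then have "real (card (grid_index r)) = real_of_int (\<lfloor>b / r\<rfloor> - \<lfloor>a / r\<rfloor> + 1)"
        by (simp add: grid_index_def)
      also have "\<dots> \<le> (b - a) / r + 2" unfolding diff_divide_distrib by linarith
      finally show ?thesis .
    qed
    have "(\<Sum>k\<in>grid_index r. min (r powr s') (M k)) \<le> (\<Sum>k\<in>grid_index r. r powr (s' - s) * M k + r powr 2
        + (\<Sum>t\<in>C. if k \<in> B t then M k else 0))"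
      by (intro sum_mono pt)
    also have "\<dots> = r powr (s' - s) * (\<Sum>k\<in>grid_index r. M k) + real (card (grid_index r)) * r powr 2
        + (\<Sum>k\<in>grid_index r. \<Sum>t\<in>C. if k \<in> B t then M k else 0)"
      by (simp add: sum.distrib sum_distrib_left)
    finally have 1: "(\<Sum>k\<in>grid_index r. min (r powr s') (M k))
      \<le> r powr (s' - s) * (\<Sum>k\<in>grid_index r. M k) + real (card (grid_index r)) * r powr 2
        + (\<Sum>k\<in>grid_index r. \<Sum>t\<in>C. if k \<in> B t then M k else 0)" .
    have "(\<Sum>k\<in>grid_index r. \<Sum>t\<in>C. if k \<in> B t then M k else 0)
        = (\<Sum>t\<in>C. \<Sum>k\<in>grid_index r. if k \<in> B t then M k else 0)"
      by (rule sum.swap)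
    also have "\<dots> \<le> (\<Sum>t\<in>C. \<Sum>k\<in>B t. M k)"
    proof (rule sum_mono)
      fix t
      have "(\<Sum>k\<in>grid_index r. if k \<in> B t then M k else 0) = (\<Sum>k\<in>grid_index r \<inter> B t. M k)"
        by (simp add: sum.inter_restrict)
      also have "\<dots> \<le> (\<Sum>k\<in>B t. M k)" using fB M0 by (intro sum_mono2) auto
      finally show "(\<Sum>k\<in>grid_index r. if k \<in> B t then M k else 0) \<le> (\<Sum>k\<in>B t. M k)" .
    qed
    also have "\<dots> \<le> (\<Sum>t\<in>C. r powr (e / 2))"
      using elim by (intro sum_mono) (auto simp: B_def M_def)
    finally have 2: "(\<Sum>k\<in>grid_index r. \<Sum>t\<in>C. if k \<in> B t then M k else 0) \<le> real (card C) * r powr (e / 2)"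
      by simp
    have "(\<Sum>k\<in>grid_index r. M k) \<le> m"
      unfolding M_def m_def using elim by (intro sum_measure_grid_le) auto
    then have 3: "r powr (s' - s) * (\<Sum>k\<in>grid_index r. M k) \<le> r powr (s' - s) * m"
      by (intro mult_left_mono) auto
    have "real (card (grid_index r)) * r powr 2 \<le> ((b - a) / r + 2) * r powr 2"
      using card by (intro mult_right_mono) auto
    also have "\<dots> = (b - a) * r + 2 * r powr 2"
      using elim by (simp add: field_simps power2_eq_square)
    finally have 4: "real (card (grid_index r)) * r powr 2 \<le> (b - a) * r + 2 * r powr 2" .
    show ?case
      using 1 2 3 4 unfolding M_def [symmetric] by (simp only: mult.commute [of m])
  qed
  have p0: "((\<lambda>r. r powr c) \<longlongrightarrow> 0) (at_right 0)" if "0 < c" for c :: real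
    using that by (intro tendsto_zero_powrI tendsto_intros)
      (auto simp: eventually_at_right_field intro: exI [of _ 1])
  have "((\<lambda>r. m * r powr (s' - s) + ((b - a) * r + 2 * r powr 2) + real (card C) * r powr (e / 2))
    \<longlongrightarrow> m * 0 + ((b - a) * 0 + 2 * 0) + real (card C) * 0) (at_right 0)"
    using e ss' by (intro tendsto_intros p0) auto
  then have lim: "((\<lambda>r. m * r powr (s' - s) + ((b - a) * r + 2 * r powr 2) + real (card C) * r powr (e / 2))
    \<longlongrightarrow> 0) (at_right 0)" by simp
  show ?thesis
    by (rule tendsto_sandwich [OF _ bound tendsto_const lim]) (auto intro!: always_eventually sum_nonneg)
qed

text \<open>Passes from the grid anchored at \<open>0\<close>, on which the spectrum is defined, to the one anchored
  at \<open>P\<close>.\<close>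

lemma light_cells_mass_tendsto_0:
  assumes less: "spectrum_exponent N < ereal s" and ss': "s < s'" and ab: "a \<le> b"
  shows "(\<lambda>l::nat. \<Sum>k\<in>{cell_index P l a..cell_index P l b}.
    if measure N (dcell P l k) < 2 powr (- (real l * s')) then measure N (dcell P l k) else 0) \<longlonglongrightarrow> 0"
proof -
  define \<Phi> where "\<Phi> r = (\<Sum>k\<in>grid_index r. min (r powr s') (measure N (grid_cell r k)))" for r
  define r where "r l = (1/2::real) ^ l" for l :: nat
  have r0: "0 < r l" for l by (simp add: r_def)
  have "r \<longlonglongrightarrow> 0" unfolding r_def by (intro LIMSEQ_power_zero) auto
  then have "filterlim r (at_right 0) sequentially"
    using r0 by (intro tendsto_imp_filterlim_at_right) auto
  from filterlim_compose [OF grid_min_mass_tendsto_0 [OF assms] this]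
  have lim: "(\<lambda>l. 2 * \<Phi> (r l)) \<longlonglongrightarrow> 2 * 0"
    unfolding \<Phi>_def by (intro tendsto_intros)
  have bound: "(\<Sum>k\<in>{cell_index P l a..cell_index P l b}.
    if measure N (dcell P l k) < 2 powr (- (real l * s')) then measure N (dcell P l k) else 0) \<le> 2 * \<Phi> (r l)"
    (is "?L \<le> _") for l
  proof -
    define g where "g k = min (r l powr s') (measure N (grid_cell (r l) k))" for k
    define q where "q = \<lfloor>P / r l\<rfloor>"
    define A where "A = {cell_index P l a..cell_index P l b}"
    have rl: "2 powi (- int l) = r l" by (simp add: r_def power_int_minus power_one_over inverse_eq_divide)
    have "r l = 2 powr - real l" by (simp add: r_def powr_minus powr_realpow power_one_over inverse_eq_divide)
    then have rs: "r l powr s' = 2 powr (- (real l * s'))" by (simp add: powr_powr)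
    \<comment> \<open>The two grids are offset by \<open>q\<close> cells and a fraction, so a cell
      of one meets at most two consecutive cells of the other.\<close>
    have "(if measure N (dcell P l k) < 2 powr (- (real l * s')) then measure N (dcell P l k) else 0)
      \<le> g (q + k) + g (q + k + 1)" for k
    proof -
      have q: "real_of_int q * r l \<le> P" "P < (real_of_int q + 1) * r l"
        using mem_grid_cell [OF r0 [of l], of P q] by (auto simp: q_def grid_cell_def)
      have "dcell P l k \<subseteq> grid_cell (r l) (q + k) \<union> grid_cell (r l) (q + k + 1)"
        using q by (auto simp: dcell_def grid_cell_def rl algebra_simps)
      then have "measure N (dcell P l k) \<le> measure N (grid_cell (r l) (q + k) \<union> grid_cell (r l) (q + k + 1))"
        by (intro finite_measure_mono) (auto simp: grid_cell_def)
      also have "\<dots> \<le> measure N (grid_cell (r l) (q + k)) + measure N (grid_cell (r l) (q + k + 1))"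
        by (intro measure_Un_le) (auto simp: grid_cell_def)
      finally show ?thesis unfolding g_def rs by (smt (verit) measure_nonneg powr_ge_zero)
    qed
    then have "?L \<le> (\<Sum>k\<in>A. g (q + k) + g (q + k + 1))"
      unfolding A_def by (rule sum_mono)
    also have "\<dots> = (\<Sum>k\<in>(+) q ` A. g k) + (\<Sum>k\<in>(+) (q + 1) ` A. g k)"
      by (simp add: sum.distrib sum.reindex algebra_simps)
    also have "\<dots> \<le> \<Phi> (r l) + \<Phi> (r l)"
    proof -
      have "(\<Sum>k\<in>B. g k) \<le> \<Phi> (r l)" if "finite B" for B
      proof -
        have "(\<Sum>k\<in>B. g k) = (\<Sum>k\<in>B \<inter> grid_index (r l). g k)"
          using that measure_grid_cell_0 [OF r0] by (intro sum.mono_neutral_right) (auto simp: g_def)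
        also have "\<dots> \<le> (\<Sum>k\<in>grid_index (r l). g k)" by (intro sum_mono2) (auto simp: g_def)
        finally show ?thesis by (simp add: \<Phi>_def g_def)
      qed
      then show ?thesis by (intro add_mono) (auto simp: A_def)
    qed
    finally show ?thesis by simp
  qed
  show ?thesis
    by (rule tendsto_sandwich [OF _ _ tendsto_const lim [unfolded mult_zero_right]])
      (use bound in \<open>auto intro!: always_eventually sum_nonneg\<close>)
qed

end

section \<open>Empirical densities\<close>

context bounded_line_measure
begin

definition restr :: "real set \<Rightarrow> real measure" where
  "restr F = density N (indicator F)"

lemma sets_restr [simp]: "sets (restr F) = sets borel"
  by (simp add: restr_def)

lemma measure_restr:
  assumes "F \<in> sets borel" "Q \<in> sets borel"
  shows "measure (restr F) Q = measure N (F \<inter> Q)"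
  using assms by (simp add: restr_def measure_restricted)

lemma measure_restr_le:
  assumes "F \<in> sets borel" "Q \<in> sets borel"
  shows "measure (restr F) Q \<le> measure N Q"
  unfolding measure_restr [OF assms] using assms by (intro finite_measure_mono) auto

lemma bounded_restr:
  assumes F: "F \<in> sets borel"
  shows "bounded_line_measure (restr F) a b"
proof (intro bounded_line_measure.intro finite_measureI bounded_line_measure_axioms.intro)
  have "emeasure (restr F) (space (restr F)) = emeasure N F"
    using F by (simp add: restr_def emeasure_restricted)
  then show "emeasure (restr F) (space (restr F)) \<noteq> \<infinity>" by simp
  show "sets (restr F) = sets borel" by simp
  have "AE y in N. 0 < (indicator F y :: ennreal) \<longrightarrow> y \<in> {a..b}"
    using AE_bounded by eventually_elim simp
  then show "AE y in restr F. y \<in> {a..b}"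
    unfolding restr_def using F by (subst AE_density) auto
qed

text \<open>The term 1 / n is at most a multiple of \<open>2 powr (- (real l * \<beta>))\<close>,
  and \<open>m powr \<eta>\<close> is at least \<open>2 powr (- (real l * s' * \<eta>))\<close>; the
  gap of 3 * \<epsilon> between the exponents absorbs the prefactor and leaves one \<epsilon>. The
  term \<open>m\<close> is split as \<open>m powr (1 - \<eta>) * m powr \<eta>\<close>, and the
  upper bound on \<open>m\<close> makes the first factor small.\<close>

lemma powr_estimate:
  fixes m c1 t1 \<epsilon> \<eta> \<beta> s' :: real and n l j :: nat
  assumes m: "0 < m" "2 powr (- (real l * s')) \<le> m" "m \<le> c1 * 2 powr (- t1 * real j)"
    and par: "0 < \<epsilon>" "0 < \<eta>" "\<eta> < 1" "0 < c1" "3 * \<epsilon> \<le> t1 * (1 - \<eta>)" "3 * \<epsilon> \<le> \<beta> - s' * \<eta>"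
    and n: "2 powr (real l * \<beta>) \<le> 4 * real n" and jl: "j \<le> l"
  shows "2 powr (2 * \<epsilon> * real j) * (1 / real n + m)
    \<le> (4 * 2 powr (- \<epsilon> * real l) + c1 powr (1 - \<eta>) * 2 powr (- \<epsilon> * real j)) * m powr \<eta>"
proof -
  have n0: "0 < real n" using n by (smt (verit) powr_gt_zero)
  have "1 / real n \<le> 4 * 2 powr (- (real l * \<beta>))"
    using n n0 by (simp add: powr_minus field_simps)
  moreover have "2 powr (2 * \<epsilon> * real j) \<le> 2 powr (2 * \<epsilon> * real l)"
    using par jl by (intro powr_mono) auto
  ultimately have "2 powr (2 * \<epsilon> * real j) * (1 / real n) \<le> 2 powr (2 * \<epsilon> * real l) * (4 * 2 powr (- (real l * \<beta>)))"
    by (intro mult_mono) auto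
  also have "\<dots> = 4 * 2 powr (real l * (2 * \<epsilon> - \<beta>))"
    by (simp add: algebra_simps flip: powr_add)
  also have "\<dots> \<le> 4 * 2 powr (real l * (- \<epsilon> - s' * \<eta>))"
    using par by (intro mult_left_mono powr_mono) auto
  also have "\<dots> = 4 * 2 powr (- \<epsilon> * real l) * (2 powr (- (real l * s'))) powr \<eta>"
    by (simp add: powr_powr algebra_simps flip: powr_add)
  also have "\<dots> \<le> 4 * 2 powr (- \<epsilon> * real l) * m powr \<eta>"
    using m par by (intro mult_left_mono powr_mono2) auto
  finally have 1: "2 powr (2 * \<epsilon> * real j) * (1 / real n) \<le> 4 * 2 powr (- \<epsilon> * real l) * m powr \<eta>" .
  have "m = m powr (1 - \<eta>) * m powr \<eta>" using m by (simp flip: powr_add)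
  also have "\<dots> \<le> (c1 * 2 powr (- t1 * real j)) powr (1 - \<eta>) * m powr \<eta>"
    using m par by (intro mult_right_mono powr_mono2) auto
  also have "\<dots> = c1 powr (1 - \<eta>) * 2 powr (- t1 * real j * (1 - \<eta>)) * m powr \<eta>"
    using par by (simp add: powr_mult powr_powr)
  finally have "2 powr (2 * \<epsilon> * real j) * m
    \<le> 2 powr (2 * \<epsilon> * real j) * (c1 powr (1 - \<eta>) * 2 powr (- t1 * real j * (1 - \<eta>)) * m powr \<eta>)"
    by (intro mult_left_mono) auto
  also have "\<dots> = c1 powr (1 - \<eta>) * 2 powr (real j * (2 * \<epsilon> - t1 * (1 - \<eta>))) * m powr \<eta>"
    by (simp add: algebra_simps flip: powr_add)
  also have "\<dots> \<le> c1 powr (1 - \<eta>) * 2 powr (real j * (- \<epsilon>)) * m powr \<eta>"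
    using par by (intro mult_left_mono mult_right_mono powr_mono) auto
  finally have 2: "2 powr (2 * \<epsilon> * real j) * m \<le> c1 powr (1 - \<eta>) * 2 powr (- \<epsilon> * real j) * m powr \<eta>"
    by (simp add: mult.commute)
  show ?thesis using 1 2 by (simp add: algebra_simps)
qed

text \<open>The density carries mass 1 / n for each good index. On levels from \<open>L\<close> to
  \<open>l\<close> the mass of a cell is a number of visits, controlled by \<open>sparse\<close>. A
  cell finer than level \<open>l\<close> receives the share of its level \<open>l\<close> cell given
  by \<open>restr F\<close>; \<open>thick\<close> prevents this share from being too large.
  \<open>heavy\<close> turns 1 / n into a power of the measure of the cell.\<close>

lemma empirical_density:
  fixes \<xi> :: "nat \<Rightarrow> real" and l L n :: nat and Good :: "nat set"
  assumes F: "F \<in> sets borel" and \<xi>: "\<And>i. \<xi> i \<in> {a..b}" and Good: "Good \<subseteq> {n..<2 * n}"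
    and Ll: "L < l"
    and par: "0 < \<epsilon>" "0 < \<eta>" "\<eta> < 1" "0 < c1" "3 * \<epsilon> \<le> t1 * (1 - \<eta>)" "3 * \<epsilon> \<le> \<beta> - s' * \<eta>"
    and n: "2 powr (real l * \<beta>) \<le> 4 * real n"
    and frostman: "\<And>j k. measure N (dcell P (int j) k) \<le> c1 * 2 powr (- t1 * real j)"
    and heavy: "\<And>i. i \<in> Good \<Longrightarrow> 2 powr (- (real l * s')) \<le> measure N (dcell P l (cell_index P l (\<xi> i)))"
    and thick: "\<And>i. i \<in> Good \<Longrightarrow> 2 powr (- \<epsilon> * real l) * measure N (dcell P l (cell_index P l (\<xi> i)))
      \<le> measure N (F \<inter> dcell P l (cell_index P l (\<xi> i)))"
    and sparse: "\<And>i j. i \<in> Good \<Longrightarrow> L < j \<Longrightarrow> j \<le> l \<Longrightarrow>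
      real (card {i'\<in>{n..<2 * n}. \<xi> i' \<in> dcell P (int j) (cell_index P (int j) (\<xi> i))})
        \<le> 2 powr (\<epsilon> * real j) * (1 + real n * measure N (dcell P (int j) (cell_index P (int j) (\<xi> i))))"
  obtains g and W :: real where "step_fun P l g" "\<And>y. 0 \<le> g y \<and> g y \<le> W"
    "\<And>y. g y \<noteq> 0 \<Longrightarrow> \<exists>i\<in>Good. cell_index P l (\<xi> i) = cell_index P l y"
    "(\<integral>y. g y \<partial>restr F) = real (card Good) / real n"
    "\<And>k. (\<integral>y. indicator (dcell P L k) y * g y \<partial>restr F)
        = real (card {i\<in>Good. \<xi> i \<in> dcell P L k}) / real n"
    "\<And>j Q. int L < j \<Longrightarrow> Q \<in> dyadic_level P j \<Longrightarrow> (\<integral>y. indicator Q y * g y \<partial>restr F)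
      \<le> (4 * 2 powr (- \<epsilon> * real l) + c1 powr (1 - \<eta>) * 2 powr (- \<epsilon> * real L)) * measure N Q powr \<eta>"
proof -
  interpret R: bounded_line_measure "restr F" a b using F by (rule bounded_restr)
  have n0: "0 < real n" using n by (smt (verit) powr_gt_zero)
  define R where "R Q = measure (restr F) Q" for Q
  have R: "R Q = measure N (F \<inter> Q)" if "Q \<in> sets borel" for Q
    unfolding R_def using F that by (rule measure_restr)
  define I where "I k = dcell P (int l) k" for k
  have I_sets [measurable, simp]: "I k \<in> sets borel" for k by (simp add: I_def)
  define K where "K = {cell_index P l a..cell_index P l b}"
  have finGood: "finite Good" using Good finite_subset by blast
  define c where "c k = card {i\<in>Good. cell_index P l (\<xi> i) = k}" for k
  \<comment> \<open>The mass \<open>c k / n\<close> is spread over the cell in proportion to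
    \<open>restr F\<close>; by \<open>thick\<close> and \<open>heavy\<close> the denominator is
    positive where \<open>c k\<close> is not 0.\<close>
  define \<phi> where "\<phi> k = real (c k) / (real n * R (I k))" for k
  define g where "g = (\<lambda>y. \<phi> (cell_index P l y))"
  have \<phi>0: "0 \<le> \<phi> k" for k using n0 by (simp add: \<phi>_def R_def)
  have Rpos: "0 < R (I (cell_index P l (\<xi> i)))" if "i \<in> Good" for i
  proof -
    have "0 < measure N (I (cell_index P l (\<xi> i)))"
      unfolding I_def using heavy [OF that] by (smt (verit) powr_gt_zero)
    then have "0 < 2 powr (- \<epsilon> * real l) * measure N (I (cell_index P l (\<xi> i)))" by simp
    also have "\<dots> \<le> R (I (cell_index P l (\<xi> i)))" using thick [OF that] R by (simp add: I_def)
    finally show ?thesis .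
  qed
  have c_pos: "\<exists>i\<in>Good. cell_index P l (\<xi> i) = k" if "c k \<noteq> 0" for k
    using that unfolding c_def by (metis (mono_tags, lifting) card.empty empty_Collect_eq)
  have K: "cell_index P l (\<xi> i) \<in> K" for i
    using \<xi> [of i] by (auto simp: K_def cell_index_mono)
  have \<phi>_out: "\<phi> k = 0" if "k \<notin> K" for k
    using c_pos [of k] K that by (force simp: \<phi>_def)
  have \<phi>_bd: "\<phi> k \<le> sum \<phi> K" for k
  proof (cases "k \<in> K")
    case True then show ?thesis using \<phi>0 by (intro member_le_sum) (auto simp: K_def)
  next
    case False then show ?thesis using \<phi>0 \<phi>_out by (simp add: sum_nonneg)
  qed
  have int: "(\<integral>y. indicator Q y * g y \<partial>restr F) = (\<Sum>k\<in>K. \<phi> k * R (I k \<inter> Q))" if Q: "Q \<in> sets borel" for Q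
  proof -
    have "(\<integral>y. indicator Q y * g y \<partial>restr F) = (\<integral>y. g y * indicator Q y \<partial>restr F)"
      by (simp add: mult.commute)
    also have "\<dots> = (\<Sum>k\<in>K. \<phi> k * (\<integral>y. indicator (dcell P l k) y * indicator Q y \<partial>restr F))"
      unfolding K_def by (rule R.integral_step_mult [OF g_def, where W = 1]) (use Q in \<open>auto simp: indicator_def\<close>)
    also have "\<dots> = (\<Sum>k\<in>K. \<phi> k * R (I k \<inter> Q))"
      unfolding I_def R_def by (simp flip: indicator_inter_arith)
    finally show ?thesis .
  qed
  \<comment> \<open>A union of level \<open>l\<close> cells either contains the whole cell of a
    visit or misses it.\<close>
  have sat: "(\<integral>y. indicator Q y * g y \<partial>restr F) = real (card {i\<in>Good. \<xi> i \<in> Q}) / real n"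
    if Q: "Q \<in> sets borel" and s: "\<And>x y. cell_index P l x = cell_index P l y \<Longrightarrow> x \<in> Q \<Longrightarrow> y \<in> Q" for Q
  proof -
    have "\<phi> k * R (I k \<inter> Q) = real (card {i\<in>{i\<in>Good. \<xi> i \<in> Q}. cell_index P l (\<xi> i) = k}) / real n" for k
    proof (cases "\<exists>i\<in>Good. cell_index P l (\<xi> i) = k")
      case True
      then obtain i where i: "i \<in> Good" "cell_index P l (\<xi> i) = k" by blast
      show ?thesis
      proof (cases "\<xi> i \<in> Q")
        case True
        have in_Q: "y \<in> Q" if "cell_index P l y = k" for y
          using s [of "\<xi> i" y] i(2) that True by simp
        then have "I k \<inter> Q = I k" unfolding I_def by (auto simp only: mem_dcell Int_iff set_eq_iff)
        moreover have "{i\<in>{i\<in>Good. \<xi> i \<in> Q}. cell_index P l (\<xi> i) = k} = {i\<in>Good. cell_index P l (\<xi> i) = k}"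
          using in_Q by blast
        ultimately show ?thesis using Rpos [OF i(1)] i(2) by (simp add: \<phi>_def c_def)
      next
        case False
        have not_Q: "y \<notin> Q" if "cell_index P l y = k" for y
          using s [of y "\<xi> i"] i(2) that False by auto
        then have "I k \<inter> Q = {}" unfolding I_def by (auto simp only: mem_dcell Int_iff set_eq_iff empty_iff)
        moreover have "{i\<in>{i\<in>Good. \<xi> i \<in> Q}. cell_index P l (\<xi> i) = k} = {}"
          using not_Q by blast
        ultimately show ?thesis by (simp only: R_def) simp
      qed
    next
      case False
      then have "c k = 0" using c_pos by blast
      moreover have "{i\<in>{i\<in>Good. \<xi> i \<in> Q}. cell_index P l (\<xi> i) = k} = {}" using False by blast
      ultimately show ?thesis by (simp only: \<phi>_def) simp
    qed
    then have "(\<integral>y. indicator Q y * g y \<partial>restr F)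
      = (\<Sum>k\<in>K. real (card {i\<in>{i\<in>Good. \<xi> i \<in> Q}. cell_index P l (\<xi> i) = k})) / real n"
      unfolding int [OF Q] by (simp add: sum_divide_distrib)
    also have "(\<Sum>k\<in>K. real (card {i\<in>{i\<in>Good. \<xi> i \<in> Q}. cell_index P l (\<xi> i) = k}))
      = real (card {i\<in>Good. \<xi> i \<in> Q})"
      using sum.group [of "{i\<in>Good. \<xi> i \<in> Q}" K "\<lambda>i. cell_index P l (\<xi> i)" "\<lambda>_. 1::real"] finGood K
      by (force simp: K_def)
    finally show ?thesis .
  qed
  have step: "step_fun P l g" by (simp add: g_def step_fun_def)
  have bd: "0 \<le> g y \<and> g y \<le> sum \<phi> K" for y using \<phi>0 \<phi>_bd by (simp add: g_def)
  have nz: "\<exists>i\<in>Good. cell_index P l (\<xi> i) = cell_index P l y" if "g y \<noteq> 0" for y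
    using that c_pos [of "cell_index P l y"] by (auto simp: g_def \<phi>_def)
  have total: "(\<integral>y. g y \<partial>restr F) = real (card Good) / real n"
    using sat [of UNIV] by simp
  have satL: "y \<in> dcell P j k" if "cell_index P l x = cell_index P l y" "x \<in> dcell P j k" "j \<le> int l" for x y j k
    using that cell_index_eq_coarser [of P l x y j] by (simp add: mem_dcell)
  have levelL: "(\<integral>y. indicator (dcell P L k) y * g y \<partial>restr F)
        = real (card {i\<in>Good. \<xi> i \<in> dcell P L k}) / real n" for k
    by (rule sat [OF dcell_sets], rule satL) (use Ll in auto)
  have fine: "(\<integral>y. indicator Q y * g y \<partial>restr F)
      \<le> (4 * 2 powr (- \<epsilon> * real l) + c1 powr (1 - \<eta>) * 2 powr (- \<epsilon> * real L)) * measure N Q powr \<eta>"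
    if j: "int L < j" and Q: "Q \<in> dyadic_level P j" for j Q
  proof -
    define B where "B = 4 * 2 powr (- \<epsilon> * real l) + c1 powr (1 - \<eta>) * 2 powr (- \<epsilon> * real L)"
    have B0: "0 \<le> B" by (simp add: B_def)
    obtain k where Qk: "Q = dcell P j k" using Q by (auto simp: dyadic_level_eq)
    have Qs: "Q \<in> sets borel" by (simp add: Qk)
    define J where "J = nat j"
    have J: "j = int J" "L < J" using j by (auto simp: J_def)
    have est: "2 powr (2 * \<epsilon> * real i) * (1 / real n + m) \<le> B * m powr \<eta>"
      if "0 < m" "2 powr (- (real l * s')) \<le> m" "m \<le> c1 * 2 powr (- t1 * real i)" "L \<le> i" "i \<le> l" for m i
    proof -
      have "2 powr (2 * \<epsilon> * real i) * (1 / real n + m)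
        \<le> (4 * 2 powr (- \<epsilon> * real l) + c1 powr (1 - \<eta>) * 2 powr (- \<epsilon> * real i)) * m powr \<eta>"
        using that(1-3) par n that(5) by (rule powr_estimate)
      also have "\<dots> \<le> B * m powr \<eta>"
      proof -
        have "\<epsilon> * real L \<le> \<epsilon> * real i" using that par by (intro mult_left_mono) auto
        then have "2 powr (- \<epsilon> * real i) \<le> 2 powr (- \<epsilon> * real L)" by (intro powr_mono) simp_all
        then show ?thesis unfolding B_def by (intro mult_right_mono add_left_mono mult_left_mono) auto
      qed
      finally show ?thesis .
    qed
    show ?thesis
    proof (cases "J \<le> l")
      case True
      have eq: "(\<integral>y. indicator Q y * g y \<partial>restr F) = real (card {i\<in>Good. \<xi> i \<in> Q}) / real n"
        unfolding Qk by (rule sat [OF dcell_sets], rule satL) (use J True in auto)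
      show ?thesis
      proof (cases "\<exists>i\<in>Good. \<xi> i \<in> Q")
        case False
        then have "{i\<in>Good. \<xi> i \<in> Q} = {}" by blast
        then show ?thesis unfolding eq using B0 by (simp only: B_def [symmetric]) simp
      next
        case True': True
        then obtain i where i: "i \<in> Good" "\<xi> i \<in> Q" by blast
        then have ki: "cell_index P J (\<xi> i) = k" by (simp add: Qk J mem_dcell)
        have "y \<in> Q" if "y \<in> I (cell_index P l (\<xi> i))" for y
          using satL [of "\<xi> i" y j k] i(2) True that unfolding Qk J I_def by (simp add: mem_dcell)
        then have "I (cell_index P l (\<xi> i)) \<subseteq> Q" by blast
        then have "measure N (I (cell_index P l (\<xi> i))) \<le> measure N Q"
          by (intro finite_measure_mono) (auto simp: Qs)
        then have m: "2 powr (- (real l * s')) \<le> measure N Q" using heavy [OF i(1)] by (simp add: I_def)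
        then have m0: "0 < measure N Q" by (smt (verit) powr_gt_zero)
        have "real (card {i\<in>Good. \<xi> i \<in> Q}) \<le> real (card {i'\<in>{n..<2 * n}. \<xi> i' \<in> Q})"
          using Good by (intro of_nat_mono card_mono) auto
        also have "\<dots> \<le> 2 powr (\<epsilon> * real J) * (1 + real n * measure N Q)"
          using sparse [OF i(1) J(2) True] unfolding ki Qk J .
        also have "\<dots> \<le> 2 powr (2 * \<epsilon> * real J) * (1 + real n * measure N Q)"
          using par by (intro mult_right_mono powr_mono) auto
        finally have "real (card {i\<in>Good. \<xi> i \<in> Q}) / real n
          \<le> 2 powr (2 * \<epsilon> * real J) * (1 + real n * measure N Q) / real n"
          using n0 by (intro divide_right_mono) auto
        also have "\<dots> = 2 powr (2 * \<epsilon> * real J) * (1 / real n + measure N Q)"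
          using n0 by (simp add: field_simps)
        also have "\<dots> \<le> B * measure N Q powr \<eta>"
          using m0 m frostman [of J k] J True by (intro est) (auto simp: Qk)
        finally show ?thesis by (simp only: eq B_def)
      qed
    next
      case False
      \<comment> \<open>The cell of level \<open>l\<close> around \<open>Q\<close>, named by an
        arbitrary point of \<open>Q\<close>.\<close>
      define k0 where "k0 = cell_index P l (SOME y. y \<in> Q)"
      have sub: "Q \<subseteq> I k0"
      proof
        fix y assume y: "y \<in> Q"
        then have "(SOME y. y \<in> Q) \<in> Q" by (rule someI)
        then have "cell_index P j y = cell_index P j (SOME y. y \<in> Q)" using y by (simp add: Qk mem_dcell)
        then have "cell_index P l y = k0"
          unfolding k0_def by (rule cell_index_eq_coarser) (use False J in auto)
        then show "y \<in> I k0" by (simp add: I_def mem_dcell)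
      qed
      have "(\<integral>y. indicator Q y * g y \<partial>restr F) = (\<Sum>k\<in>K. \<phi> k * R (I k \<inter> Q))"
        by (rule int [OF Qs])
      also have "\<dots> = (\<Sum>k\<in>K. if k = k0 then \<phi> k0 * R Q else 0)"
      proof (rule sum.cong [OF refl])
        fix k
        show "\<phi> k * R (I k \<inter> Q) = (if k = k0 then \<phi> k0 * R Q else 0)"
        proof (cases "k = k0")
          case True
          then show ?thesis using sub by (simp add: Int_absorb1)
        next
          case False
          then have "I k \<inter> Q = {}" using sub by (auto simp: I_def mem_dcell)
          then show ?thesis using False by (simp only: R_def) simp
        qed
      qed
      also have "\<dots> \<le> \<phi> k0 * R Q" using \<phi>0 [of k0] by (simp add: R_def K_def)
      also have "\<dots> \<le> B * measure N Q powr \<eta>"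
      proof (cases "c k0 = 0")
        case True
        then show ?thesis using B0 by (simp add: \<phi>_def)
      next
        case False
        then obtain i where i: "i \<in> Good" "cell_index P l (\<xi> i) = k0" using c_pos by blast
        define m where "m = measure N (I k0)"
        have m: "2 powr (- (real l * s')) \<le> m" using heavy [OF i(1)] by (simp add: I_def i m_def)
        then have m0: "0 < m" by (smt (verit) powr_gt_zero)
        have RQ: "R Q \<le> measure N Q" unfolding R_def using F Qs by (rule measure_restr_le)
        have Qm: "measure N Q \<le> m" unfolding m_def using sub by (intro finite_measure_mono) auto
        have RI: "2 powr (- \<epsilon> * real l) * m \<le> R (I k0)"
          using thick [OF i(1)] R by (simp add: m_def I_def i)
        have pos: "0 < 2 powr (- \<epsilon> * real l) * m" using m0 by simp
        have "real (c k0) \<le> real (card {i'\<in>{n..<2 * n}. \<xi> i' \<in> I k0})"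
          unfolding c_def I_def using Good by (intro of_nat_mono card_mono) (auto simp: mem_dcell)
        also have "\<dots> \<le> 2 powr (\<epsilon> * real l) * (1 + real n * m)"
          using sparse [OF i(1) Ll] by (simp add: i m_def I_def)
        finally have ck: "real (c k0) / real n \<le> 2 powr (\<epsilon> * real l) * (1 / real n + m)"
          using n0 by (simp add: field_simps)
        \<comment> \<open>A ratio at most 1 does not decrease when raised to \<eta> < 1.\<close>
        have "measure N Q / m \<le> measure N Q powr \<eta> * m powr (- \<eta>)"
        proof (cases "measure N Q = 0")
          case False
          then have q: "0 < measure N Q" using measure_nonneg [of N Q] by linarith
          have "measure N Q / m = (measure N Q powr \<eta> * measure N Q powr (1 - \<eta>)) * m powr (- 1)"
            using q m0 by (simp add: powr_minus_divide flip: powr_add)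
          also have "\<dots> \<le> (measure N Q powr \<eta> * m powr (1 - \<eta>)) * m powr (- 1)"
            using q Qm par by (intro mult_left_mono mult_right_mono powr_mono2) auto
          also have "\<dots> = measure N Q powr \<eta> * m powr (- \<eta>)"
            unfolding mult.assoc powr_add [symmetric] by simp
          finally show ?thesis .
        qed simp
        note quot = this
        have "\<phi> k0 * R Q = real (c k0) / real n * (R Q / R (I k0))" by (simp add: \<phi>_def)
        \<comment> \<open>One factor \<open>2 powr (\<epsilon> * real l)\<close> stems from
          crowding, the other from the small part of the cell that \<open>F\<close> may fill;
          together they are the prefactor of \<open>powr_estimate\<close>.\<close>
        also have "\<dots> \<le> (2 powr (\<epsilon> * real l) * (1 / real n + m)) * (measure N Q / (2 powr (- \<epsilon> * real l) * m))"
        proof (intro mult_mono frac_le ck RQ RI pos)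
          show "0 \<le> 2 powr (\<epsilon> * real l) * (1 / real n + m)"
            using m0 by (intro mult_nonneg_nonneg add_nonneg_nonneg) auto
        qed (use RI pos in \<open>auto simp: R_def\<close>)
        also have "\<dots> = (2 powr (\<epsilon> * real l) / 2 powr (- \<epsilon> * real l)) * (1 / real n + m) * (measure N Q / m)"
          by simp
        also have "2 powr (\<epsilon> * real l) / 2 powr (- \<epsilon> * real l) = 2 powr (2 * \<epsilon> * real l)"
          by (simp add: mult.assoc flip: powr_diff)
        also have "2 powr (2 * \<epsilon> * real l) * (1 / real n + m) * (measure N Q / m)
          \<le> (B * m powr \<eta>) * (measure N Q powr \<eta> * m powr (- \<eta>))"
          using m m0 frostman [of l k0] Ll B0 quot
          by (intro mult_mono est) (auto simp: m_def I_def)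
        also have "\<dots> = B * measure N Q powr \<eta> * (m powr \<eta> * m powr (- \<eta>))" by simp
        also have "m powr \<eta> * m powr (- \<eta>) = 1" using m0 by (simp flip: powr_add)
        finally show ?thesis by simp
      qed
      finally show ?thesis unfolding B_def .
    qed
  qed
  show thesis
    by (rule that [OF step bd nz total levelL fine])
qed

end

section \<open>Law of large numbers along orbits\<close>

text \<open>Every distance from \<open>j\<close> occurs at most twice, once on each side.\<close>

lemma sum_dist_le_suminf:
  fixes p :: "nat \<Rightarrow> real"
  assumes "summable p" "\<And>m. 0 \<le> p m" "finite A"
  shows "(\<Sum>k\<in>A. p (if j \<le> k then k - j else j - k)) \<le> 2 * suminf p"
proof -
  have "(\<Sum>k\<in>A. p (if j \<le> k then k - j else j - k))
    = (\<Sum>k\<in>{k\<in>A. j \<le> k}. p (k - j)) + (\<Sum>k\<in>{k\<in>A. k < j}. p (j - k))"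
    using assms(3) by (simp add: if_distrib [of p] sum.If_cases Int_def not_le)
  also have "(\<Sum>k\<in>{k\<in>A. j \<le> k}. p (k - j)) = (\<Sum>m\<in>(\<lambda>k. k - j) ` {k\<in>A. j \<le> k}. p m)"
    by (subst sum.reindex) (auto simp: inj_on_def)
  also have "(\<Sum>k\<in>{k\<in>A. k < j}. p (j - k)) = (\<Sum>m\<in>(\<lambda>k. j - k) ` {k\<in>A. k < j}. p m)"
    by (subst sum.reindex) (auto simp: inj_on_def)
  also have "(\<Sum>m\<in>(\<lambda>k. k - j) ` {k\<in>A. j \<le> k}. p m) \<le> suminf p"
    using assms by (intro sum_le_suminf) auto
  also have "(\<Sum>m\<in>(\<lambda>k. j - k) ` {k\<in>A. k < j}. p m) \<le> suminf p"
    using assms by (intro sum_le_suminf) auto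
  finally show ?thesis by simp
qed

text \<open>Only the hypotheses on the system itself; the anchor of the grid, the bound on cell
  measures and the exponents remain parameters of the lemmas.\<close>

locale mixing_system = prob_space \<mu> for \<mu> :: "real measure" +
  fixes a b :: real and T :: "real \<Rightarrow> real" and p :: "nat \<Rightarrow> real"
  assumes ab: "a < b"
    and sets_mu: "sets \<mu> = sets (restrict_space borel {a..b})"
    and T_meas: "T \<in> measurable \<mu> \<mu>"
    and T_inv: "distr \<mu> \<mu> T = \<mu>"
    and p_summable: "summable p"
    and decay: "\<And>n f g. integrable \<mu> f \<Longrightarrow> bounded_variation_on {a..b} g \<Longrightarrow>
           \<bar>(\<integral>x. f ((T ^^ n) x) * g x \<partial>\<mu>) - (\<integral>x. f x \<partial>\<mu>) * (\<integral>x. g x \<partial>\<mu>)\<bar>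
             \<le> p n * (\<integral>x. \<bar>f x\<bar> \<partial>\<mu>)
                 * ((\<integral>x. \<bar>g x\<bar> \<partial>\<mu>) + enn2real (total_variation {a..b} g))"
begin

abbreviation M :: "real measure" where "M \<equiv> line_measure \<mu>"

lemma space_mu: "space \<mu> = {a..b}"
  using sets_eq_imp_space_eq [OF sets_mu] by (simp add: space_restrict_space)

lemma borel_to_mu: "f \<in> borel_measurable borel \<Longrightarrow> f \<in> borel_measurable \<mu>"
  unfolding measurable_cong_sets [OF sets_mu refl] by (rule measurable_restrict_space1)

lemma ident_meas: "(\<lambda>x. x) \<in> measurable \<mu> borel"
  by (rule borel_to_mu) (rule measurable_ident_sets, simp)

lemma sets_M [simp]: "sets M = sets borel"
  by (simp add: line_measure_def)

lemma prob_M: "prob_space M"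
  unfolding line_measure_def by (rule prob_space_distr [OF ident_meas])

lemma bounded_M: "bounded_line_measure M a b"
proof (intro bounded_line_measure.intro bounded_line_measure_axioms.intro)
  show "finite_measure M" using prob_M by (rule prob_space.axioms(1))
  show "AE y in M. y \<in> {a..b}"
    unfolding line_measure_def by (subst AE_distr_iff [OF ident_meas]) (auto simp: space_mu)
qed simp

sublocale M: bounded_line_measure M a b by (rule bounded_M)

lemma measure_M_le_1: "measure M Q \<le> 1"
  using prob_space.prob_le_1 [OF prob_M] .

lemma integral_M: "f \<in> borel_measurable borel \<Longrightarrow> (\<integral>y. f y \<partial>M) = (\<integral>x. f x \<partial>\<mu>)" for f :: "real \<Rightarrow> real"
  unfolding line_measure_def using ident_meas by (subst integral_distr) auto

lemma iter_meas: "T ^^ k \<in> measurable \<mu> \<mu>"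
  by (induction k) (use T_meas in \<open>auto intro: measurable_comp\<close>)

lemma iter_inv: "distr \<mu> \<mu> (T ^^ k) = \<mu>"
proof (induction k)
  case (Suc k)
  have "distr \<mu> \<mu> (T ^^ Suc k) = distr (distr \<mu> \<mu> (T ^^ k)) \<mu> T"
    using iter_meas T_meas by (simp add: distr_distr)
  then show ?case unfolding Suc T_inv .
qed (simp add: distr_id id_def)

lemma iter_in: "x \<in> {a..b} \<Longrightarrow> (T ^^ k) x \<in> {a..b}"
  using measurable_space [OF iter_meas] by (simp add: space_mu)

lemma integral_iter:
  fixes f :: "real \<Rightarrow> real"
  assumes "f \<in> borel_measurable \<mu>"
  shows "(\<integral>x. f ((T ^^ k) x) \<partial>\<mu>) = (\<integral>x. f x \<partial>\<mu>)"
  using integral_distr [OF iter_meas, of f k] assms by (simp add: iter_inv)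

lemma integrable_iter:
  fixes f :: "real \<Rightarrow> real"
  assumes "integrable \<mu> f"
  shows "integrable \<mu> (\<lambda>x. f ((T ^^ k) x))"
  by (rule integrable_distr [OF iter_meas]) (simp add: iter_inv assms)

lemma meas_iter: "f \<in> borel_measurable borel \<Longrightarrow> (\<lambda>x. f ((T ^^ k) x)) \<in> borel_measurable \<mu>"
  using measurable_compose [OF iter_meas borel_to_mu] .

lemma integrable_bounded_mu:
  fixes f :: "real \<Rightarrow> real"
  assumes "f \<in> borel_measurable \<mu>" "\<And>y. \<bar>f y\<bar> \<le> W"
  shows "integrable \<mu> f"
  using assms by (intro integrable_const_bound [where B = W]) auto

text \<open>Testing the decay with constant functions equal to 1 gives 0 on the left and
  \<open>p m\<close> on the right.\<close>

lemma p_nonneg: "0 \<le> p m"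
proof -
  have "variation_le (\<lambda>x. 1) 0" by (rule variation_le_const)
  then have "bounded_variation_on {a..b} (\<lambda>x. 1)" "total_variation {a..b} (\<lambda>x. 1) = 0"
    using bounded_variation_onI total_variation_le [of "\<lambda>x. 1" 0 "{a..b}"] by auto
  then show ?thesis using decay [of "\<lambda>x. 1" "\<lambda>x. 1" m] by (simp add: prob_space)
qed

lemma correlation_le:
  assumes u: "u \<in> borel_measurable borel" "\<And>y. \<bar>u y\<bar> \<le> W" and B: "variation_le u B"
  shows "(\<integral>x. u ((T ^^ m) x) * u x \<partial>\<mu>)
    \<le> (\<integral>x. u x \<partial>\<mu>)\<^sup>2 + p m * ((\<integral>x. \<bar>u x\<bar> \<partial>\<mu>) * ((\<integral>x. \<bar>u x\<bar> \<partial>\<mu>) + B))"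
proof -
  have "enn2real (total_variation {a..b} u) \<le> B"
    using total_variation_le [OF B] variation_le_nonneg [OF B] by (simp add: enn2real_leI)
  then have "p m * (\<integral>x. \<bar>u x\<bar> \<partial>\<mu>) * ((\<integral>x. \<bar>u x\<bar> \<partial>\<mu>) + enn2real (total_variation {a..b} u))
    \<le> p m * (\<integral>x. \<bar>u x\<bar> \<partial>\<mu>) * ((\<integral>x. \<bar>u x\<bar> \<partial>\<mu>) + B)"
    using p_nonneg by (intro mult_left_mono add_left_mono mult_nonneg_nonneg) auto
  moreover have "integrable \<mu> u" using u borel_to_mu by (intro integrable_bounded_mu) auto
  ultimately show ?thesis
    using decay [of u u m] bounded_variation_onI [OF B]
    by (simp add: power2_eq_square mult.assoc abs_le_iff)
qed

text \<open>Invariance moves the pair \<open>j\<close>, \<open>k\<close> to 0, \<open>k - j\<close>,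
  where \<open>correlation_le\<close> applies. Summability of \<open>p\<close> makes the total error
  linear in \<open>n\<close> although there are \<open>n\<close> squared pairs.\<close>

lemma second_moment:
  assumes u: "u \<in> borel_measurable borel" "\<And>y. \<bar>u y\<bar> \<le> W" and B: "variation_le u B"
  shows "(\<integral>x. (\<Sum>k\<in>{n..<2 * n}. u ((T ^^ k) x))\<^sup>2 \<partial>\<mu>)
    \<le> (real n * (\<integral>x. u x \<partial>\<mu>))\<^sup>2
      + 2 * real n * suminf p * ((\<integral>x. \<bar>u x\<bar> \<partial>\<mu>) * ((\<integral>x. \<bar>u x\<bar> \<partial>\<mu>) + B))"
proof -
  define C where "C = (\<integral>x. \<bar>u x\<bar> \<partial>\<mu>) * ((\<integral>x. \<bar>u x\<bar> \<partial>\<mu>) + B)"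
  define e where "e = (\<integral>x. u x \<partial>\<mu>)"
  define d where "d j k = (if j \<le> k then k - j else j - k)" for j k :: nat
  have C0: "0 \<le> C"
    using variation_le_nonneg [OF B] by (auto simp: C_def intro!: mult_nonneg_nonneg add_nonneg_nonneg)
  have W0: "0 \<le> W" using u(2) [of 0] by linarith
  have meas: "(\<lambda>x. u ((T ^^ j) x) * u ((T ^^ k) x)) \<in> borel_measurable \<mu>" for j k
    using meas_iter [OF u(1)] by (intro borel_measurable_times)
  have int: "integrable \<mu> (\<lambda>x. u ((T ^^ j) x) * u ((T ^^ k) x))" for j k
    using meas by (rule integrable_bounded_mu [where W = "W * W"])
      (use u(2) W0 in \<open>auto simp: abs_mult intro: mult_mono\<close>)
  have le1: "(\<integral>x. u ((T ^^ j) x) * u ((T ^^ k) x) \<partial>\<mu>) \<le> e\<^sup>2 + p (k - j) * C" if "j \<le> k" for j k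
  proof -
    have "T ^^ k = (T ^^ (k - j)) \<circ> (T ^^ j)" using that by (simp flip: funpow_add)
    then have "(\<integral>x. u ((T ^^ j) x) * u ((T ^^ k) x) \<partial>\<mu>)
      = (\<integral>x. (\<lambda>y. u ((T ^^ (k - j)) y) * u y) ((T ^^ j) x) \<partial>\<mu>)"
      by (simp add: mult.commute)
    also have "\<dots> = (\<integral>x. u ((T ^^ (k - j)) x) * u x \<partial>\<mu>)"
      using meas [of "k - j" 0] by (intro integral_iter) simp
    also have "\<dots> \<le> e\<^sup>2 + p (k - j) * C"
      unfolding e_def C_def by (rule correlation_le [OF u B])
    finally show ?thesis .
  qed
  have le: "(\<integral>x. u ((T ^^ j) x) * u ((T ^^ k) x) \<partial>\<mu>) \<le> e\<^sup>2 + p (d j k) * C" for j k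
  proof (cases "j \<le> k")
    case True then show ?thesis using le1 by (simp add: d_def)
  next
    case False
    then show ?thesis using le1 [of k j] by (simp add: d_def mult.commute)
  qed
  have "(\<integral>x. (\<Sum>k\<in>{n..<2 * n}. u ((T ^^ k) x))\<^sup>2 \<partial>\<mu>)
    = (\<Sum>j\<in>{n..<2 * n}. \<Sum>k\<in>{n..<2 * n}. \<integral>x. u ((T ^^ j) x) * u ((T ^^ k) x) \<partial>\<mu>)"
    using int by (simp add: power2_eq_square sum_product Bochner_Integration.integral_sum)
  also have "\<dots> \<le> (\<Sum>j\<in>{n..<2 * n}. \<Sum>k\<in>{n..<2 * n}. e\<^sup>2 + p (d j k) * C)"
    by (intro sum_mono le)
  also have "\<dots> = (\<Sum>j\<in>{n..<2 * n}. real n * e\<^sup>2 + (\<Sum>k\<in>{n..<2 * n}. p (d j k)) * C)"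
    by (simp add: sum.distrib sum_distrib_right)
  also have "\<dots> \<le> (\<Sum>j\<in>{n..<2 * n}. real n * e\<^sup>2 + (2 * suminf p) * C)"
    unfolding d_def using sum_dist_le_suminf [OF p_summable p_nonneg] C0
    by (intro sum_mono add_left_mono mult_right_mono) auto
  also have "\<dots> = (real n * e)\<^sup>2 + 2 * real n * suminf p * C"
    by (simp add: power2_eq_square algebra_simps)
  finally show ?thesis unfolding e_def C_def .
qed

text \<open>A dyadic window of times: it has \<open>n\<close> elements, and the radii of all balls
  in it agree up to a factor \<open>2 powr \<alpha>\<close>.\<close>

definition cnt :: "nat \<Rightarrow> real set \<Rightarrow> real \<Rightarrow> real" where
  "cnt n Q x = (\<Sum>k\<in>{n..<2 * n}. indicator Q ((T ^^ k) x))"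

lemma cnt_card: "cnt n Q x = real (card {k\<in>{n..<2 * n}. (T ^^ k) x \<in> Q})"
proof -
  have "cnt n Q x = (\<Sum>k\<in>{k\<in>{n..<2 * n}. (T ^^ k) x \<in> Q}. 1)"
    unfolding cnt_def by (rule sum.mono_neutral_cong_right) (auto simp: indicator_def)
  then show ?thesis by simp
qed

lemma cnt_meas [measurable]: "Q \<in> sets borel \<Longrightarrow> cnt n Q \<in> borel_measurable \<mu>"
  unfolding cnt_def [abs_def] by (intro borel_measurable_sum meas_iter borel_measurable_indicator)

lemma cnt_bound: "0 \<le> cnt n Q x" "cnt n Q x \<le> real n"
proof -
  show "0 \<le> cnt n Q x" by (simp add: cnt_card)
  have "card {k\<in>{n..<2 * n}. (T ^^ k) x \<in> Q} \<le> card {n..<2 * n}" by (intro card_mono) auto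
  then show "cnt n Q x \<le> real n" by (simp add: cnt_card)
qed

lemma integral_sum_iter:
  fixes f :: "real \<Rightarrow> real"
  assumes "f \<in> borel_measurable borel" "\<And>y. \<bar>f y\<bar> \<le> W"
  shows "(\<integral>x. (\<Sum>k\<in>{n..<2 * n}. f ((T ^^ k) x)) \<partial>\<mu>) = real n * (\<integral>y. f y \<partial>M)"
    and "integrable \<mu> (\<lambda>x. \<Sum>k\<in>{n..<2 * n}. f ((T ^^ k) x))"
proof -
  have "integrable \<mu> f" using assms borel_to_mu by (intro integrable_bounded_mu) auto
  then have int: "integrable \<mu> (\<lambda>x. f ((T ^^ k) x))" for k by (rule integrable_iter)
  show "(\<integral>x. (\<Sum>k\<in>{n..<2 * n}. f ((T ^^ k) x)) \<partial>\<mu>) = real n * (\<integral>y. f y \<partial>M)"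
    using int by (simp add: Bochner_Integration.integral_sum integral_iter [OF borel_to_mu [OF assms(1)]]
        integral_M [OF assms(1)])
  show "integrable \<mu> (\<lambda>x. \<Sum>k\<in>{n..<2 * n}. f ((T ^^ k) x))" using int by auto
qed

text \<open>The indicator of a cell has variation at most 2 and integral at most 1, so its norm is
  at most 3. The factor from the L1 norm keeps the error proportional to the measure of the cell,
  which is what makes sums over cells bounded.\<close>

lemma cnt_second_moment:
  "(\<integral>x. (cnt n (dcell P l k) x)\<^sup>2 \<partial>\<mu>)
    \<le> (real n * measure M (dcell P l k))\<^sup>2 + 6 * suminf p * (real n * measure M (dcell P l k))"
proof -
  define Q where "Q = dcell P l k"
  define m where "m = measure M Q"
  have Q: "Q \<in> sets borel" by (simp add: Q_def)
  have ind: "(indicator Q :: real \<Rightarrow> real) \<in> borel_measurable borel" using Q by simp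
  have var: "variation_le (indicator Q) 2"
    unfolding Q_def dcell_def by (rule variation_le_interval) simp
  have m: "(\<integral>x. indicator Q x \<partial>\<mu>) = m" "(\<integral>x. \<bar>indicator Q x\<bar> \<partial>\<mu>) = m"
    using integral_M [OF ind] Q by (simp_all add: m_def)
  have m01: "0 \<le> m" "m \<le> 1" using measure_M_le_1 by (auto simp: m_def)
  have S0: "0 \<le> suminf p" using p_summable p_nonneg by (rule suminf_nonneg)
  have "(\<integral>x. (cnt n Q x)\<^sup>2 \<partial>\<mu>) \<le> (real n * m)\<^sup>2 + 2 * real n * suminf p * (m * (m + 2))"
    using second_moment [OF ind _ var, of 1 n] unfolding m cnt_def by (simp add: indicator_def)
  also have "\<dots> \<le> (real n * m)\<^sup>2 + 2 * real n * suminf p * (m * 3)"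
    using m01 S0 by (intro add_left_mono mult_left_mono) auto
  finally show ?thesis by (simp add: m_def Q_def mult_ac)
qed

text \<open>\<open>S\<close> is replaced by \<open>u\<close> of bounded variation; invariance turns
  the L1 error of this replacement into an error per visit. For \<open>u\<close> the variance is
  linear in \<open>n\<close>.\<close>

lemma law_of_large_numbers:
  assumes S: "S \<in> sets borel" and e: "0 < e"
  shows "\<forall>\<^sub>F n in sequentially. (\<integral>x. \<bar>cnt n S x - real n * measure M S\<bar> \<partial>\<mu>) \<le> e * real n"
proof -
  obtain u where u: "bv u" "(\<integral>y. \<bar>indicator S y - u y\<bar> \<partial>M) \<le> e / 4"
    using M.bv_dense [OF S, of "e / 4"] e by auto
  obtain W B where um: "u \<in> borel_measurable borel" and W: "\<And>y. \<bar>u y\<bar> \<le> W" and B: "variation_le u B"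
    using u(1) unfolding bv_def by blast
  define f where "f y = \<bar>indicator S y - u y\<bar>" for y
  have fm: "f \<in> borel_measurable borel" unfolding f_def [abs_def] using S um by measurable
  have fb: "\<bar>f y\<bar> \<le> 1 + W" for y
    using W [of y] unfolding f_def by (auto simp: indicator_def)
  define E where "E = (\<integral>x. u x \<partial>\<mu>)"
  define V where "V = 2 * suminf p * ((\<integral>x. \<bar>u x\<bar> \<partial>\<mu>) * ((\<integral>x. \<bar>u x\<bar> \<partial>\<mu>) + B))"
  define U where "U n x = (\<Sum>k\<in>{n..<2 * n}. u ((T ^^ k) x))" for n x
  have Eint: "(\<integral>x. U n x \<partial>\<mu>) = real n * E" and Uint: "integrable \<mu> (U n)" for n
    using integral_sum_iter [OF um W, of n] integral_M [OF um] by (simp_all add: U_def [abs_def] E_def)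
  have W0: "0 \<le> W" using W [of 0] by linarith
  have Ub: "\<bar>U n x\<bar> \<le> real n * W" for n x
  proof -
    have "\<bar>U n x\<bar> \<le> (\<Sum>k\<in>{n..<2 * n}. \<bar>u ((T ^^ k) x)\<bar>)" unfolding U_def by (rule sum_abs)
    also have "\<dots> \<le> (\<Sum>k\<in>{n..<2 * n}. W)" using W by (intro sum_mono)
    finally show ?thesis by simp
  qed
  have Um [measurable]: "U n \<in> borel_measurable \<mu>" for n using Uint by auto
  have U2: "integrable \<mu> (\<lambda>x. (U n x)\<^sup>2)" for n
  proof (rule integrable_bounded_mu [where W = "(real n * W)\<^sup>2"])
    show "\<bar>(U n y)\<^sup>2\<bar> \<le> (real n * W)\<^sup>2" for y
      using power_mono [OF Ub [of n y], of 2] by simp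
  qed measurable
  have var: "(\<integral>x. (U n x - real n * E)\<^sup>2 \<partial>\<mu>) \<le> real n * V" for n
  proof -
    have "(\<integral>x. (U n x - real n * E)\<^sup>2 \<partial>\<mu>) = (\<integral>x. (U n x)\<^sup>2 + (real n * E)\<^sup>2 - 2 * (real n * E) * U n x \<partial>\<mu>)"
      by (simp add: power2_diff mult_ac)
    also have "\<dots> = (\<integral>x. (U n x)\<^sup>2 \<partial>\<mu>) - (real n * E)\<^sup>2"
      using U2 Uint Eint by (simp add: prob_space power2_eq_square)
    also have "\<dots> \<le> real n * V"
      using second_moment [OF um W B, of n] unfolding U_def [symmetric] E_def V_def by (simp add: algebra_simps)
    finally show ?thesis .
  qed
  have EM: "\<bar>E - measure M S\<bar> \<le> e / 4"
  proof -
    have "integrable M u" using u(1) by (rule M.integrable_bv)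
    moreover have "integrable M (indicat_real S)"
      using S by (intro M.integrable_bounded [where W = 1]) (auto simp: indicator_def)
    ultimately have "E - measure M S = - (\<integral>y. indicator S y - u y \<partial>M)"
      using integral_M [OF um] S by (simp add: E_def)
    then have "\<bar>E - measure M S\<bar> \<le> (\<integral>y. \<bar>indicator S y - u y\<bar> \<partial>M)" by simp
    then show ?thesis using u(2) by simp
  qed
  have main: "(\<integral>x. \<bar>cnt n S x - real n * measure M S\<bar> \<partial>\<mu>) \<le> 3 * e / 4 * real n + V / e"
    if n: "0 < n" for n
  proof -
    \<comment> \<open>With this \<open>t\<close>, the inequality between means bounds the deviation
      of \<open>U n\<close> in L1 by e * n / 4 + V / e. The two approximation errors contribute e *
      n / 4 each, which leaves e * n / 4 for V / e.\<close>
    define t where "t = e * real n / 2"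
    have t: "0 < t" using e n by (simp add: t_def)
    have pt: "\<bar>cnt n S x - real n * measure M S\<bar> \<le> (\<Sum>k\<in>{n..<2 * n}. f ((T ^^ k) x))
      + (t / 2 + (U n x - real n * E)\<^sup>2 / (2 * t)) + real n * (e / 4)" for x
    proof -
      have "\<bar>cnt n S x - U n x\<bar> \<le> (\<Sum>k\<in>{n..<2 * n}. f ((T ^^ k) x))"
        unfolding cnt_def U_def f_def sum_subtractf [symmetric] by (rule sum_abs)
      moreover have "\<bar>U n x - real n * E\<bar> \<le> t / 2 + (U n x - real n * E)\<^sup>2 / (2 * t)"
      proof -
        have "0 \<le> (\<bar>U n x - real n * E\<bar> - t)\<^sup>2" by simp
        then have "2 * t * \<bar>U n x - real n * E\<bar> \<le> t * t + (U n x - real n * E)\<^sup>2"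
          by (simp add: power2_diff power2_eq_square algebra_simps)
        then show ?thesis using t by (simp add: field_simps)
      qed
      moreover have "\<bar>real n * E - real n * measure M S\<bar> \<le> real n * (e / 4)"
        using mult_left_mono [OF EM, of "real n"] by (simp add: abs_mult flip: right_diff_distrib)
      ultimately show ?thesis by linarith
    qed
    have i1: "integrable \<mu> (\<lambda>x. \<Sum>k\<in>{n..<2 * n}. f ((T ^^ k) x))"
      using fm fb by (rule integral_sum_iter)
    have i2: "integrable \<mu> (\<lambda>x. (U n x - real n * E)\<^sup>2)"
      using U2 Uint by (simp add: power2_diff)
    have "(\<integral>x. \<bar>cnt n S x - real n * measure M S\<bar> \<partial>\<mu>) \<le> (\<integral>x. (\<Sum>k\<in>{n..<2 * n}. f ((T ^^ k) x))
      + (t / 2 + (U n x - real n * E)\<^sup>2 / (2 * t)) + real n * (e / 4) \<partial>\<mu>)"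
    proof (rule integral_mono [OF _ _ pt])
      have "integrable \<mu> (cnt n S)"
        using S cnt_bound by (intro integrable_bounded_mu [where W = "real n"]) auto
      then show "integrable \<mu> (\<lambda>x. \<bar>cnt n S x - real n * measure M S\<bar>)" by simp
      show "integrable \<mu> (\<lambda>x. (\<Sum>k\<in>{n..<2 * n}. f ((T ^^ k) x))
        + (t / 2 + (U n x - real n * E)\<^sup>2 / (2 * t)) + real n * (e / 4))"
        using i1 i2 by simp
    qed
    also have "\<dots> = real n * (\<integral>y. f y \<partial>M) + (t / 2 + (\<integral>x. (U n x - real n * E)\<^sup>2 \<partial>\<mu>) / (2 * t)) + real n * (e / 4)"
      using i1 i2 integral_sum_iter(1) [OF fm fb, of n] by (simp add: prob_space)
    also have "\<dots> \<le> real n * (e / 4) + (t / 2 + real n * V / (2 * t)) + real n * (e / 4)"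
      using u(2) var [of n] t unfolding f_def
      by (intro add_mono mult_left_mono divide_right_mono) auto
    also have "\<dots> = 3 * e / 4 * real n + V / e"
      using e n by (simp add: t_def field_simps)
    finally show ?thesis .
  qed
  have "\<forall>\<^sub>F n in sequentially. V / e * (4 / e) \<le> real n \<and> 0 < n"
    using eventually_ge_at_top [of "nat \<lceil>V / e * (4 / e)\<rceil>"] eventually_gt_at_top [of 0]
    by eventually_elim linarith
  then show ?thesis
  proof eventually_elim
    case (elim n)
    have "V / e \<le> e / 4 * real n" using elim e by (simp add: field_simps)
    then show ?case using main [of n] elim by linarith
  qed
qed

end

lemma geometric_tail_le:
  fixes \<epsilon> :: real
  assumes "0 < \<epsilon>"
  shows "(\<Sum>j\<in>{L<..l}. 2 powr (- \<epsilon> * real j)) \<le> 2 powr (- \<epsilon> * real L) / (1 - 2 powr - \<epsilon>)"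
proof -
  define \<rho> where "\<rho> = (2::real) powr - \<epsilon>"
  have \<rho>: "0 < \<rho>" "\<rho> < 1" using assms by (auto simp: \<rho>_def powr_minus_divide)
  have pow: "2 powr (- \<epsilon> * real j) = \<rho> ^ j" for j
    using \<rho> by (simp add: \<rho>_def powr_powr flip: powr_realpow)
  have "(\<Sum>j\<in>{L<..l}. \<rho> ^ j) \<le> (\<Sum>j\<in>(+) L ` {..<Suc l}. \<rho> ^ j)"
  proof (rule sum_mono2)
    show "{L<..l} \<subseteq> (+) L ` {..<Suc l}"
    proof
      fix j assume "j \<in> {L<..l}"
      then show "j \<in> (+) L ` {..<Suc l}" by (intro image_eqI [of _ _ "j - L"]) auto
    qed
  qed (use \<rho> in auto)
  also have "\<dots> = \<rho> ^ L * (\<Sum>j<Suc l. \<rho> ^ j)"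
    by (simp add: sum.reindex power_add sum_distrib_left del: sum.lessThan_Suc)
  also have "(\<Sum>j<Suc l. \<rho> ^ j) \<le> (\<Sum>j. \<rho> ^ j)"
    using \<rho> by (intro sum_le_suminf) auto
  also have "(\<Sum>j. \<rho> ^ j) = 1 / (1 - \<rho>)" using \<rho> by (simp add: suminf_geometric)
  finally show ?thesis
    using \<rho> unfolding pow by (simp add: \<rho>_def mult_left_mono)
qed

section \<open>Visits to light, thin and overcrowded cells\<close>

context mixing_system
begin

definition light :: "real \<Rightarrow> real \<Rightarrow> nat \<Rightarrow> int \<Rightarrow> bool" where
  "light P s' l q \<longleftrightarrow> measure M (dcell P l q) < 2 powr (- (real l * s'))"

text \<open>Mass is spread over a cell through its intersection with \<open>F\<close>, hence divided
  by the measure of that intersection; visits to cells where it is relatively tiny are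
  discarded.\<close>

definition thin :: "real \<Rightarrow> real \<Rightarrow> real set \<Rightarrow> nat \<Rightarrow> int \<Rightarrow> bool" where
  "thin P \<epsilon> F l q \<longleftrightarrow> measure M (F \<inter> dcell P l q) < 2 powr (- \<epsilon> * real l) * measure M (dcell P l q)"

text \<open>The tolerated number of visits: the expected number, with 1 added since a cell of tiny
  measure may still be visited once, times a loss growing with the level.\<close>

definition crowd :: "real \<Rightarrow> real \<Rightarrow> nat \<Rightarrow> nat \<Rightarrow> int \<Rightarrow> real" where
  "crowd P \<epsilon> n j q = 2 powr (\<epsilon> * real j) * (1 + real n * measure M (dcell P j q))"

definition good :: "real \<Rightarrow> real \<Rightarrow> real \<Rightarrow> real set \<Rightarrow> nat \<Rightarrow> nat \<Rightarrow> nat \<Rightarrow> real \<Rightarrow> nat set" where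
  "good P s' \<epsilon> F L l n x = {k\<in>{n..<2 * n}. (T ^^ k) x \<in> F
    \<and> \<not> light P s' l (cell_index P l ((T ^^ k) x)) \<and> \<not> thin P \<epsilon> F l (cell_index P l ((T ^^ k) x))
    \<and> (\<forall>j. L < j \<and> j \<le> l \<longrightarrow> cnt n (dcell P (int j) (cell_index P (int j) ((T ^^ k) x))) x
        \<le> crowd P \<epsilon> n j (cell_index P (int j) ((T ^^ k) x)))}"

text \<open>A majorant for the number of discarded visits to \<open>F\<close>. In the last sum,
  \<open>c\<close> visits to an overcrowded cell are at most \<open>c\<close> squared divided by the
  threshold, so only second moments are needed for the expectation.\<close>

definition bad_bound :: "real \<Rightarrow> real \<Rightarrow> real \<Rightarrow> real set \<Rightarrow> nat \<Rightarrow> nat \<Rightarrow> nat \<Rightarrow> real \<Rightarrow> real" where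
  "bad_bound P s' \<epsilon> F L l n x =
    (\<Sum>k\<in>{n..<2 * n}. of_bool (light P s' l (cell_index P l ((T ^^ k) x))))
    + (\<Sum>k\<in>{n..<2 * n}. of_bool (thin P \<epsilon> F l (cell_index P l ((T ^^ k) x))) * indicator F ((T ^^ k) x))
    + (\<Sum>j\<in>{L<..l}. \<Sum>q\<in>{cell_index P j a..cell_index P j b}.
        (cnt n (dcell P (int j) q) x)\<^sup>2 / crowd P \<epsilon> n j q)"

lemma crowd_pos: "0 < crowd P \<epsilon> n j q"
  unfolding crowd_def by (intro mult_pos_pos add_pos_nonneg) auto

text \<open>Each visit to \<open>F\<close> that is not good fails one of the tests, and its failure
  is counted in \<open>bad_bound\<close>; visits to overcrowded cells are regrouped by cell.\<close>

lemma cnt_le_good: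
  assumes x: "x \<in> {a..b}"
  shows "cnt n F x \<le> real (card (good P s' \<epsilon> F L l n x)) + bad_bound P s' \<epsilon> F L l n x"
proof -
  define \<xi> where "\<xi> k = (T ^^ k) x" for k
  define Gd where "Gd = good P s' \<epsilon> F L l n x"
  define cr where "cr j q \<longleftrightarrow> crowd P \<epsilon> n j q < cnt n (dcell P (int j) q) x" for j :: nat and q
  have pt: "indicator F (\<xi> k) \<le> (indicator Gd k :: real) + of_bool (light P s' l (cell_index P l (\<xi> k)))
      + of_bool (thin P \<epsilon> F l (cell_index P l (\<xi> k))) * indicator F (\<xi> k)
      + (\<Sum>j\<in>{L<..l}. of_bool (cr j (cell_index P j (\<xi> k))))"
    if k: "k \<in> {n..<2 * n}" for k
  proof -
    have s0: "0 \<le> (\<Sum>j\<in>{L<..l}. of_bool (cr j (cell_index P j (\<xi> k))) :: real)" by (simp add: sum_nonneg)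
    show ?thesis
    proof (cases "\<exists>j\<in>{L<..l}. cr j (cell_index P j (\<xi> k))")
      case True
      then obtain j where j: "j \<in> {L<..l}" "cr j (cell_index P j (\<xi> k))" by blast
      then have "1 \<le> (\<Sum>j\<in>{L<..l}. of_bool (cr j (cell_index P j (\<xi> k))) :: real)"
        using member_le_sum [of j "{L<..l}" "\<lambda>j. of_bool (cr j (cell_index P j (\<xi> k))) :: real"] by simp
      then show ?thesis by (simp add: indicator_def)
    next
      case False
      then have "k \<in> Gd \<or> \<xi> k \<notin> F \<or> light P s' l (cell_index P l (\<xi> k)) \<or> thin P \<epsilon> F l (cell_index P l (\<xi> k))"
        using k unfolding Gd_def good_def cr_def \<xi>_def by force
      then show ?thesis using s0 by (auto simp: indicator_def)
    qed
  qed
  have "cnt n F x \<le> (\<Sum>k\<in>{n..<2 * n}. (indicator Gd k :: real) + of_bool (light P s' l (cell_index P l (\<xi> k)))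
      + of_bool (thin P \<epsilon> F l (cell_index P l (\<xi> k))) * indicator F (\<xi> k)
      + (\<Sum>j\<in>{L<..l}. of_bool (cr j (cell_index P j (\<xi> k)))))"
    unfolding cnt_def \<xi>_def [symmetric] by (rule sum_mono) (rule pt)
  also have "\<dots> = (\<Sum>k\<in>{n..<2 * n}. (indicator Gd k :: real))
      + (\<Sum>k\<in>{n..<2 * n}. of_bool (light P s' l (cell_index P l (\<xi> k))))
      + (\<Sum>k\<in>{n..<2 * n}. of_bool (thin P \<epsilon> F l (cell_index P l (\<xi> k))) * indicator F (\<xi> k))
      + (\<Sum>j\<in>{L<..l}. \<Sum>k\<in>{n..<2 * n}. of_bool (cr j (cell_index P j (\<xi> k))))"
    unfolding sum.distrib by (subst sum.swap [of _ "{L<..l}"]) simp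
  also have "(\<Sum>k\<in>{n..<2 * n}. (indicator Gd k :: real)) = real (card Gd)"
    by (subst sum.mono_neutral_right [of _ Gd]) (auto simp: Gd_def good_def)
  also have "(\<Sum>j\<in>{L<..l}. \<Sum>k\<in>{n..<2 * n}. of_bool (cr j (cell_index P j (\<xi> k))) :: real)
    \<le> (\<Sum>j\<in>{L<..l}. \<Sum>q\<in>{cell_index P j a..cell_index P j b}.
        (cnt n (dcell P (int j) q) x)\<^sup>2 / crowd P \<epsilon> n j q)"
  proof (rule sum_mono)
    fix j :: nat
    have img: "(\<lambda>k. cell_index P j (\<xi> k)) ` {n..<2 * n} \<subseteq> {cell_index P j a..cell_index P j b}"
      using iter_in [OF x] unfolding \<xi>_def by (force intro: cell_index_mono)
    have "(\<Sum>k\<in>{n..<2 * n}. of_bool (cr j (cell_index P j (\<xi> k))) :: real)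
      = (\<Sum>q\<in>{cell_index P j a..cell_index P j b}.
          \<Sum>k\<in>{k\<in>{n..<2 * n}. cell_index P j (\<xi> k) = q}. of_bool (cr j (cell_index P j (\<xi> k))))"
      by (rule sum.group [symmetric]) (use img in auto)
    also have "\<dots> = (\<Sum>q\<in>{cell_index P j a..cell_index P j b}. cnt n (dcell P j q) x * of_bool (cr j q))"
      by (intro sum.cong refl) (simp add: cnt_card mem_dcell \<xi>_def)
    also have "\<dots> \<le> (\<Sum>q\<in>{cell_index P j a..cell_index P j b}.
        (cnt n (dcell P (int j) q) x)\<^sup>2 / crowd P \<epsilon> n j q)"
    proof (rule sum_mono)
      fix q
      define c where "c = cnt n (dcell P (int j) q) x"
      have c: "0 \<le> c" unfolding c_def by (rule cnt_bound)
      have d: "0 < crowd P \<epsilon> n j q" by (rule crowd_pos)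
      have "c * of_bool (cr j q) \<le> c\<^sup>2 / crowd P \<epsilon> n j q"
      proof (cases "cr j q")
        case True
        then have "crowd P \<epsilon> n j q \<le> c" by (simp add: cr_def c_def)
        then have "c * crowd P \<epsilon> n j q \<le> c * c" using c by (rule mult_left_mono)
        then show ?thesis using True d by (simp add: field_simps power2_eq_square)
      next
        case False then show ?thesis using d by simp
      qed
      then show "cnt n (dcell P j q) x * of_bool (cr j q) \<le> (cnt n (dcell P (int j) q) x)\<^sup>2 / crowd P \<epsilon> n j q"
        by (simp add: c_def)
    qed
    finally show "(\<Sum>k\<in>{n..<2 * n}. of_bool (cr j (cell_index P j (\<xi> k))) :: real)
      \<le> (\<Sum>q\<in>{cell_index P j a..cell_index P j b}.
        (cnt n (dcell P (int j) q) x)\<^sup>2 / crowd P \<epsilon> n j q)" .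
  qed
  finally show ?thesis unfolding bad_bound_def \<xi>_def Gd_def by simp
qed

lemma sum_measure_dcell_le: "finite A \<Longrightarrow> (\<Sum>q\<in>A. measure M (dcell P j q)) \<le> 1"
proof -
  assume A: "finite A"
  have "disjoint_family_on (dcell P j) A"
    by (auto simp: disjoint_family_on_def mem_dcell)
  then have "(\<Sum>q\<in>A. measure M (dcell P j q)) = measure M (\<Union>q\<in>A. dcell P j q)"
    using A by (subst M.finite_measure_finite_Union) auto
  then show ?thesis using measure_M_le_1 by simp
qed

definition light_mass :: "real \<Rightarrow> real \<Rightarrow> nat \<Rightarrow> real" where
  "light_mass P s' l = (\<Sum>k\<in>{cell_index P l a..cell_index P l b}.
    if measure M (dcell P l k) < 2 powr (- (real l * s')) then measure M (dcell P l k) else 0)"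

text \<open>By invariance, the expected numbers of visits to light cells, and to \<open>F\<close> in
  thin cells, are \<open>n\<close> times the measures of these sets. For overcrowded cells, second
  moment over threshold is proportional to the measure of the cell, so a level contributes a
  multiple of \<open>n * 2 powr (- \<epsilon> * real j)\<close>, and the levels form a geometric
  series.\<close>

lemma expected_bad_bound:
  assumes F: "F \<in> sets borel" and \<epsilon>: "0 < \<epsilon>"
  shows "integrable \<mu> (bad_bound P s' \<epsilon> F L l n)"
    and "(\<integral>x. bad_bound P s' \<epsilon> F L l n x \<partial>\<mu>) \<le> real n * (light_mass P s' l + 2 powr (- \<epsilon> * real l)
      + (1 + 6 * suminf p) * (2 powr (- \<epsilon> * real L) / (1 - 2 powr - \<epsilon>)))"
proof -
  define f1 :: "real \<Rightarrow> real" where "f1 y = of_bool (light P s' l (cell_index P l y))" for y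
  define f2 :: "real \<Rightarrow> real" where "f2 y = of_bool (thin P \<epsilon> F l (cell_index P l y)) * indicator F y" for y
  have f1m: "f1 \<in> borel_measurable borel" unfolding f1_def [abs_def] by measurable
  have f2m: "f2 \<in> borel_measurable borel" unfolding f2_def [abs_def] using F by measurable
  have f1b: "\<bar>f1 y\<bar> \<le> 1" and f2b: "\<bar>f2 y\<bar> \<le> 1" for y by (auto simp: f1_def f2_def indicator_def)
  define K where "K j = {cell_index P j a..cell_index P j b}" for j :: int
  have "(\<integral>y. f1 y * 1 \<partial>M) = (\<Sum>k\<in>K l. of_bool (light P s' l k) * (\<integral>y. indicator (dcell P l k) y * 1 \<partial>M))"
    unfolding K_def by (rule M.integral_step_mult [where W = 1]) (auto simp: f1_def fun_eq_iff)
  also have "\<dots> = light_mass P s' l"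
    unfolding light_mass_def K_def by (intro sum.cong refl) (simp add: light_def)
  finally have f1i: "(\<integral>y. f1 y \<partial>M) = light_mass P s' l" by simp
  have "(\<integral>y. f2 y \<partial>M) = (\<Sum>k\<in>K l. of_bool (thin P \<epsilon> F l k) * (\<integral>y. indicator (dcell P l k) y * indicator F y \<partial>M))"
    unfolding K_def f2_def by (rule M.integral_step_mult [where W = 1]) (use F in \<open>auto simp: indicator_def fun_eq_iff\<close>)
  also have "\<dots> = (\<Sum>k\<in>K l. of_bool (thin P \<epsilon> F l k) * measure M (F \<inter> dcell P l k))"
    by (simp add: Int_commute flip: indicator_inter_arith)
  also have "\<dots> \<le> (\<Sum>k\<in>K l. 2 powr (- \<epsilon> * real l) * measure M (dcell P l k))"
    by (intro sum_mono) (auto simp: thin_def)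
  also have "\<dots> = 2 powr (- \<epsilon> * real l) * (\<Sum>k\<in>K l. measure M (dcell P l k))"
    by (simp add: sum_distrib_left)
  also have "\<dots> \<le> 2 powr (- \<epsilon> * real l) * 1"
    by (intro mult_left_mono sum_measure_dcell_le) (auto simp: K_def)
  finally have f2i: "(\<integral>y. f2 y \<partial>M) \<le> 2 powr (- \<epsilon> * real l)" by simp
  have c2m: "integrable \<mu> (\<lambda>x. (cnt n (dcell P (int j) q) x)\<^sup>2)" for j q
  proof (rule integrable_bounded_mu [where W = "(real n)\<^sup>2"])
    show "\<bar>(cnt n (dcell P (int j) q) y)\<^sup>2\<bar> \<le> (real n)\<^sup>2" for y
      using cnt_bound by (auto intro: power_mono)
    show "(\<lambda>x. (cnt n (dcell P (int j) q) x)\<^sup>2) \<in> borel_measurable \<mu>" by measurable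
  qed
  define S where "S = suminf p"
  have S0: "0 \<le> S" unfolding S_def using p_summable p_nonneg by (rule suminf_nonneg)
  have cr: "(\<Sum>q\<in>K j. (\<integral>x. (cnt n (dcell P (int j) q) x)\<^sup>2 \<partial>\<mu>) / crowd P \<epsilon> n j q)
      \<le> real n * (1 + 6 * S) * 2 powr (- \<epsilon> * real j)" for j :: nat
  proof -
    have "(\<Sum>q\<in>K j. (\<integral>x. (cnt n (dcell P (int j) q) x)\<^sup>2 \<partial>\<mu>) / crowd P \<epsilon> n j q)
      \<le> (\<Sum>q\<in>K j. real n * (1 + 6 * S) * 2 powr (- \<epsilon> * real j) * measure M (dcell P j q))"
    proof (rule sum_mono)
      fix q
      define m where "m = real n * measure M (dcell P j q)"
      have m0: "0 \<le> m" by (simp add: m_def)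
      have "(\<integral>x. (cnt n (dcell P (int j) q) x)\<^sup>2 \<partial>\<mu>) \<le> m\<^sup>2 + 6 * S * m"
        unfolding m_def S_def by (rule cnt_second_moment)
      \<comment> \<open>Written with the factor 1 + m in order to cancel it against the threshold
        \<open>crowd\<close>.\<close>
      also have "\<dots> \<le> (1 + 6 * S) * m * (1 + m)"
        using m0 S0 mult_nonneg_nonneg [of S "m * m"] by (simp add: power2_eq_square algebra_simps)
      finally have "(\<integral>x. (cnt n (dcell P (int j) q) x)\<^sup>2 \<partial>\<mu>) / crowd P \<epsilon> n j q
        \<le> ((1 + 6 * S) * m * (1 + m)) / crowd P \<epsilon> n j q"
        by (intro divide_right_mono less_imp_le [OF crowd_pos])
      also have "\<dots> = (1 + 6 * S) * m * 2 powr (- \<epsilon> * real j)"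
      proof -
        have "1 + m \<noteq> 0" using m0 by linarith
        then show ?thesis by (simp add: crowd_def m_def [symmetric] powr_minus divide_inverse)
      qed
      finally show "(\<integral>x. (cnt n (dcell P (int j) q) x)\<^sup>2 \<partial>\<mu>) / crowd P \<epsilon> n j q
        \<le> real n * (1 + 6 * S) * 2 powr (- \<epsilon> * real j) * measure M (dcell P j q)"
        by (simp add: m_def mult_ac)
    qed
    also have "\<dots> = real n * (1 + 6 * S) * 2 powr (- \<epsilon> * real j) * (\<Sum>q\<in>K j. measure M (dcell P j q))"
      by (simp add: sum_distrib_left)
    also have "\<dots> \<le> real n * (1 + 6 * S) * 2 powr (- \<epsilon> * real j) * 1"
      using S0 by (intro mult_left_mono sum_measure_dcell_le) (auto simp: K_def)
    finally show ?thesis by simp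
  qed
  have eq: "bad_bound P s' \<epsilon> F L l n = (\<lambda>x. (\<Sum>k\<in>{n..<2 * n}. f1 ((T ^^ k) x)) + (\<Sum>k\<in>{n..<2 * n}. f2 ((T ^^ k) x))
    + (\<Sum>j\<in>{L<..l}. \<Sum>q\<in>K j. (cnt n (dcell P (int j) q) x)\<^sup>2 / crowd P \<epsilon> n j q))"
    by (simp add: bad_bound_def f1_def f2_def K_def fun_eq_iff)
  note i1 = integral_sum_iter [OF f1m f1b, of n] and i2 = integral_sum_iter [OF f2m f2b, of n]
  show "integrable \<mu> (bad_bound P s' \<epsilon> F L l n)"
    unfolding eq using i1(2) i2(2) c2m by simp
  have "(\<integral>x. bad_bound P s' \<epsilon> F L l n x \<partial>\<mu>) = real n * (\<integral>y. f1 y \<partial>M) + real n * (\<integral>y. f2 y \<partial>M)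
    + (\<Sum>j\<in>{L<..l}. \<Sum>q\<in>K j. (\<integral>x. (cnt n (dcell P (int j) q) x)\<^sup>2 \<partial>\<mu>) / crowd P \<epsilon> n j q)"
    unfolding eq using i1 i2 c2m by (simp add: Bochner_Integration.integral_sum)
  also have "\<dots> \<le> real n * light_mass P s' l + real n * 2 powr (- \<epsilon> * real l)
    + (\<Sum>j\<in>{L<..l}. real n * (1 + 6 * S) * 2 powr (- \<epsilon> * real j))"
    using f2i unfolding f1i by (intro add_mono mult_left_mono sum_mono cr) auto
  also have "(\<Sum>j\<in>{L<..l}. real n * (1 + 6 * S) * 2 powr (- \<epsilon> * real j))
    = real n * (1 + 6 * S) * (\<Sum>j\<in>{L<..l}. 2 powr (- \<epsilon> * real j))"
    by (simp add: sum_distrib_left)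
  also have "\<dots> \<le> real n * (1 + 6 * S) * (2 powr (- \<epsilon> * real L) / (1 - 2 powr - \<epsilon>))"
    using S0 by (intro mult_left_mono geometric_tail_le \<epsilon>) auto
  finally show "(\<integral>x. bad_bound P s' \<epsilon> F L l n x \<partial>\<mu>) \<le> real n * (light_mass P s' l + 2 powr (- \<epsilon> * real l)
      + (1 + 6 * suminf p) * (2 powr (- \<epsilon> * real L) / (1 - 2 powr - \<epsilon>)))"
    unfolding S_def [symmetric] by (simp add: algebra_simps)
qed

end

section \<open>Redistribution along typical orbits\<close>

lemma (in bounded_line_measure) measure_dcell_0:
  assumes "q \<notin> {cell_index P l a..cell_index P l b}"
  shows "measure N (dcell P l q) = 0"
proof -
  have "AE y in N. y \<notin> dcell P l q"
    using AE_bounded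
  proof eventually_elim
    case (elim y)
    then show ?case
      using assms cell_index_mono [of a y P l] cell_index_mono [of y b P l] by (auto simp: mem_dcell)
  qed
  then have "measure N (dcell P l q) = measure N {}"
    by (intro measure_eq_AE) auto
  then show ?thesis by simp
qed

lemma (in prob_space) markov_le:
  assumes "integrable M f" "\<And>x. 0 \<le> f x" "0 < c" "(\<integral>x. f x \<partial>M) \<le> c * t"
  shows "prob {x \<in> space M. c \<le> f x} \<le> (t :: real)"
proof -
  have "prob {x \<in> space M. c \<le> f x} \<le> (\<integral>x. f x \<partial>M) / c"
    by (rule integral_Markov_inequality_measure [where A = "space M"]) (use assms in auto)
  also have "\<dots> \<le> t" using assms by (simp add: divide_le_eq mult.commute)
  finally show ?thesis .
qed

text \<open>No measurability of \<open>Q\<close> is assumed: the intersection of the measurable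
  exceptional sets is null and contains all failures.\<close>

lemma (in prob_space) AE_of_small_exceptions:
  assumes "\<And>\<kappa>. 0 < \<kappa> \<Longrightarrow> \<exists>B\<in>events. prob B \<le> \<kappa> \<and> (\<forall>x\<in>space M - B. Q x)"
  shows "AE x in M. Q x"
proof -
  have "\<forall>i::nat. \<exists>B. B \<in> events \<and> prob B \<le> (1/2)^i \<and> (\<forall>x\<in>space M - B. Q x)"
    using assms [of "(1/2)^i" for i] by (auto simp: Bex_def)
  from choice [OF this] obtain B where B: "\<And>i. B i \<in> events" "\<And>i. prob (B i) \<le> (1/2)^i"
    "\<And>i x. x \<in> space M - B i \<Longrightarrow> Q x" by blast
  define Z where "Z = (\<Inter>i. B i)"
  have Z: "Z \<in> events" unfolding Z_def using B(1) by auto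
  have "prob Z \<le> (1/2)^i" for i
    using finite_measure_mono [of Z "B i"] B(1,2) [of i] by (force simp: Z_def intro: order_trans)
  then have "prob Z \<le> 0"
    by (intro LIMSEQ_le_const [OF LIMSEQ_power_zero [of "1/2 :: real"]]) auto
  then have "prob Z = 0" by (simp add: measure_le_0_iff)
  then have "Z \<in> null_sets M" using Z by (simp add: emeasure_eq_measure null_setsI)
  then show ?thesis
    by (rule AE_I') (use B(3) in \<open>auto simp: Z_def\<close>)
qed

text \<open>Allows \<open>fills\<close> to be read off from countably many levels and
  tolerances.\<close>

lemma fills_at_mono:
  assumes "fills_at P N \<tau> U G \<delta>" "G' \<le> G" "\<delta> \<le> \<delta>'" "\<And>Q. 0 \<le> \<tau> Q"
  shows "fills_at P N \<tau> U G' \<delta>'"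
proof -
  obtain L g K n W where H: "G \<le> L" "compact K" "K \<subseteq> U" "step_fun P n g"
    "\<And>y. 0 \<le> g y \<and> g y \<le> W" "\<And>y. y \<notin> K \<Longrightarrow> g y = 0"
    "\<And>Q. Q \<in> dyadic_level P L \<Longrightarrow> (\<integral>y. indicator Q y * g y \<partial>N) \<le> (1 + \<delta>) * measure N Q"
    "measure N UNIV - \<delta> \<le> (\<integral>y. g y \<partial>N)"
    "\<And>l Q. L < l \<Longrightarrow> Q \<in> dyadic_level P l \<Longrightarrow> (\<integral>y. indicator Q y * g y \<partial>N) \<le> \<delta> * \<tau> Q"
    using assms(1) unfolding fills_at_def by blast
  have "(\<integral>y. indicator Q y * g y \<partial>N) \<le> (1 + \<delta>') * measure N Q" if "Q \<in> dyadic_level P L" for Q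
  proof -
    have "(1 + \<delta>) * measure N Q \<le> (1 + \<delta>') * measure N Q"
      using assms(3) by (intro mult_right_mono) auto
    then show ?thesis using H(7) [OF that] by linarith
  qed
  moreover have "(\<integral>y. indicator Q y * g y \<partial>N) \<le> \<delta>' * \<tau> Q" if "L < l" "Q \<in> dyadic_level P l" for l Q
    using H(9) [OF that] mult_right_mono [OF assms(3) assms(4) [of Q]] by linarith
  moreover have "G' \<le> L" "measure N UNIV - \<delta>' \<le> (\<integral>y. g y \<partial>N)" using H(1,8) assms(2,3) by linarith+
  ultimately show ?thesis
    unfolding fills_at_def using H(2-6)
    by (intro exI [of _ L] exI [of _ g] exI [of _ K] exI [of _ n] exI [of _ W] conjI) auto
qed

context mixing_system
begin

definition tail_balls :: "real \<Rightarrow> real \<Rightarrow> nat \<Rightarrow> real set" where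
  "tail_balls \<alpha> x m = (\<Union>k\<in>{m..}. ball ((T ^^ k) x) (real k powr (- \<alpha>)))"

text \<open>The order of choices matters: \<epsilon> depends on the exponents only, then
  \<open>L\<close> is fixed, and only then is \<open>l\<close> taken large, since the law of large
  numbers is needed for the finitely many cells of level \<open>L\<close> and its rate is not
  controlled.\<close>

lemma fills_event:
  assumes F: "F \<in> sets borel" and \<alpha>: "0 < \<alpha>"
    and s: "spectrum_exponent M < ereal s''" "s'' < s'" "s' * \<eta> < 1 / \<alpha>" and \<eta>: "0 < \<eta>" "\<eta> < 1"
    and t1: "0 < t1" "0 < c1"
    and frostman: "\<And>j k. measure M (dcell P (int j) k) \<le> c1 * 2 powr (- t1 * real j)"
    and \<delta>: "0 < \<delta>" and \<kappa>: "0 < \<kappa>"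
  shows "\<exists>B\<in>events. prob B \<le> \<kappa> \<and> (\<forall>x\<in>space \<mu> - B.
    fills_at P (M.restr F) (\<lambda>Q. measure M Q powr \<eta>) (tail_balls \<alpha> x m) G \<delta>)"
proof -
  define \<beta> where "\<beta> = 1 / \<alpha>"
  define \<epsilon> where "\<epsilon> = min (t1 * (1 - \<eta>)) (\<beta> - s' * \<eta>) / 3"
  have "0 < t1 * (1 - \<eta>)" "0 < \<beta> - s' * \<eta>" using t1 \<eta> s by (auto simp: \<beta>_def)
  then have \<epsilon>: "0 < \<epsilon>" "3 * \<epsilon> \<le> t1 * (1 - \<eta>)" "3 * \<epsilon> \<le> \<beta> - s' * \<eta>"
    by (auto simp: \<epsilon>_def)
  have \<beta>: "0 < \<beta>" using \<alpha> by (simp add: \<beta>_def)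
  have decay0: "(\<lambda>j. c * 2 powr (- \<epsilon> * real j)) \<longlonglongrightarrow> 0" for c :: real
  proof -
    have "(\<lambda>j. (2 powr - \<epsilon>) ^ j) \<longlonglongrightarrow> 0"
      using \<epsilon>(1) by (intro LIMSEQ_power_zero) (auto simp: powr_minus_divide)
    moreover have "(2 powr - \<epsilon>) ^ j = 2 powr (- \<epsilon> * real j)" for j
      by (simp add: powr_powr flip: powr_realpow)
    ultimately have "(\<lambda>j. 2 powr (- \<epsilon> * real j)) \<longlonglongrightarrow> 0" by simp
    then show ?thesis by (rule tendsto_mult_right_zero)
  qed
  have le_ev: "\<forall>\<^sub>F j in sequentially. c * 2 powr (- \<epsilon> * real j) \<le> d" if "0 < d" for c d :: real
    using order_tendstoD(2) [OF decay0 [of c] that] by eventually_elim simp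
  define D where "D = (1 + 6 * suminf p) / (1 - 2 powr - \<epsilon>)"
  have \<kappa>\<delta>: "0 < \<kappa> * \<delta> / 12" using \<kappa> \<delta> by simp
  \<comment> \<open>The three demands on \<open>L\<close>: small masses on finer cells, few visits
    to overcrowded cells beyond \<open>L\<close>, and the prescribed depth \<open>G\<close>.\<close>
  have "\<forall>\<^sub>F L in sequentially. c1 powr (1 - \<eta>) * 2 powr (- \<epsilon> * real L) \<le> \<delta> / 2
    \<and> D * 2 powr (- \<epsilon> * real L) \<le> \<kappa> * \<delta> / 12 \<and> nat G \<le> L"
    using \<kappa>\<delta> \<delta> by (intro eventually_conj eventually_ge_at_top le_ev) auto
  then obtain L where L: "c1 powr (1 - \<eta>) * 2 powr (- \<epsilon> * real L) \<le> \<delta> / 2"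
    "D * 2 powr (- \<epsilon> * real L) \<le> \<kappa> * \<delta> / 12" "nat G \<le> L"
    using eventually_happens' [OF sequentially_bot] by blast
  \<comment> \<open>The window for level \<open>l\<close>. The floor gives 2 * n at most
    \<open>2 powr (real l * \<beta>)\<close>, so that cells of level \<open>l\<close> fit into the
    balls; conversely this power is at most 4 * n once it is at least 4.\<close>
  define N where "N l = nat \<lfloor>2 powr (real l * \<beta>) / 2\<rfloor>" for l :: nat
  define R where "R q = measure M (F \<inter> dcell P L q)" for q
  \<comment> \<open>Cells of level \<open>L\<close> that \<open>F\<close> does not charge admit no
    relative error; they are treated separately as null sets.\<close>
  define Qs where "Qs = {q\<in>{cell_index P L a..cell_index P L b}. 0 < R q}"
  have finQs: "finite Qs" unfolding Qs_def by (intro finite_Collect_conjI disjI1) simp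
  \<comment> \<open>Tuned so that Markov's inequality at height
    \<open>real n * \<delta> * R q\<close> leaves probability \<kappa> / 3 for all cells in
    \<open>Qs\<close> together.\<close>
  define e where "e q = \<kappa> * \<delta> * R q / (3 * (real (card Qs) + 1))" for q
  have e: "0 < e q" if "q \<in> Qs" for q using that \<kappa> \<delta> by (simp add: Qs_def e_def)
  have pow_top: "filterlim (\<lambda>l. 2 powr (real l * \<beta>)) at_top sequentially"
  proof -
    have "(2 powr \<beta>) ^ l = 2 powr (real l * \<beta>)" for l
      by (simp add: powr_powr mult.commute flip: powr_realpow)
    moreover have "filterlim (\<lambda>l. (2 powr \<beta>) ^ l) at_top sequentially"
      using \<beta> by (intro filterlim_at_infinity_imp_filterlim_at_top filterlim_realpow_sequentially_gt1) auto
    ultimately show ?thesis by simp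
  qed
  have big: "\<forall>\<^sub>F l in sequentially. C \<le> 2 powr (real l * \<beta>)" for C :: real
    using pow_top by (simp add: filterlim_at_top)
  have N_props: "real (N l) \<le> 2 powr (real l * \<beta>) / 2" "2 powr (real l * \<beta>) / 2 - 1 < real (N l)" for l
  proof -
    have "real (N l) = real_of_int \<lfloor>2 powr (real l * \<beta>) / 2\<rfloor>" unfolding N_def by simp
    then show "real (N l) \<le> 2 powr (real l * \<beta>) / 2" "2 powr (real l * \<beta>) / 2 - 1 < real (N l)"
      by linarith+
  qed
  have N_top: "filterlim N at_top sequentially"
    unfolding filterlim_at_top
  proof
    fix Z :: nat
    show "\<forall>\<^sub>F l in sequentially. Z \<le> N l"
      using big [of "2 * (real Z + 1)"]
    proof eventually_elim
      case (elim l)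
      then have "real Z \<le> real (N l)" using N_props(2) [of l] by argo
      then show ?case by simp
    qed
  qed
  have lm: "\<forall>\<^sub>F l in sequentially. light_mass P s' l + 2 powr (- \<epsilon> * real l) \<le> \<kappa> * \<delta> / 12"
  proof -
    have "(\<lambda>l. light_mass P s' l + 1 * 2 powr (- \<epsilon> * real l)) \<longlonglongrightarrow> 0 + 0"
      unfolding light_mass_def
      using M.light_cells_mass_tendsto_0 [OF s(1,2), of P] ab by (intro tendsto_add decay0) auto
    then have "\<forall>\<^sub>F l in sequentially. light_mass P s' l + 1 * 2 powr (- \<epsilon> * real l) < \<kappa> * \<delta> / 12"
      using \<kappa>\<delta> by (intro order_tendstoD) auto
    then show ?thesis by eventually_elim simp
  qed
  have lln0: "\<forall>\<^sub>F l in sequentially. (\<integral>x. \<bar>cnt (N l) F x - real (N l) * measure M F\<bar> \<partial>\<mu>)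
    \<le> (\<kappa> * \<delta> / 6) * real (N l)"
    using \<kappa> \<delta> by (intro eventually_compose_filterlim [OF law_of_large_numbers N_top] F) auto
  have lln1: "\<forall>\<^sub>F l in sequentially. \<forall>q\<in>Qs.
    (\<integral>x. \<bar>cnt (N l) (F \<inter> dcell P L q) x - real (N l) * R q\<bar> \<partial>\<mu>) \<le> e q * real (N l)"
    unfolding R_def using F e finQs
    by (intro eventually_ball_finite ballI eventually_compose_filterlim [OF law_of_large_numbers N_top]) auto
  have "\<forall>\<^sub>F l in sequentially. L < l \<and> 4 * 2 powr (- \<epsilon> * real l) \<le> \<delta> / 2
    \<and> light_mass P s' l + 2 powr (- \<epsilon> * real l) \<le> \<kappa> * \<delta> / 12 \<and> max 1 m \<le> N l
    \<and> 4 \<le> 2 powr (real l * \<beta>)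
    \<and> (\<integral>x. \<bar>cnt (N l) F x - real (N l) * measure M F\<bar> \<partial>\<mu>) \<le> (\<kappa> * \<delta> / 6) * real (N l)
    \<and> (\<forall>q\<in>Qs. (\<integral>x. \<bar>cnt (N l) (F \<inter> dcell P L q) x - real (N l) * R q\<bar> \<partial>\<mu>) \<le> e q * real (N l))"
    by (intro eventually_conj eventually_gt_at_top le_ev big lm lln0 lln1
        N_top [unfolded filterlim_at_top, rule_format]) (use \<delta> in simp)
  then obtain l where l: "L < l" "4 * 2 powr (- \<epsilon> * real l) \<le> \<delta> / 2"
    "light_mass P s' l + 2 powr (- \<epsilon> * real l) \<le> \<kappa> * \<delta> / 12" "max 1 m \<le> N l" "4 \<le> 2 powr (real l * \<beta>)"
    "(\<integral>x. \<bar>cnt (N l) F x - real (N l) * measure M F\<bar> \<partial>\<mu>) \<le> (\<kappa> * \<delta> / 6) * real (N l)"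
    "\<And>q. q \<in> Qs \<Longrightarrow> (\<integral>x. \<bar>cnt (N l) (F \<inter> dcell P L q) x - real (N l) * R q\<bar> \<partial>\<mu>) \<le> e q * real (N l)"
    using eventually_happens' [OF sequentially_bot] by blast
  define n where "n = N l"
  have n1: "1 \<le> n" "m \<le> n" using l(4) by (auto simp: n_def)
  have n0: "0 < real n" using n1 by simp
  have n4: "2 powr (real l * \<beta>) \<le> 4 * real n" using N_props(2) [of l] l(5) unfolding n_def by argo
  have n2: "2 * real n \<le> 2 powr (real l * \<beta>)" using N_props(1) [of l] unfolding n_def by argo
  have int_cnt: "integrable \<mu> (\<lambda>x. \<bar>cnt n S x - c\<bar>)" if "S \<in> sets borel" for S c
  proof -
    have "integrable \<mu> (cnt n S)"
      using that cnt_bound by (intro integrable_bounded_mu [where W = "real n"]) auto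
    then show ?thesis by simp
  qed
  define B1 where "B1 q = {x\<in>space \<mu>. real n * \<delta> * R q \<le> \<bar>cnt n (F \<inter> dcell P L q) x - real n * R q\<bar>}" for q
  define B2 where "B2 = {x\<in>space \<mu>. real n * (\<delta> / 2) \<le> \<bar>cnt n F x - real n * measure M F\<bar>}"
  define B3 where "B3 = {x\<in>space \<mu>. real n * (\<delta> / 2) \<le> bad_bound P s' \<epsilon> F L l n x}"
  note bb = expected_bad_bound [OF F \<epsilon>(1), of P s' L l n]
  have B1: "B1 q \<in> events" for q unfolding B1_def using F by measurable
  have B2: "B2 \<in> events" unfolding B2_def using F by measurable
  have "bad_bound P s' \<epsilon> F L l n \<in> borel_measurable \<mu>" using bb(1) by auto
  then have B3: "B3 \<in> events" unfolding B3_def by measurable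
  have mB1: "prob (B1 q) \<le> \<kappa> / (3 * (real (card Qs) + 1))" if q: "q \<in> Qs" for q
    unfolding B1_def
  proof (rule markov_le)
    show "0 < real n * \<delta> * R q" using n0 \<delta> q by (simp add: Qs_def)
    show "(\<integral>x. \<bar>cnt n (F \<inter> dcell P L q) x - real n * R q\<bar> \<partial>\<mu>)
      \<le> real n * \<delta> * R q * (\<kappa> / (3 * (real (card Qs) + 1)))"
      using l(7) [OF q] by (simp add: n_def e_def mult_ac)
  qed (use F int_cnt in auto)
  have mB2: "prob B2 \<le> \<kappa> / 3"
    unfolding B2_def
  proof (rule markov_le)
    show "0 < real n * (\<delta> / 2)" using n0 \<delta> by simp
    show "(\<integral>x. \<bar>cnt n F x - real n * measure M F\<bar> \<partial>\<mu>) \<le> real n * (\<delta> / 2) * (\<kappa> / 3)"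
      using l(6) by (simp add: n_def mult_ac)
  qed (use F int_cnt in auto)
  have bb0: "0 \<le> bad_bound P s' \<epsilon> F L l n x" for x
    unfolding bad_bound_def using crowd_pos less_imp_le
    by (intro add_nonneg_nonneg sum_nonneg divide_nonneg_nonneg) (auto simp: less_imp_le)
  have mB3: "prob B3 \<le> \<kappa> / 3"
    unfolding B3_def
  proof (rule markov_le [OF bb(1) bb0])
    show "0 < real n * (\<delta> / 2)" using n0 \<delta> by simp
    have "(\<integral>x. bad_bound P s' \<epsilon> F L l n x \<partial>\<mu>) \<le> real n * (light_mass P s' l + 2 powr (- \<epsilon> * real l)
      + D * 2 powr (- \<epsilon> * real L))"
      using bb(2) by (simp add: D_def)
    also have "\<dots> \<le> real n * (\<kappa> * \<delta> / 12 + \<kappa> * \<delta> / 12)"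
      using l(3) L(2) by (intro mult_left_mono add_mono) auto
    finally show "(\<integral>x. bad_bound P s' \<epsilon> F L l n x \<partial>\<mu>) \<le> real n * (\<delta> / 2) * (\<kappa> / 3)"
      by (simp add: field_simps)
  qed
  define B where "B = (\<Union>q\<in>Qs. B1 q) \<union> B2 \<union> B3"
  have Bev: "B \<in> events" unfolding B_def using B1 B2 B3 finQs by (intro sets.Un sets.finite_UN) auto
  have "prob B \<le> prob (\<Union>q\<in>Qs. B1 q) + prob B2 + prob B3"
    unfolding B_def using B1 B2 B3 finQs
    by (intro order_trans [OF measure_Un_le] add_mono measure_Un_le sets.Un sets.finite_UN) auto
  also have "prob (\<Union>q\<in>Qs. B1 q) \<le> (\<Sum>q\<in>Qs. prob (B1 q))"
    using B1 finQs by (intro measure_UNION_le) auto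
  also have "\<dots> \<le> real (card Qs) * (\<kappa> / (3 * (real (card Qs) + 1)))"
    using mB1 by (intro sum_bounded_above) auto
  also have "\<dots> \<le> \<kappa> / 3" using \<kappa> by (simp add: field_simps)
  finally have PB: "prob B \<le> \<kappa>" using mB2 mB3 by linarith
  have "fills_at P (M.restr F) (\<lambda>Q. measure M Q powr \<eta>) (tail_balls \<alpha> x m) G \<delta>"
    if x: "x \<in> space \<mu> - B" for x
  proof -
    have xab: "x \<in> {a..b}" using x by (simp add: space_mu)
    have g1: "\<bar>cnt n (F \<inter> dcell P L q) x - real n * R q\<bar> < real n * \<delta> * R q" if "q \<in> Qs" for q
      using x that by (force simp: B_def B1_def)
    have g2: "\<bar>cnt n F x - real n * measure M F\<bar> < real n * (\<delta> / 2)"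
      using x by (force simp: B_def B2_def)
    have g3: "bad_bound P s' \<epsilon> F L l n x < real n * (\<delta> / 2)"
      using x by (force simp: B_def B3_def)
    define \<xi> where "\<xi> k = (T ^^ k) x" for k
    define Gd where "Gd = good P s' \<epsilon> F L l n x"
    have Gd: "Gd \<subseteq> {n..<2 * n}" "\<And>k. k \<in> Gd \<Longrightarrow> \<xi> k \<in> F" by (auto simp: Gd_def good_def \<xi>_def)
    have \<xi>ab: "\<xi> k \<in> {a..b}" for k using iter_in [OF xab] by (simp add: \<xi>_def)
    have heavy: "2 powr (- (real l * s')) \<le> measure M (dcell P l (cell_index P l (\<xi> i)))" if "i \<in> Gd" for i
      using that by (simp add: Gd_def good_def \<xi>_def light_def not_less)
    have thick: "2 powr (- \<epsilon> * real l) * measure M (dcell P l (cell_index P l (\<xi> i)))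
      \<le> measure M (F \<inter> dcell P l (cell_index P l (\<xi> i)))" if "i \<in> Gd" for i
      using that by (simp add: Gd_def good_def \<xi>_def thin_def not_less)
    have sparse: "real (card {i'\<in>{n..<2 * n}. \<xi> i' \<in> dcell P (int j) (cell_index P (int j) (\<xi> i))})
        \<le> 2 powr (\<epsilon> * real j) * (1 + real n * measure M (dcell P (int j) (cell_index P (int j) (\<xi> i))))"
      if "i \<in> Gd" "L < j" "j \<le> l" for i j
      using that by (simp add: Gd_def good_def \<xi>_def cnt_card crowd_def)
    obtain g and W :: real where g: "step_fun P l g" "\<And>y. 0 \<le> g y \<and> g y \<le> W"
      "\<And>y. g y \<noteq> 0 \<Longrightarrow> \<exists>i\<in>Gd. cell_index P l (\<xi> i) = cell_index P l y"
      "(\<integral>y. g y \<partial>M.restr F) = real (card Gd) / real n"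
      "\<And>k. (\<integral>y. indicator (dcell P L k) y * g y \<partial>M.restr F)
        = real (card {i\<in>Gd. \<xi> i \<in> dcell P L k}) / real n"
      "\<And>j Q. int L < j \<Longrightarrow> Q \<in> dyadic_level P j \<Longrightarrow> (\<integral>y. indicator Q y * g y \<partial>M.restr F)
      \<le> (4 * 2 powr (- \<epsilon> * real l) + c1 powr (1 - \<eta>) * 2 powr (- \<epsilon> * real L)) * measure M Q powr \<eta>"
      using M.empirical_density [OF F \<xi>ab Gd(1) l(1) \<epsilon>(1) \<eta> t1(2) \<epsilon>(2,3) n4 frostman heavy thick sparse]
      by blast
    \<comment> \<open>Left endpoints of the visited cells; \<open>K\<close> is made of the closed
      cells.\<close>
    define u where "u k = P + real_of_int (cell_index P l (\<xi> k)) * 2 powi (- int l)" for k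
    define K where "K = (\<Union>k\<in>Gd. {u k..u k + 2 powi (- int l)})"
    have in_cell: "y \<in> {u k..u k + 2 powi (- int l)}" if "cell_index P l y = cell_index P l (\<xi> k)" for y k
    proof -
      have "y \<in> dcell P l (cell_index P l (\<xi> k))" using that by (simp add: mem_dcell)
      then show ?thesis by (auto simp: dcell_def u_def algebra_simps)
    qed
    have Kc: "compact K" unfolding K_def using Gd(1) by (intro compact_UN) (auto intro: finite_subset)
    have KU: "K \<subseteq> tail_balls \<alpha> x m"
    proof
      fix y assume "y \<in> K"
      then obtain k where k: "k \<in> Gd" "y \<in> {u k..u k + 2 powi (- int l)}" by (auto simp: K_def)
      have kn: "n \<le> k" "k < 2 * n" using k(1) Gd(1) by auto
      have "\<xi> k \<in> {u k..u k + 2 powi (- int l)}" by (rule in_cell) simp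
      then have "dist (\<xi> k) y \<le> 2 powi (- int l)" using k(2) by (auto simp: dist_real_def)
      also have "(2::real) powi (- int l) = 2 powr (- real l)"
        by (simp add: power_int_minus powr_minus powr_realpow)
      also have "2 powr (- real l) = (2 powr (real l * \<beta>)) powr (- \<alpha>)"
        using \<alpha> by (simp add: powr_powr \<beta>_def)
      \<comment> \<open>The inequality between 2 * n and the cell scale enters here. The next step
        is strict because k < 2 * n, so even the closed cells lie in the open balls.\<close>
      also have "\<dots> \<le> (2 * real n) powr (- \<alpha>)"
        using n2 n0 \<alpha> by (intro powr_mono2') auto
      also have "\<dots> < real k powr (- \<alpha>)"
        using kn n1 \<alpha> by (intro powr_less_mono2_neg) auto
      finally show "y \<in> tail_balls \<alpha> x m"
        using kn n1 by (auto simp: tail_balls_def \<xi>_def intro!: bexI [of _ k])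
    qed
    have gK: "g y = 0" if "y \<notin> K" for y
      using g(3) [of y] in_cell [of y] that unfolding K_def by (metis UN_I)
    have A: "(\<integral>y. indicator Q y * g y \<partial>M.restr F) \<le> (1 + \<delta>) * measure (M.restr F) Q"
      if QL: "Q \<in> dyadic_level P L" for Q
    proof -
      obtain q where Q: "Q = dcell P L q" using QL by (auto simp: dyadic_level_eq)
      have RQ: "measure (M.restr F) Q = R q" unfolding Q R_def using F by (simp add: M.measure_restr)
      show ?thesis
      proof (cases "q \<in> Qs")
        case True
        have "{i\<in>Gd. \<xi> i \<in> Q} \<subseteq> {k\<in>{n..<2 * n}. (T ^^ k) x \<in> F \<inter> Q}"
          using Gd by (auto simp: \<xi>_def)
        then have "real (card {i\<in>Gd. \<xi> i \<in> Q}) \<le> cnt n (F \<inter> Q) x"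
          unfolding cnt_card by (intro of_nat_mono card_mono) auto
        also have "\<dots> \<le> real n * R q + real n * \<delta> * R q"
          using g1 [OF True] unfolding Q by linarith
        finally have "real (card {i\<in>Gd. \<xi> i \<in> Q}) / real n \<le> (1 + \<delta>) * R q"
          using n0 by (simp add: field_simps)
        then show ?thesis unfolding RQ using g(5) [of q] by (simp add: Q)
      next
        case False
        have "R q \<le> measure M (dcell P L q)"
          unfolding R_def using F by (intro M.finite_measure_mono) auto
        moreover have "0 \<le> R q" by (simp add: R_def)
        ultimately have R0: "R q = 0"
          using False M.measure_dcell_0 [of q P L] by (force simp: Qs_def)
        interpret RF: bounded_line_measure "M.restr F" a b using F by (rule M.bounded_restr)
        have "(\<integral>y. indicator Q y * g y \<partial>M.restr F) = 0"
          using R0 RQ by (intro RF.integral_indicator_null) (auto simp: Q)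
        then show ?thesis using R0 RQ by simp
      qed
    qed
    have A': "measure (M.restr F) UNIV - \<delta> \<le> (\<integral>y. g y \<partial>M.restr F)"
    proof -
      \<comment> \<open>The shortfall of visits to \<open>F\<close> and the number of discarded
        visits each take half of n * \<delta>.\<close>
      have "real n * measure M F - real n * \<delta> \<le> real (card Gd)"
      proof -
        have half: "real n * (\<delta> / 2) = real n * \<delta> / 2" by simp
        show ?thesis
          using cnt_le_good [OF xab, of n F P s' \<epsilon> L l] g2 g3
          unfolding Gd_def half abs_less_iff by linarith
      qed
      then have "measure M F - \<delta> \<le> real (card Gd) / real n"
        using n0 by (simp add: field_simps)
      then show ?thesis using g(4) F by (simp add: M.measure_restr)
    qed
    have Bf: "(\<integral>y. indicator Q y * g y \<partial>M.restr F) \<le> \<delta> * measure M Q powr \<eta>"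
      if "int L < j" "Q \<in> dyadic_level P j" for j Q
    proof -
      have "(4 * 2 powr (- \<epsilon> * real l) + c1 powr (1 - \<eta>) * 2 powr (- \<epsilon> * real L)) * measure M Q powr \<eta>
        \<le> \<delta> * measure M Q powr \<eta>"
        using l(2) L(1) by (intro mult_right_mono) auto
      then show ?thesis using g(6) [OF that] by linarith
    qed
    have "G \<le> int L" using L(3) by linarith
    then show ?thesis
      unfolding fills_at_def using Kc KU g(1,2) gK A A' Bf
      by (intro exI [of _ "int L"] exI [of _ g] exI [of _ K] exI [of _ "int l"] exI [of _ W] conjI allI ballI impI) auto
  qed
  then show ?thesis using Bev PB by blast
qed

text \<open>Exceptional probabilities are arbitrary for each choice of \<open>m\<close>,
  \<open>G\<close> and \<delta>, and integer \<open>G\<close> with \<delta> = 1 / (j + 1) suffice,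
  so a countable intersection gives the claim.\<close>

theorem AE_fills:
  assumes F: "F \<in> sets borel" and \<alpha>: "0 < \<alpha>"
    and s: "spectrum_exponent M < ereal s''" "s'' < s'" "s' * \<eta> < 1 / \<alpha>" and \<eta>: "0 < \<eta>" "\<eta> < 1"
    and t1: "0 < t1" "0 < c1"
    and frostman: "\<And>j k. measure M (dcell P (int j) k) \<le> c1 * 2 powr (- t1 * real j)"
  shows "AE x in \<mu>. \<forall>m. fills P (M.restr F) (\<lambda>Q. measure M Q powr \<eta>) (tail_balls \<alpha> x m)"
proof -
  have "AE x in \<mu>. fills_at P (M.restr F) (\<lambda>Q. measure M Q powr \<eta>) (tail_balls \<alpha> x m) (int i) (1 / (real j + 1))"
    for m i j :: nat
    by (rule AE_of_small_exceptions, rule fills_event [OF F \<alpha> s \<eta> t1 frostman]) auto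
  then have "AE x in \<mu>. \<forall>m i j :: nat.
    fills_at P (M.restr F) (\<lambda>Q. measure M Q powr \<eta>) (tail_balls \<alpha> x m) (int i) (1 / (real j + 1))"
    unfolding AE_all_countable by blast
  then show ?thesis
  proof eventually_elim
    case (elim x)
    show ?case
      unfolding fills_def
    proof (intro allI impI)
      fix m :: nat and G :: int and \<delta> :: real assume \<delta>: "0 < \<delta>"
      then obtain j where j: "inverse (real (Suc j)) < \<delta>" using reals_Archimedean by blast
      have "1 / (real j + 1) \<le> \<delta>" using j by (simp add: inverse_eq_divide add.commute)
      then show "fills_at P (M.restr F) (\<lambda>Q. measure M Q powr \<eta>) (tail_balls \<alpha> x m) G \<delta>"
        by (rule fills_at_mono [OF elim [rule_format, of m "nat G" j], rotated]) auto
    qed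
  qed
qed

end

section \<open>Hausdorff dimension and local dimension\<close>

lemma hausdorff_dim_nonneg: "0 \<le> hausdorff_dim A"
  unfolding hausdorff_dim_def by (rule INF_greatest) auto

text \<open>The balls with index at least \<open>N\<close> cover the set for every \<open>N\<close>,
  and for t > 1 / \<alpha> the sums of their diameters to the power \<open>t\<close> are tails of a
  convergent series.\<close>

lemma hausdorff_dim_limsup_le:
  fixes A :: "real set"
  assumes \<alpha>: "0 < \<alpha>" and A: "A \<subseteq> {y. \<exists>\<^sub>\<infinity>n::nat. \<bar>z n - y\<bar> < real n powr (- \<alpha>)}"
  shows "hausdorff_dim A \<le> ereal (1 / \<alpha>)"
proof -
  have le: "hausdorff_dim A \<le> ereal t" if t: "1 / \<alpha> < t" for t
  proof -
    have t0: "0 < t" using \<alpha> t by (meson divide_pos_pos less_trans zero_less_one)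
    have exp: "- (\<alpha> * t) < - 1" using t \<alpha> by (simp add: field_simps)
    define f where "f n = 2 powr t * real n powr (- (\<alpha> * t))" for n :: nat
    have sumf: "summable f"
      unfolding f_def using exp by (intro summable_mult) (simp add: summable_real_powr_iff)
    have f0: "0 \<le> f n" for n by (simp add: f_def)
    have "hausdorff_premeasure \<delta> t A = 0" if \<delta>: "0 < \<delta>" for \<delta>
    proof -
      have le_e: "hausdorff_premeasure \<delta> t A \<le> ennreal e" if e: "0 < e" for e
      proof -
        obtain N1 where N1: "\<And>n. N1 \<le> n \<Longrightarrow> norm (\<Sum>i. f (i + n)) < e"
          using suminf_exist_split [OF e sumf] by blast
        have "(\<lambda>n. real n powr (- \<alpha>)) \<longlonglongrightarrow> 0"
          using \<alpha> by (intro tendsto_neg_powr filterlim_real_sequentially) auto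
        then have "\<forall>\<^sub>F n in sequentially. real n powr (- \<alpha>) < \<delta> / 2"
          using \<delta> by (intro order_tendstoD) auto
        then obtain N2 where N2: "\<And>n. N2 \<le> n \<Longrightarrow> real n powr (- \<alpha>) < \<delta> / 2"
          unfolding eventually_sequentially by blast
        define N where "N = max 1 (max N1 N2)"
        define U where "U i = ball (z (i + N)) (real (i + N) powr (- \<alpha>))" for i
        have diam: "diameter (U i) = 2 * real (i + N) powr (- \<alpha>)" for i
          unfolding U_def by (subst diameter_ball) simp
        have diam_powr: "diameter (U i) powr t = f (i + N)" for i
          unfolding diam f_def by (simp add: powr_mult powr_powr)
        have "A \<subseteq> (\<Union>i. U i)"
        proof
          fix y assume "y \<in> A"
          then have "\<exists>\<^sub>\<infinity>n::nat. \<bar>z n - y\<bar> < real n powr (- \<alpha>)" using A by blast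
          then obtain n where n: "N \<le> n" "\<bar>z n - y\<bar> < real n powr (- \<alpha>)"
            unfolding INFM_nat_le by blast
          then have "y \<in> U (n - N)" by (simp add: U_def dist_real_def)
          then show "y \<in> (\<Union>i. U i)" by blast
        qed
        moreover have "bounded (U i) \<and> diameter (U i) \<le> \<delta>" for i
        proof -
          have "real (i + N) powr (- \<alpha>) < \<delta> / 2" by (rule N2) (simp add: N_def)
          then show ?thesis unfolding diam by (simp add: U_def)
        qed
        ultimately have "hausdorff_premeasure \<delta> t A \<le> (\<Sum>i. ennreal (diameter (U i) powr t))"
          unfolding hausdorff_premeasure_def by (intro INF_lower) auto
        also have "\<dots> = ennreal (\<Sum>i. f (i + N))"
          unfolding diam_powr using f0 sumf by (intro suminf_ennreal2) (auto simp: summable_iff_shift)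
        also have "\<dots> \<le> ennreal e"
        proof (rule ennreal_leI)
          have "norm (\<Sum>i. f (i + N)) < e" by (rule N1) (simp add: N_def)
          then show "(\<Sum>i. f (i + N)) \<le> e" by simp
        qed
        finally show ?thesis .
      qed
      have "hausdorff_premeasure \<delta> t A \<le> 0"
      proof (rule ennreal_le_epsilon)
        fix e :: real assume "0 < e"
        from le_e [OF this] show "hausdorff_premeasure \<delta> t A \<le> 0 + ennreal e" by simp
      qed
      then show ?thesis by simp
    qed
    then have "hausdorff_measure t A = 0"
      unfolding hausdorff_measure_def by (simp add: SUP_eq_const)
    then show ?thesis
      unfolding hausdorff_dim_def using t0 by (intro INF_lower) auto
  qed
  show ?thesis
  proof (rule ccontr)
    assume "\<not> hausdorff_dim A \<le> ereal (1 / \<alpha>)"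
    then obtain t where "ereal (1 / \<alpha>) < ereal t" "ereal t < hausdorff_dim A"
      using ereal_dense2 by (meson not_le)
    then show False using le [of t] by auto
  qed
qed

section \<open>Lower bounds for Hausdorff dimension through dyadic covers\<close>

lemma measure_lborel_dcell [simp]: "measure lborel (dcell P n k) = 2 powi (- n)"
  unfolding dcell_def by (simp add: algebra_simps)

text \<open>Three adjacent cells of length between \<open>d\<close> and 2 * d cover a set of
  diameter \<open>d\<close>; since d \<le> 1, passing from exponent \<kappa> to the smaller
  \<open>t\<close> only increases the right-hand side.\<close>

lemma small_cover:
  fixes U :: "real set"
  assumes "bounded U" "diameter U \<le> 1" and t: "0 < t" "t \<le> \<kappa>" and e: "0 < e"
  shows "\<exists>\<F>. finite \<F> \<and> \<F> \<subseteq> dyadic P \<and> U \<subseteq> \<Union>\<F>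
    \<and> (\<Sum>Q\<in>\<F>. measure lborel Q powr \<kappa>) \<le> 3 * 2 powr \<kappa> * diameter U powr t + e"
proof (cases "U = {}")
  case True
  then show ?thesis using e by (intro exI [of _ "{}"]) auto
next
  case False
  then obtain u where u: "u \<in> U" by blast
  define d where "d = diameter U"
  have d0: "0 \<le> d" unfolding d_def using assms(1) by (rule diameter_ge_0)
  have key: "\<exists>n::int. d < 2 powi (- n) \<and> 3 * (2 powi (- n)) powr \<kappa> \<le> 3 * 2 powr \<kappa> * d powr t + e"
  \<comment> \<open>A single point has diameter 0, whose power gives no room for a cell; the extra
    \<open>e\<close> pays for it.\<close>
  proof (cases "d = 0")
    case True
    have "(\<lambda>n. 3 * ((1/2) powr \<kappa>) ^ n) \<longlonglongrightarrow> 3 * 0"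
      using t by (intro tendsto_mult tendsto_const LIMSEQ_power_zero) (auto simp: powr_divide)
    then have "\<forall>\<^sub>F n in sequentially. 3 * ((1/2) powr \<kappa>) ^ n < e"
      using e by (intro order_tendstoD) auto
    then obtain n where n: "3 * ((1/2) powr \<kappa>) ^ n < e"
      using eventually_happens' [OF sequentially_bot] by blast
    have "(2 powi (- int n)) powr \<kappa> = ((1/2::real) powr \<kappa>) ^ n"
      by (simp add: power_int_minus power_divide powr_power powr_divide inverse_eq_divide powr_powr
          mult.commute flip: powr_realpow)
    then show ?thesis using n True t by (intro exI [of _ "int n"]) auto
  next
    case False
    then have d: "0 < d" using d0 by simp
    \<comment> \<open>The level whose cell length exceeds \<open>d\<close> strictly but is at most 2
      * d.\<close>
    define n where "n = - (\<lfloor>log 2 d\<rfloor> + 1)"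
    have powi: "2 powr (real_of_int (- n)) = (2::real) powi (- n)"
      by (rule powr_real_of_int') auto
    have "d = 2 powr (log 2 d)" using d by simp
    also have "\<dots> < 2 powr (real_of_int (- n))" unfolding n_def by (intro powr_less_mono) linarith+
    finally have 1: "d < 2 powi (- n)" unfolding powi .
    have "2 powr (real_of_int (- n)) \<le> 2 powr (1 + log 2 d)" unfolding n_def by (intro powr_mono) linarith+
    also have "\<dots> = 2 * d" using d by (simp add: powr_add)
    finally have "2 powi (- n) \<le> 2 * d" unfolding powi .
    then have "(2 powi (- n)) powr \<kappa> \<le> (2 * d) powr \<kappa>" using t by (intro powr_mono2) auto
    also have "\<dots> = 2 powr \<kappa> * d powr \<kappa>" using d by (simp add: powr_mult)
    also have "\<dots> \<le> 2 powr \<kappa> * d powr t"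
      using d t assms(2) by (intro mult_left_mono powr_mono') (auto simp: d_def)
    finally show ?thesis using 1 e by (intro exI [of _ n]) auto
  qed
  then obtain n :: int where n: "d < 2 powi (- n)"
    "3 * (2 powi (- n)) powr \<kappa> \<le> 3 * 2 powr \<kappa> * d powr t + e" by blast
  define \<F> where "\<F> = (\<lambda>i. dcell P n (cell_index P n u + i)) ` {-1, 0, 1}"
  have "U \<subseteq> ball u (2 powi (- n))"
  proof
    fix y assume "y \<in> U"
    then have "dist u y \<le> d" unfolding d_def using assms(1) u by (intro diameter_bounded_bound)
    then show "y \<in> ball u (2 powi (- n))" using n by simp
  qed
  then have "U \<subseteq> \<Union>\<F>" using ball_subset_cells [of u n P] by (auto simp: \<F>_def)
  moreover have "(\<Sum>Q\<in>\<F>. measure lborel Q powr \<kappa>) \<le> (\<Sum>i\<in>{-1, 0, 1::int}. (2 powi (- n)) powr \<kappa>)"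
    unfolding \<F>_def by (rule order_trans [OF sum_image_le]) (auto simp: o_def)
  ultimately show ?thesis
    using n(2) by (intro exI [of _ \<F>]) (auto simp: \<F>_def d_def)
qed

text \<open>If the Hausdorff measure vanished for some t < \<kappa>, an efficient cover by sets of
  diameter at most 1 could be turned into a dyadic cover whose cost stays below
  \<open>c\<close>.\<close>

lemma hausdorff_dim_ge:
  fixes A :: "real set"
  assumes c: "0 < c"
    and cover: "\<And>C S. countable C \<Longrightarrow> C \<subseteq> dyadic P \<Longrightarrow> A \<subseteq> \<Union>C \<Longrightarrow>
      (\<And>C0. finite C0 \<Longrightarrow> C0 \<subseteq> C \<Longrightarrow> (\<Sum>Q\<in>C0. measure lborel Q powr \<kappa>) \<le> S) \<Longrightarrow> c \<le> S"
  shows "ereal \<kappa> \<le> hausdorff_dim A"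
  unfolding hausdorff_dim_def
proof (rule INF_greatest, clarify)
  fix t :: real assume t: "0 < t" "hausdorff_measure t A = 0"
  show "ereal \<kappa> \<le> ereal t"
  proof (rule ccontr)
    assume "\<not> ereal \<kappa> \<le> ereal t"
    then have t\<kappa>: "t \<le> \<kappa>" by simp
    have "hausdorff_premeasure 1 t A \<le> hausdorff_measure t A"
      unfolding hausdorff_measure_def by (intro SUP_upper) auto
    then have pre: "hausdorff_premeasure 1 t A = 0" using t(2) by simp
    define K where "K = 3 * 2 powr \<kappa>"
    have K: "0 < K" by (simp add: K_def)
    \<comment> \<open>The dyadic cover costs at most (K + 1) * e, which is c / 2.\<close>
    define e where "e = c / (2 * (K + 1))"
    have e: "0 < e" using c K by (simp add: e_def)
    have "hausdorff_premeasure 1 t A < ennreal e" using pre e by simp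
    then obtain U where U: "A \<subseteq> (\<Union>i::nat. U i)" "\<And>i. bounded (U i) \<and> diameter (U i) \<le> 1"
      "(\<Sum>i. ennreal (diameter (U i) powr t)) < ennreal e"
      unfolding hausdorff_premeasure_def by (auto simp: INF_less_iff)
    have "\<forall>i. \<exists>\<F>. finite \<F> \<and> \<F> \<subseteq> dyadic P \<and> U i \<subseteq> \<Union>\<F>
      \<and> (\<Sum>Q\<in>\<F>. measure lborel Q powr \<kappa>) \<le> 3 * 2 powr \<kappa> * diameter (U i) powr t + e * (1/2) ^ Suc i"
      using U(2) t t\<kappa> e by (intro allI small_cover) auto
    from choice [OF this] obtain \<F> where \<F>: "\<And>i. finite (\<F> i)" "\<And>i. \<F> i \<subseteq> dyadic P" "\<And>i. U i \<subseteq> \<Union>(\<F> i)"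
      "\<And>i. (\<Sum>Q\<in>\<F> i. measure lborel Q powr \<kappa>) \<le> K * diameter (U i) powr t + e * (1/2) ^ Suc i"
      unfolding K_def by blast
    define C where "C = (\<Union>i. \<F> i)"
    have "c \<le> (K + 1) * e"
    proof (rule cover)
      show "countable C" unfolding C_def using \<F>(1) by (intro countable_UN) (auto intro: countable_finite)
      show "C \<subseteq> dyadic P" unfolding C_def using \<F>(2) by blast
      show "A \<subseteq> \<Union>C" unfolding C_def using U(1) \<F>(3) by blast
      fix C0 assume C0: "finite C0" "C0 \<subseteq> C"
      have "\<exists>n. C0 \<subseteq> (\<Union>i<n. \<F> i)"
        using C0
      proof (induction rule: finite_induct)
        case (insert Q C0)
        then obtain n i where "C0 \<subseteq> (\<Union>i<n. \<F> i)" "Q \<in> \<F> i" by (auto simp: C_def)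
        moreover have "(\<Union>i<n. \<F> i) \<subseteq> (\<Union>i<max n (Suc i). \<F> i)" by (intro UN_mono) auto
        ultimately have "insert Q C0 \<subseteq> (\<Union>i<max n (Suc i). \<F> i)" by force
        then show ?case ..
      qed simp
      then obtain n where n: "C0 \<subseteq> (\<Union>i<n. \<F> i)" by blast
      have "(\<Sum>Q\<in>C0. measure lborel Q powr \<kappa>) \<le> (\<Sum>Q\<in>(\<Union>i<n. \<F> i). measure lborel Q powr \<kappa>)"
        using n \<F>(1) by (intro sum_mono2) auto
      also have "\<dots> \<le> (\<Sum>i<n. \<Sum>Q\<in>\<F> i. measure lborel Q powr \<kappa>)"
        using \<F>(1) by (intro sum_UN_le) auto
      also have "\<dots> \<le> (\<Sum>i<n. K * diameter (U i) powr t + e * (1/2) ^ Suc i)"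
        by (intro sum_mono \<F>(4))
      also have "\<dots> = K * (\<Sum>i<n. diameter (U i) powr t) + e * (\<Sum>i<n. (1/2) ^ Suc i)"
        by (simp add: sum.distrib sum_distrib_left)
      also have "\<dots> \<le> K * e + e * 1"
      proof (intro add_mono mult_left_mono)
        have "(\<Sum>i<n. ennreal (diameter (U i) powr t)) \<le> (\<Sum>i. ennreal (diameter (U i) powr t))"
          by (rule sum_le_suminf) auto
        then have "ennreal (\<Sum>i<n. diameter (U i) powr t) < ennreal e"
          using U(3) by (simp add: sum_ennreal)
        then show "(\<Sum>i<n. diameter (U i) powr t) \<le> e"
          using e by (simp add: ennreal_less_iff sum_nonneg)
        have "(\<Sum>i<n. (1/2::real) ^ Suc i) \<le> (\<Sum>i. (1/2) ^ Suc i)"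
          by (rule sum_le_suminf) (auto simp: summable_mult)
        also have "\<dots> = 1" using power_half_series sums_unique by metis
        finally show "(\<Sum>i<n. (1/2::real) ^ Suc i) \<le> 1" .
      qed (use K e in auto)
      finally show "(\<Sum>Q\<in>C0. measure lborel Q powr \<kappa>) \<le> (K + 1) * e" by (simp add: algebra_simps)
    qed
    also have "(K + 1) * e = c / 2" using K by (simp add: e_def field_simps)
    finally show False using c by simp
  qed
qed

section \<open>Level sets of the lower local dimension\<close>

definition local_dim_level :: "real measure \<Rightarrow> real \<Rightarrow> nat \<Rightarrow> real set" where
  "local_dim_level N c j = {y. \<forall>r. 0 < r \<and> r < 1 / (real j + 1) \<longrightarrow> measure N (ball y r) \<le> r powr c}"

context bounded_line_measure
begin

text \<open>For fixed \<open>r\<close> the measure of the open ball is lower semicontinuous in its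
  centre: an open ball is the increasing union of smaller concentric ones, and such a smaller ball
  stays inside when the centre moves slightly.\<close>

lemma closed_local_dim_level: "closed (local_dim_level N c j)"
proof -
  have op: "open {y. r powr c < measure N (ball y r)}" if r: "0 < r" for r
    unfolding open_dist
  proof clarify
    fix y assume y: "r powr c < measure N (ball y r)"
    define \<rho> where "\<rho> i = r * (1 - (1/2) ^ i)" for i :: nat
    have inc: "incseq \<rho>"
      unfolding \<rho>_def incseq_def using r by (auto intro!: mult_left_mono power_decreasing)
    have "\<rho> \<longlonglongrightarrow> r * (1 - 0)" unfolding \<rho>_def by (intro tendsto_intros LIMSEQ_power_zero) auto
    then have lim: "\<rho> \<longlonglongrightarrow> r" by simp
    have \<rho>_less: "\<rho> i < r" for i using r by (simp add: \<rho>_def)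
    have "(\<Union>i. ball y (\<rho> i)) = ball y r"
    proof
      show "(\<Union>i. ball y (\<rho> i)) \<subseteq> ball y r" by (auto intro: less_trans [OF _ \<rho>_less])
      show "ball y r \<subseteq> (\<Union>i. ball y (\<rho> i))"
      proof
        fix v assume "v \<in> ball y r"
        then have "\<forall>\<^sub>F i in sequentially. dist y v < \<rho> i" using lim by (intro order_tendstoD) auto
        then show "v \<in> (\<Union>i. ball y (\<rho> i))" using eventually_happens' [OF sequentially_bot] by fastforce
      qed
    qed
    moreover have "(\<lambda>i. measure N (ball y (\<rho> i))) \<longlonglongrightarrow> measure N (\<Union>i. ball y (\<rho> i))"
      using inc by (intro finite_Lim_measure_incseq) (auto simp: incseq_def subset_ball)
    ultimately have "\<forall>\<^sub>F i in sequentially. r powr c < measure N (ball y (\<rho> i))"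
      using y by (intro order_tendstoD) auto
    then obtain i where i: "r powr c < measure N (ball y (\<rho> i))"
      using eventually_happens' [OF sequentially_bot] by blast
    have "r powr c < measure N (ball y' r)" if "dist y' y < r - \<rho> i" for y'
    proof -
      have "ball y (\<rho> i) \<subseteq> ball y' r"
      proof
        fix v assume "v \<in> ball y (\<rho> i)"
        then show "v \<in> ball y' r" using that dist_triangle [of y' v y] by simp
      qed
      then have "measure N (ball y (\<rho> i)) \<le> measure N (ball y' r)" by (intro finite_measure_mono) auto
      then show ?thesis using i by simp
    qed
    then show "\<exists>e>0. \<forall>y'. dist y' y < e \<longrightarrow> y' \<in> {y. r powr c < measure N (ball y r)}"
      using \<rho>_less [of i] by (intro exI [of _ "r - \<rho> i"]) auto
  qed
  have "local_dim_level N c j = (\<Inter>r\<in>{r. 0 < r \<and> r < 1 / (real j + 1)}. - {y. r powr c < measure N (ball y r)})"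
    by (auto simp: local_dim_level_def not_less)
  also have "closed \<dots>" using op by (intro closed_INT) auto
  finally show ?thesis .
qed

lemma local_dim_level_sets [measurable]: "local_dim_level N c j \<in> sets borel"
  using closed_local_dim_level by (rule borel_closed)

lemma lower_local_dim_ge:
  assumes "y \<in> local_dim_level N c j"
  shows "ereal c \<le> lower_local_dim N y"
  unfolding lower_local_dim_def
proof (rule Liminf_bounded)
  show "\<forall>\<^sub>F r in at_right 0. ereal c \<le> elog (measure N (ball y r)) / ereal (ln r)"
    unfolding eventually_at_right_field
  proof (intro exI [of _ "1 / (real j + 1)"] conjI allI impI)
    fix r :: real assume r: "0 < r" "r < 1 / (real j + 1)"
    have le1: "1 / (real j + 1) \<le> 1" by simp
    have lnr: "ln r < 0" using r(1) less_le_trans [OF r(2) le1] by simp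
    have le: "measure N (ball y r) \<le> r powr c" using assms r by (auto simp: local_dim_level_def)
    show "ereal c \<le> elog (measure N (ball y r)) / ereal (ln r)"
    proof (cases "measure N (ball y r) \<le> 0")
      case True
      then show ?thesis using lnr by (simp add: elog_def divide_ereal_def)
    next
      case False
      then have "ln (measure N (ball y r)) \<le> ln (r powr c)"
        using le r(1) ln_le_cancel_iff [of "measure N (ball y r)" "r powr c"] by (simp del: ln_powr)
      also have "\<dots> = c * ln r" using r by (simp add: ln_powr)
      finally show ?thesis using False lnr by (simp add: elog_def neg_le_divide_eq)
    qed
  qed simp
qed

lemma local_dim_level_of_less:
  assumes "ereal c < lower_local_dim N y"
  shows "\<exists>j. y \<in> local_dim_level N c j"
proof -
  have "\<forall>\<^sub>F r in at_right 0. ereal c < elog (measure N (ball y r)) / ereal (ln r)"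
    using assms unfolding lower_local_dim_def by (rule less_LiminfD)
  then obtain b where b: "0 < b" "\<And>r. 0 < r \<Longrightarrow> r < b \<Longrightarrow> ereal c < elog (measure N (ball y r)) / ereal (ln r)"
    unfolding eventually_at_right_field by blast
  obtain j where j: "inverse (real (Suc j)) < b" using reals_Archimedean [OF b(1)] by blast
  have "measure N (ball y r) \<le> r powr c" if r: "0 < r" "r < 1 / (real j + 1)" for r
  proof (cases "measure N (ball y r) \<le> 0")
    case True
    then show ?thesis by (smt (verit) powr_ge_zero)
  next
    case False
    have le1: "1 / (real j + 1) \<le> 1" by simp
    have lnr: "ln r < 0" using r(1) less_le_trans [OF r(2) le1] by simp
    have "r < b" using r j by (simp add: inverse_eq_divide add.commute)
    then have "c < ln (measure N (ball y r)) / ln r"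
      using b(2) [OF r(1)] False lnr by (simp add: elog_def)
    then have "ln (measure N (ball y r)) < ln (r powr c)" using lnr r by (simp add: neg_less_divide_eq ln_powr)
    then show ?thesis using False r ln_less_cancel_iff [of "measure N (ball y r)" "r powr c"] by (simp del: ln_powr)
  qed
  then show ?thesis by (auto simp: local_dim_level_def)
qed

text \<open>Writing a strict superlevel set as a countable union of closed sets gives measurability,
  without which \<open>esssup\<close> would default to \<open>top\<close>, and yields a single level
  set of positive measure.\<close>

lemma lower_local_dim_superlevel:
  "{y. z < lower_local_dim N y} = (\<Union>q\<in>{q. z < ereal (real_of_rat q)}. \<Union>j. local_dim_level N (real_of_rat q) j)"
proof (intro set_eqI iffI)
  fix y assume "y \<in> {y. z < lower_local_dim N y}"
  then obtain q where q: "z < ereal (real_of_rat q)" "ereal (real_of_rat q) < lower_local_dim N y"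
    using ereal_dense3 by blast
  obtain j where "y \<in> local_dim_level N (real_of_rat q) j" using local_dim_level_of_less [OF q(2)] by blast
  then show "y \<in> (\<Union>q\<in>{q. z < ereal (real_of_rat q)}. \<Union>j. local_dim_level N (real_of_rat q) j)"
    using q(1) by (intro UN_I [of q] UN_I [of j]) simp_all
next
  fix y assume "y \<in> (\<Union>q\<in>{q. z < ereal (real_of_rat q)}. \<Union>j. local_dim_level N (real_of_rat q) j)"
  then obtain q j where q: "z < ereal (real_of_rat q)" "y \<in> local_dim_level N (real_of_rat q) j" by auto
  have "z < lower_local_dim N y" using q(1) lower_local_dim_ge [OF q(2)] by (rule less_le_trans)
  then show "y \<in> {y. z < lower_local_dim N y}" by simp
qed

lemma lower_local_dim_measurable: "lower_local_dim N \<in> borel_measurable N"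
proof (rule borel_measurableI_greater)
  fix z
  have "{y. z < lower_local_dim N y} \<in> sets borel"
    unfolding lower_local_dim_superlevel
    by (intro sets.countable_UN' sets.countable_UN) auto
  then show "{y \<in> space N. z < lower_local_dim N y} \<in> sets N" by simp
qed

lemma local_dim_level_charged:
  assumes "ereal d < upper_hausdorff_dim_measure N"
  obtains q j where "d < real_of_rat q" "0 < measure N (local_dim_level N (real_of_rat q) j)"
proof -
  have "0 < emeasure N {y \<in> space N. ereal d < lower_local_dim N y}"
    using assms unfolding upper_hausdorff_dim_measure_def
    by (rule esssup_pos_measure [OF lower_local_dim_measurable])
  then have pos: "emeasure N {y. ereal d < lower_local_dim N y} \<noteq> 0" by simp
  have "\<exists>q j. d < real_of_rat q \<and> emeasure N (local_dim_level N (real_of_rat q) j) \<noteq> 0"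
  proof (rule ccontr)
    assume "\<not> ?thesis"
    then have "(\<Union>q\<in>{q. ereal d < ereal (real_of_rat q)}. \<Union>j. local_dim_level N (real_of_rat q) j) \<in> null_sets N"
      by (intro null_sets_UN' null_sets_UN) auto
    then show False using pos unfolding lower_local_dim_superlevel by (auto simp: null_sets_def)
  qed
  then obtain q j where "d < real_of_rat q" "emeasure N (local_dim_level N (real_of_rat q) j) \<noteq> 0" by blast
  then show ?thesis
    by (intro that [of q j]) (auto simp: emeasure_eq_measure zero_less_measure_iff)
qed

end

section \<open>The main theorem\<close>

context bounded_line_measure
begin

text \<open>Cells disjoint from \<open>F\<close> receive no mass, so \<tau> and \<tau>' need
  comparison only on cells meeting \<open>F\<close>; with a level set for \<open>F\<close>, this is
  where the local dimension bounds the measure of a cell.\<close>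

lemma fills_restr_compare:
  assumes F: "F \<in> sets borel" and U: "fills P (restr F) \<tau> U" and C: "0 < C"
    and le: "\<And>Q. Q \<in> dyadic P \<Longrightarrow> F \<inter> Q \<noteq> {} \<Longrightarrow> \<tau> Q \<le> C * \<tau>' Q" and \<tau>': "\<And>Q. 0 \<le> \<tau>' Q"
  shows "fills P (restr F) \<tau>' U"
  unfolding fills_def
proof (intro allI impI)
  fix G :: int and \<delta> :: real assume \<delta>: "0 < \<delta>"
  interpret R: bounded_line_measure "restr F" a b using F by (rule bounded_restr)
  define d where "d = min \<delta> (\<delta> / C)"
  have d: "0 < d" "d \<le> \<delta>" "d * C \<le> \<delta>" using \<delta> C by (auto simp: d_def field_simps min_def)
  have "fills_at P (restr F) \<tau> U G d" using U d(1) unfolding fills_def by blast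
  then obtain L g K n W where H: "G \<le> L" "compact K" "K \<subseteq> U" "step_fun P n g"
    "\<And>y. 0 \<le> g y \<and> g y \<le> W" "\<And>y. y \<notin> K \<Longrightarrow> g y = 0"
    "\<And>Q. Q \<in> dyadic_level P L \<Longrightarrow> (\<integral>y. indicator Q y * g y \<partial>restr F) \<le> (1 + d) * measure (restr F) Q"
    "measure (restr F) UNIV - d \<le> (\<integral>y. g y \<partial>restr F)"
    "\<And>l Q. L < l \<Longrightarrow> Q \<in> dyadic_level P l \<Longrightarrow> (\<integral>y. indicator Q y * g y \<partial>restr F) \<le> d * \<tau> Q"
    unfolding fills_at_def by blast
  have 1: "(\<integral>y. indicator Q y * g y \<partial>restr F) \<le> (1 + \<delta>) * measure (restr F) Q"
    if "Q \<in> dyadic_level P L" for Q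
  proof -
    have "(1 + d) * measure (restr F) Q \<le> (1 + \<delta>) * measure (restr F) Q"
      using d(2) by (intro mult_right_mono) auto
    then show ?thesis using H(7) [OF that] by linarith
  qed
  have 2: "(\<integral>y. indicator Q y * g y \<partial>restr F) \<le> \<delta> * \<tau>' Q" if Q: "L < l" "Q \<in> dyadic_level P l" for l Q
  proof -
    have Qd: "Q \<in> dyadic P" using Q(2) unfolding dyadic_def by blast
    have Qs: "Q \<in> sets borel" using Q(2) by (auto simp: dyadic_level_eq)
    show ?thesis
    proof (cases "F \<inter> Q = {}")
      case True
      then have "measure (restr F) Q = 0" using measure_restr [OF F Qs] by simp
      then show ?thesis using \<delta> \<tau>' [of Q] R.integral_indicator_null [OF Qs] by simp
    next
      case False
      have "d * \<tau> Q \<le> d * (C * \<tau>' Q)" using le [OF Qd False] d(1) by (intro mult_left_mono) auto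
      also have "\<dots> = (d * C) * \<tau>' Q" by simp
      also have "\<dots> \<le> \<delta> * \<tau>' Q" using d(3) \<tau>' by (rule mult_right_mono)
      finally show ?thesis using H(9) [OF Q] by linarith
    qed
  qed
  have 3: "measure (restr F) UNIV - \<delta> \<le> (\<integral>y. g y \<partial>restr F)" using H(8) d(2) by linarith
  show "fills_at P (restr F) \<tau>' U G \<delta>"
    unfolding fills_at_def using H(1-6) 1 2 3
    by (intro exI [of _ L] exI [of _ g] exI [of _ K] exI [of _ n] exI [of _ W] conjI allI ballI impI) auto
qed

lemma charged_unit_cell:
  assumes "0 < measure N UNIV"
  obtains k where "0 < measure N (dcell P 0 k)"
proof -
  have "\<exists>k. emeasure N (dcell P 0 k) \<noteq> 0"
  proof (rule ccontr)
    assume "\<not> ?thesis"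
    then have "(\<Union>k. dcell P 0 k) \<in> null_sets N" by (intro null_sets_UN) auto
    moreover have "(\<Union>k. dcell P 0 k) = UNIV" by (auto simp: mem_dcell)
    ultimately show False using assms by (simp add: emeasure_eq_measure null_sets_def)
  qed
  then show thesis using that by (auto simp: emeasure_eq_measure zero_less_measure_iff)
qed

end

lemma powr_le_epsilon_level:
  fixes c e t :: real
  assumes "0 < c" "0 < t" "0 < e"
  shows "\<exists>n::nat. c * 2 powr (- t * real n) \<le> e"
proof -
  have "(\<lambda>n. (2 powr - t) ^ n) \<longlonglongrightarrow> 0"
    using assms by (intro LIMSEQ_power_zero) (auto simp: powr_minus_divide)
  then have "(\<lambda>n. c * (2 powr - t) ^ n) \<longlonglongrightarrow> 0" by (rule tendsto_mult_right_zero)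
  then have "\<forall>\<^sub>F n in sequentially. c * (2 powr - t) ^ n < e"
    using assms by (intro order_tendstoD) auto
  then obtain n where n: "c * (2 powr - t) ^ n < e"
    using eventually_happens' [OF sequentially_bot] by blast
  have "(2 powr - t) ^ n = 2 powr (- t * real n)" by (simp add: powr_powr flip: powr_realpow)
  then show ?thesis using n by (intro exI [of _ n]) simp
qed

context mixing_system
begin

lemma orbit_limsup_eq: "orbit_limsup_set T \<alpha> x = (\<Inter>m. tail_balls \<alpha> x m)"
  unfolding orbit_limsup_set_def tail_balls_def INFM_nat_le
  by (auto simp: dist_real_def Bex_def)

lemma gdelta_orbit_limsup: "gdelta (orbit_limsup_set T \<alpha> x)"
  unfolding orbit_limsup_eq by (rule gdelta.intros) (auto simp: tail_balls_def)

text \<open>The single cell \<open>D\<close> bounds its content by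
  \<open>measure M D powr \<eta>\<close>. Conversely, the measure of Q \<inter> D is at most
  \<open>measure M D powr (1 - \<eta>) * measure M Q powr \<eta>\<close>; with this factor
  \<open>fills_cover\<close> gives the sharp constant, so the contents are equal and not merely
  comparable.\<close>

lemma net_content_orbit_limsup:
  assumes fills: "\<And>m. fills P (M.restr UNIV) (\<lambda>Q. measure M Q powr \<eta>') (tail_balls \<alpha> x m)"
    and \<eta>: "0 < \<eta>" "\<eta> \<le> \<eta>'" "\<eta> \<le> 1" and t1: "0 < t1" "0 < c1"
    and frostman: "\<And>j k. measure M (dcell P (int j) k) \<le> c1 * 2 powr (- t1 * real j)"
    and D: "D \<in> dyadic P"
  shows "net_content P M \<eta> (orbit_limsup_set T \<alpha> x \<inter> D) = net_content P M \<eta> D"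
proof (rule antisym)
  show "net_content P M \<eta> (orbit_limsup_set T \<alpha> x \<inter> D) \<le> net_content P M \<eta> D"
    unfolding net_content_def by (rule INF_superset_mono) auto
  define \<tau> where "\<tau> Q = measure M Q powr \<eta>" for Q
  have "net_content P M \<eta> D \<le> (\<Sum>\<^sub>\<infinity>Q\<in>{D}. ennreal (\<tau> Q))"
    unfolding net_content_def \<tau>_def using D by (intro INF_lower) auto
  then have upper: "net_content P M \<eta> D \<le> ennreal (\<tau> D)" by simp
  have U: "fills P (M.restr UNIV) \<tau> (tail_balls \<alpha> x m)" for m
  proof (rule M.fills_restr_compare [OF _ fills, where C = 1])
    show "measure M Q powr \<eta>' \<le> 1 * \<tau> Q" for Q
      unfolding \<tau>_def using \<eta> measure_M_le_1 [of Q] by (simp add: powr_mono')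
  qed (auto simp: \<tau>_def)
  interpret R: bounded_line_measure "M.restr UNIV" a b by (rule M.bounded_restr) simp
  have R: "measure (M.restr UNIV) Q = measure M Q" if "Q \<in> sets borel" for Q
    using that by (simp add: M.measure_restr)
  have dy_borel: "Q \<in> sets borel" if "Q \<in> dyadic P" for Q
    using that unfolding dyadic_def dyadic_level_eq by auto
  have "ennreal (\<tau> D) \<le> (\<Sum>\<^sub>\<infinity>Q\<in>C. ennreal (\<tau> Q))"
    if C: "countable C" "C \<subseteq> dyadic P" "orbit_limsup_set T \<alpha> x \<inter> D \<subseteq> \<Union>C" for C
  proof (cases "(\<Sum>\<^sub>\<infinity>Q\<in>C. ennreal (\<tau> Q)) = \<infinity> \<or> measure M D = 0")
    case True
    then show ?thesis by (auto simp: \<tau>_def)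
  next
    case False
    then obtain S where S: "0 \<le> S" "(\<Sum>\<^sub>\<infinity>Q\<in>C. ennreal (\<tau> Q)) = ennreal S"
      by (cases "(\<Sum>\<^sub>\<infinity>Q\<in>C. ennreal (\<tau> Q))") auto
    have D0: "0 < measure M D" using False measure_nonneg [of M D] by linarith
    have "measure (M.restr UNIV) D \<le> measure M D powr (1 - \<eta>) * S"
    proof (rule R.fills_cover [of P \<tau> "tail_balls \<alpha> x" D "measure M D powr (1 - \<eta>)" C S])
      show "0 < measure M D powr (1 - \<eta>)" using D0 by simp
      show "measure (M.restr UNIV) (Q \<inter> D) \<le> measure M D powr (1 - \<eta>) * \<tau> Q" if Q: "Q \<in> dyadic P" for Q
      proof (cases "measure M (Q \<inter> D) = 0")
        case True
        then show ?thesis using R dy_borel [OF Q] dy_borel [OF D] by (simp add: \<tau>_def)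
      next
        case False
        then have pos: "0 < measure M (Q \<inter> D)" using measure_nonneg [of M "Q \<inter> D"] by linarith
        have "measure M (Q \<inter> D) = measure M (Q \<inter> D) powr (1 - \<eta>) * measure M (Q \<inter> D) powr \<eta>"
          using pos by (simp flip: powr_add)
        also have "\<dots> \<le> measure M D powr (1 - \<eta>) * \<tau> Q"
          unfolding \<tau>_def using \<eta> dy_borel [OF Q] dy_borel [OF D]
          by (intro mult_mono powr_mono2 M.finite_measure_mono) auto
        finally show ?thesis using R dy_borel [OF Q] dy_borel [OF D] by simp
      qed
      show "\<exists>n. \<forall>k. \<tau> (dcell P n k) \<le> e" if e: "0 < e" for e
      proof -
        obtain n :: nat where n: "c1 powr \<eta> * 2 powr (- (t1 * \<eta>) * real n) \<le> e"
          using powr_le_epsilon_level [of "c1 powr \<eta>" "t1 * \<eta>" e] t1 \<eta> e by auto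
        have "\<tau> (dcell P (int n) k) \<le> e" for k
        proof -
          have "\<tau> (dcell P (int n) k) \<le> (c1 * 2 powr (- t1 * real n)) powr \<eta>"
            unfolding \<tau>_def using \<eta> frostman by (intro powr_mono2) auto
          also have "\<dots> = c1 powr \<eta> * 2 powr (- (t1 * \<eta>) * real n)"
            using t1 by (simp add: powr_mult powr_powr mult_ac)
          finally show ?thesis using n by linarith
        qed
        then show ?thesis by blast
      qed
      show "D \<inter> (\<Inter>i. tail_balls \<alpha> x i) \<subseteq> \<Union>C" using C(3) unfolding orbit_limsup_eq by blast
      show "sum \<tau> C0 \<le> S" if "finite C0" "C0 \<subseteq> C" for C0
      proof -
        have "ennreal (sum \<tau> C0) = (\<Sum>Q\<in>C0. ennreal (\<tau> Q))" by (simp add: sum_ennreal \<tau>_def)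
        also have "\<dots> \<le> (\<Sum>\<^sub>\<infinity>Q\<in>C. ennreal (\<tau> Q))"
          using that by (subst nonneg_infsum_complete) (auto intro: SUP_upper)
        finally show ?thesis using S by (simp add: ennreal_le_iff)
      qed
    qed (use U D C in \<open>auto simp: \<tau>_def\<close>)
    then have "measure M D \<le> measure M D powr (1 - \<eta>) * S" using R dy_borel [OF D] by simp
    moreover have "measure M D = measure M D powr (1 - \<eta>) * \<tau> D"
      using D0 by (simp add: \<tau>_def flip: powr_add)
    ultimately have "\<tau> D \<le> S" using D0 by (smt (verit) mult_le_cancel_left_pos powr_gt_zero)
    then show ?thesis using S by (simp add: ennreal_leI)
  qed
  then have "ennreal (\<tau> D) \<le> net_content P M \<eta> (orbit_limsup_set T \<alpha> x \<inter> D)"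
    unfolding net_content_def \<tau>_def [symmetric] by (intro INF_greatest) auto
  with upper show "net_content P M \<eta> D \<le> net_content P M \<eta> (orbit_limsup_set T \<alpha> x \<inter> D)"
    by (rule order_trans)
qed

text \<open>On cells meeting the level set, the measure is at most a constant times the length to
  the power \<open>c\<close>. So the \<eta>-th power of the measure may be replaced by length to the
  power c * \<eta>, after which \<open>fills_cover\<close> is a statement about Hausdorff
  sums.\<close>

lemma hausdorff_dim_orbit_limsup_ge:
  assumes c: "0 < c" and \<eta>: "0 < \<eta>" "\<eta> < 1"
    and pos: "0 < measure M (local_dim_level M c j)" and J: "J \<noteq> {}"
    and fills: "\<And>n m. n \<in> J \<Longrightarrow> fills P (M.restr (local_dim_level M c j)) (\<lambda>Q. measure M Q powr \<eta>)
      (tail_balls \<alpha> (x n) m)"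
  shows "ereal (c * \<eta>) \<le> hausdorff_dim (\<Inter>n\<in>(J :: nat set). orbit_limsup_set T \<alpha> (x n))"
proof -
  define F where "F = local_dim_level M c j"
  have F: "F \<in> sets borel" unfolding F_def by (rule M.local_dim_level_sets)
  interpret R: bounded_line_measure "M.restr F" a b using F by (rule M.bounded_restr)
  define \<tau> where "\<tau> Q = measure lborel Q powr (c * \<eta>)" for Q :: "real set"
  define C where "C = (real j + 1) powr (c * \<eta>)"
  have C: "0 < C" by (simp add: C_def)
  have le: "measure M Q powr \<eta> \<le> C * \<tau> Q" if Q: "Q \<in> dyadic P" "F \<inter> Q \<noteq> {}" for Q
  proof -
    obtain n k where Qk: "Q = dcell P n k" using Q(1) unfolding dyadic_def dyadic_level_eq by blast
    obtain y where y: "y \<in> F" "y \<in> Q" using Q(2) by blast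
    define d :: real where "d = 2 powi (- n)"
    have d: "0 < d" by (simp add: d_def)
    have "measure M Q \<le> ((real j + 1) * d) powr c"
    proof (cases "d < 1 / (real j + 1)")
      case True
      have "Q \<subseteq> ball y d"
      proof
        fix v assume "v \<in> Q"
        then have "\<bar>y - v\<bar> < d" using y(2) unfolding Qk d_def mem_dcell by (intro dist_same_cell [of P]) simp
        then show "v \<in> ball y d" by (simp add: dist_real_def)
      qed
      then have "measure M Q \<le> measure M (ball y d)" by (intro M.finite_measure_mono) auto
      also have "\<dots> \<le> d powr c" using y(1) True d by (auto simp: F_def local_dim_level_def)
      also have "\<dots> \<le> ((real j + 1) * d) powr c"
        using d c by (intro powr_mono2) (auto simp: algebra_simps)
      finally show ?thesis .
    next
      \<comment> \<open>Cells too long for the level set condition: the right-hand side is at least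
        1, the total mass.\<close>
      case False
      then have "1 \<le> (real j + 1) * d" by (simp add: not_less field_simps)
      then have "1 \<le> ((real j + 1) * d) powr c" using c by (intro ge_one_powr_ge_zero) auto
      then show ?thesis using measure_M_le_1 [of Q] by linarith
    qed
    then have "measure M Q powr \<eta> \<le> (((real j + 1) * d) powr c) powr \<eta>"
      using \<eta> by (intro powr_mono2) auto
    also have "\<dots> = C * \<tau> Q"
      using d by (simp add: C_def \<tau>_def Qk d_def powr_powr powr_mult)
    finally show ?thesis .
  qed
  have U: "fills P (M.restr F) \<tau> (tail_balls \<alpha> (x n) m)" if "n \<in> J" for n m
    by (rule M.fills_restr_compare [OF F fills [OF that, folded F_def] C le]) (auto simp: \<tau>_def)
  have "0 < measure (M.restr F) UNIV" using pos F by (simp add: M.measure_restr F_def)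
  then obtain k where k: "0 < measure (M.restr F) (dcell P 0 k)" by (rule R.charged_unit_cell)
  obtain n0 where n0: "n0 \<in> J" using J by blast
  \<comment> \<open>One sequence runs through all pairs of an index in \<open>J\<close> and a tail;
    indices outside \<open>J\<close> are replaced by the member \<open>n0\<close>.\<close>
  define V where "V i = (let (n, m) = prod_decode i in tail_balls \<alpha> (x (if n \<in> J then n else n0)) m)" for i
  have V: "fills P (M.restr F) \<tau> (V i)" for i
    unfolding V_def using U n0 by (auto split: prod.splits)
  have V_Int: "(\<Inter>i. V i) \<subseteq> (\<Inter>n\<in>J. orbit_limsup_set T \<alpha> (x n))"
  proof
    fix y assume y: "y \<in> (\<Inter>i. V i)"
    have "y \<in> tail_balls \<alpha> (x n) m" if "n \<in> J" for n m
    proof -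
      have "y \<in> V (prod_encode (n, m))" using y by blast
      then show ?thesis using that by (simp add: V_def)
    qed
    then show "y \<in> (\<Inter>n\<in>J. orbit_limsup_set T \<alpha> (x n))" unfolding orbit_limsup_eq by blast
  qed
  show ?thesis
  proof (rule hausdorff_dim_ge)
    show "0 < measure (M.restr F) (dcell P 0 k) / C" using k C by simp
    fix \<C> S assume \<C>: "countable \<C>" "\<C> \<subseteq> dyadic P" "(\<Inter>n\<in>J. orbit_limsup_set T \<alpha> (x n)) \<subseteq> \<Union>\<C>"
      "\<And>C0. finite C0 \<Longrightarrow> C0 \<subseteq> \<C> \<Longrightarrow> (\<Sum>Q\<in>C0. measure lborel Q powr (c * \<eta>)) \<le> S"
    have "measure (M.restr F) (dcell P 0 k) \<le> C * S"
    proof (rule R.fills_cover [of P \<tau> V "dcell P 0 k" C \<C> S])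
      show "measure (M.restr F) (Q \<inter> dcell P 0 k) \<le> C * \<tau> Q" if Q: "Q \<in> dyadic P" for Q
      proof -
        have Qs: "Q \<in> sets borel" using Q unfolding dyadic_def dyadic_level_eq by auto
        show ?thesis
        proof (cases "F \<inter> Q = {}")
          case True
          then have "F \<inter> (Q \<inter> dcell P 0 k) = {}" by blast
          then have "measure (M.restr F) (Q \<inter> dcell P 0 k) = 0"
            using Qs M.measure_restr [OF F, of "Q \<inter> dcell P 0 k"] by simp
          then show ?thesis using C by (simp add: \<tau>_def)
        next
          case False
          have "measure (M.restr F) (Q \<inter> dcell P 0 k) \<le> measure M (Q \<inter> dcell P 0 k)"
            using F Qs by (intro M.measure_restr_le) auto
          also have "\<dots> \<le> measure M Q" using Qs by (intro M.finite_measure_mono) auto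
          also have "\<dots> \<le> measure M Q powr \<eta>"
            using \<eta> measure_M_le_1 [of Q] powr_mono' [of \<eta> 1 "measure M Q"] by simp
          also have "\<dots> \<le> C * \<tau> Q" by (rule le [OF Q False])
          finally show ?thesis .
        qed
      qed
      show "\<exists>n. \<forall>k. \<tau> (dcell P n k) \<le> e" if e: "0 < e" for e
      proof -
        obtain n :: nat where n: "1 * 2 powr (- (c * \<eta>) * real n) \<le> e"
          using powr_le_epsilon_level [of 1 "c * \<eta>" e] c \<eta> e by auto
        have "(2::real) powi (- int n) = 2 powr (- real n)"
          by (simp add: power_int_minus powr_minus powr_realpow)
        then have "\<tau> (dcell P (int n) k) \<le> e" for k
          using n by (simp add: \<tau>_def powr_powr mult_ac)
        then show ?thesis by blast
      qed
      show "dcell P 0 k \<inter> (\<Inter>i. V i) \<subseteq> \<Union>\<C>" using \<C>(3) V_Int by blast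
    qed (use V C \<C> in \<open>auto simp: \<tau>_def\<close>)
    then show "measure (M.restr F) (dcell P 0 k) / C \<le> S"
      using C by (simp add: field_simps)
  qed
qed

end

text \<open>Approximation from below also covers infinite \<open>E\<close>; rational second factors
  match the countable family of exponents for which \<open>fills\<close> is known.\<close>

lemma ereal_mult_le_of_dense:
  fixes E v :: ereal and \<theta> :: real
  assumes \<theta>: "0 < \<theta>" and v: "0 \<le> v"
    and le: "\<And>d q. 0 < d \<Longrightarrow> ereal d < E \<Longrightarrow> 0 < real_of_rat q \<Longrightarrow> real_of_rat q < \<theta> \<Longrightarrow> ereal (d * real_of_rat q) \<le> v"
  shows "ereal \<theta> * E \<le> v"
proof -
  have "E \<le> v / ereal \<theta>"
  proof (rule ccontr)
    assume "\<not> E \<le> v / ereal \<theta>"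
    then obtain d where d: "v / ereal \<theta> < ereal d" "ereal d < E" using ereal_dense2 by (meson not_le)
    have "0 \<le> v / ereal \<theta>" using v \<theta> by simp
    then have d0: "0 < d" using d(1) by (metis ereal_less(2) le_less_trans)
    have vd: "v < ereal (\<theta> * d)" using d(1) \<theta> by (cases v) (auto simp: field_simps)
    then obtain w where w: "v = ereal w" "0 \<le> w" using v by (cases v) auto
    have "w / d < \<theta>" using vd w d0 by (simp add: field_simps)
    then obtain q where q: "w / d < real_of_rat q" "real_of_rat q < \<theta>" using of_rat_dense by blast
    have "0 < real_of_rat q" using q(1) w d0 by (smt (verit) divide_nonneg_pos)
    then have "ereal (d * real_of_rat q) \<le> v" using le d0 d(2) q(2) by blast
    then show False using q(1) w d0 by (simp add: field_simps)
  qed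
  then show ?thesis using \<theta> by (subst (asm) ereal_le_divide_pos) auto
qed

theorem theorem2p9:
  fixes P a b t1 c1 \<alpha> :: real
    and T :: "real \<Rightarrow> real"
    and \<mu> :: "real measure"
    and p :: "nat \<Rightarrow> real"
  assumes "a < b"
    and "sets \<mu> = sets (restrict_space borel {a..b})"
    and "prob_space \<mu>"
    and "T \<in> measurable \<mu> \<mu>"
    and "distr \<mu> \<mu> T = \<mu>"
    and "t1 > 0" and "c1 > 0"
    and "\<And>n D. D \<in> dyadic_level P n \<Longrightarrow>
           measure (line_measure \<mu>) D \<le> c1 * 2 powr (- t1 * real_of_int n)"
    and "summable p"
    and "\<And>n f g. integrable \<mu> f \<Longrightarrow> bounded_variation_on {a..b} g \<Longrightarrow>
           \<bar>(\<integral>x. f ((T ^^ n) x) * g x \<partial>\<mu>) - (\<integral>x. f x \<partial>\<mu>) * (\<integral>x. g x \<partial>\<mu>)\<bar>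
             \<le> p n * (\<integral>x. \<bar>f x\<bar> \<partial>\<mu>)
                 * ((\<integral>x. \<bar>g x\<bar> \<partial>\<mu>) + enn2real (total_variation {a..b} g))"
    and "\<alpha> > 0"
    and "ereal (1 / \<alpha>) \<le> spectrum_exponent (line_measure \<mu>)"
  shows "(AE x in \<mu>. orbit_limsup_set T \<alpha> x \<in>
            large_intersection_class P (line_measure \<mu>)
              (1 / (\<alpha> * real_of_ereal (spectrum_exponent (line_measure \<mu>)))))
       \<and> (\<exists>A \<subseteq> {a..b}. A \<in> sets \<mu> \<and> measure \<mu> A = 1 \<and>
            (\<forall>(J :: nat set) x. J \<noteq> {} \<and> (\<forall>n\<in>J. x n \<in> A) \<longrightarrow>
               ereal (1 / \<alpha>) * (upper_hausdorff_dim_measure (line_measure \<mu>)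
                                / spectrum_exponent (line_measure \<mu>))
                 \<le> hausdorff_dim (\<Inter>n\<in>J. orbit_limsup_set T \<alpha> (x n))
             \<and> hausdorff_dim (\<Inter>n\<in>J. orbit_limsup_set T \<alpha> (x n)) \<le> ereal (1 / \<alpha>)))"
proof -
  interpret mixing_system \<mu> a b T p
    by (intro mixing_system.intro mixing_system_axioms.intro) fact+
  note \<alpha> = \<open>\<alpha> > 0\<close>
  have frostman: "measure M (dcell P (int j) k) \<le> c1 * 2 powr (- t1 * real j)" for j k
    using assms(8) [of "dcell P (int j) k" "int j"] by (simp add: dyadic_level_eq)
  \<comment> \<open>For an infinite exponent this conversion gives 0, and division by 0 then makes
    \<theta> equal to 0: no \<eta> lies in the range, and membership in the class reduces to being a
    G-delta set.\<close>
  define \<sigma> where "\<sigma> = real_of_ereal (spectrum_exponent M)"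
  define \<theta> where "\<theta> = 1 / (\<alpha> * \<sigma>)"
  have upper: "hausdorff_dim (\<Inter>n\<in>J. orbit_limsup_set T \<alpha> (x n)) \<le> ereal (1 / \<alpha>)"
    if ne: "J \<noteq> {}" for J :: "nat set" and x
  proof -
    obtain n where "n \<in> J" using ne by blast
    then have "(\<Inter>n\<in>J. orbit_limsup_set T \<alpha> (x n)) \<subseteq> {y. \<exists>\<^sub>\<infinity>k. \<bar>(T ^^ k) (x n) - y\<bar> < real k powr (- \<alpha>)}"
      unfolding orbit_limsup_set_def by blast
    then show ?thesis by (rule hausdorff_dim_limsup_le [OF \<alpha>])
  qed
  \<comment> \<open>Rational exponents and rational levels keep the number of conditions countable,
    independently of any sequence of points.\<close>
  define good where "good x \<longleftrightarrow> (\<forall>\<eta>. 0 < real_of_rat \<eta> \<and> real_of_rat \<eta> < \<theta> \<longrightarrow>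
      (\<forall>m. fills P (M.restr UNIV) (\<lambda>Q. measure M Q powr real_of_rat \<eta>) (tail_balls \<alpha> x m))
      \<and> (\<forall>q j m. fills P (M.restr (local_dim_level M (real_of_rat q) j))
            (\<lambda>Q. measure M Q powr real_of_rat \<eta>) (tail_balls \<alpha> x m)))" for x
  have good_UNIV: "fills P (M.restr UNIV) (\<lambda>Q. measure M Q powr real_of_rat \<eta>) (tail_balls \<alpha> x m)"
    if "good x" "0 < real_of_rat \<eta>" "real_of_rat \<eta> < \<theta>" for x \<eta> m
    using that unfolding good_def by blast
  have good_level: "fills P (M.restr (local_dim_level M (real_of_rat q) j))
      (\<lambda>Q. measure M Q powr real_of_rat \<eta>) (tail_balls \<alpha> x m)"
    if "good x" "0 < real_of_rat \<eta>" "real_of_rat \<eta> < \<theta>" for x \<eta> q j m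
    using that unfolding good_def by blast
  have \<theta>_pos: "0 < \<sigma> \<and> spectrum_exponent M = ereal \<sigma> \<and> \<theta> \<le> 1" if "0 < \<theta>"
  proof -
    have "0 < \<sigma>" using that \<alpha> by (simp add: \<theta>_def zero_less_mult_iff)
    then have eq: "spectrum_exponent M = ereal \<sigma>"
      unfolding \<sigma>_def by (cases "spectrum_exponent M") auto
    have "1 / \<alpha> \<le> \<sigma>" using assms(12) unfolding eq by simp
    then show ?thesis using \<open>0 < \<sigma>\<close> eq \<alpha> by (simp add: \<theta>_def field_simps)
  qed
  have fills_AE: "AE x in \<mu>. \<forall>m. fills P (M.restr F) (\<lambda>Q. measure M Q powr \<eta>) (tail_balls \<alpha> x m)"
    if F: "F \<in> sets borel" and \<eta>: "0 < \<eta>" "\<eta> < \<theta>" for F \<eta>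
  proof -
    have \<sigma>: "0 < \<sigma>" "spectrum_exponent M = ereal \<sigma>" "\<theta> \<le> 1" using \<theta>_pos \<eta> by auto
    have "\<sigma> < 1 / (\<alpha> * \<eta>)" using \<eta> \<sigma>(1) \<alpha> by (simp add: \<theta>_def field_simps)
    \<comment> \<open>Room above \<sigma> exists because \<eta> < \<theta>.\<close>
    then obtain s' where s': "\<sigma> < s'" "s' < 1 / (\<alpha> * \<eta>)" using dense by blast
    obtain s'' where s'': "\<sigma> < s''" "s'' < s'" using s'(1) dense by blast
    have "s' * \<eta> < 1 / \<alpha>" using s'(2) \<alpha> \<eta> by (simp add: field_simps)
    then show ?thesis
      using s'' \<sigma> \<eta> by (intro AE_fills [OF F \<alpha> _ s''(2) _ _ _ assms(6,7) frostman]) auto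
  qed
  have "AE x in \<mu>. good x"
    unfolding good_def
  proof (subst AE_all_countable, intro allI)
    fix \<eta>
    show "AE x in \<mu>. 0 < real_of_rat \<eta> \<and> real_of_rat \<eta> < \<theta> \<longrightarrow>
      (\<forall>m. fills P (M.restr UNIV) (\<lambda>Q. measure M Q powr real_of_rat \<eta>) (tail_balls \<alpha> x m))
      \<and> (\<forall>q j m. fills P (M.restr (local_dim_level M (real_of_rat q) j))
            (\<lambda>Q. measure M Q powr real_of_rat \<eta>) (tail_balls \<alpha> x m))"
    proof (cases "0 < real_of_rat \<eta> \<and> real_of_rat \<eta> < \<theta>")
      case True
      have "AE x in \<mu>. fills P (M.restr (local_dim_level M (real_of_rat q) j))
            (\<lambda>Q. measure M Q powr real_of_rat \<eta>) (tail_balls \<alpha> x m)" for q j m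
        using fills_AE [OF M.local_dim_level_sets, of "real_of_rat \<eta>"] True
        unfolding AE_all_countable by blast
      then have "AE x in \<mu>. \<forall>q j m. fills P (M.restr (local_dim_level M (real_of_rat q) j))
            (\<lambda>Q. measure M Q powr real_of_rat \<eta>) (tail_balls \<alpha> x m)"
        unfolding AE_all_countable by blast
      moreover have "AE x in \<mu>. \<forall>m. fills P (M.restr UNIV) (\<lambda>Q. measure M Q powr real_of_rat \<eta>) (tail_balls \<alpha> x m)"
        using True by (intro fills_AE) auto
      ultimately show ?thesis by eventually_elim blast
    next
      case False
      then show ?thesis by (intro AE_I2 impI) blast
    qed
  qed
  \<comment> \<open>\<open>good\<close> is not known to be measurable, so \<open>A\<close> is the
    complement of a measurable null set containing its failures.\<close>
  then obtain Z where Z: "{x \<in> space \<mu>. \<not> good x} \<subseteq> Z" "emeasure \<mu> Z = 0" "Z \<in> sets \<mu>"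
    by (rule AE_E)
  define A where "A = space \<mu> - Z"
  have A: "A \<subseteq> {a..b}" "A \<in> sets \<mu>" "measure \<mu> A = 1" "\<And>x. x \<in> A \<Longrightarrow> good x"
    using Z prob_compl [OF Z(3)] by (auto simp: A_def space_mu [symmetric] measure_def)
  have in_class: "orbit_limsup_set T \<alpha> x \<in> large_intersection_class P M \<theta>" if "good x" for x
    unfolding large_intersection_class_def
  proof (intro CollectI conjI allI impI)
    show "gdelta (orbit_limsup_set T \<alpha> x)" by (rule gdelta_orbit_limsup)
    fix \<eta> D assume \<eta>D: "0 < \<eta> \<and> \<eta> < \<theta> \<and> D \<in> dyadic P"
    \<comment> \<open>A rational exponent above \<eta> suffices: masses are at most 1, so a larger
      exponent gives a stronger bound.\<close>
    then obtain q where q: "\<eta> < real_of_rat q" "real_of_rat q < \<theta>" using of_rat_dense by blast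
    have q0: "0 < real_of_rat q" using q(1) \<eta>D by linarith
    have "\<theta> \<le> 1" using \<theta>_pos \<eta>D by simp
    then show "net_content P M \<eta> (orbit_limsup_set T \<alpha> x \<inter> D) = net_content P M \<eta> D"
      using \<eta>D q q0
      by (intro net_content_orbit_limsup [OF good_UNIV [OF that q0 q(2)] _ _ _ assms(6,7) frostman]) auto
  qed
  have lower: "ereal (1 / \<alpha>) * (upper_hausdorff_dim_measure M / spectrum_exponent M)
      \<le> hausdorff_dim (\<Inter>n\<in>J. orbit_limsup_set T \<alpha> (x n))"
    if J: "J \<noteq> {}" "\<And>n. n \<in> J \<Longrightarrow> x n \<in> A" for J :: "nat set" and x
  proof (cases "spectrum_exponent M = \<infinity>")
    \<comment> \<open>The quotient by an infinite exponent is 0, so the bound is trivial.\<close>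
    case True
    then show ?thesis using hausdorff_dim_nonneg by simp
  next
    case False
    have "ereal 0 < spectrum_exponent M" using assms(12) \<alpha>
      by (metis ereal_less_eq(3) less_ereal.simps(1) less_le_trans zero_less_divide_1_iff)
    then have \<sigma>: "spectrum_exponent M = ereal \<sigma>" "0 < \<sigma>"
      using False unfolding \<sigma>_def by (cases "spectrum_exponent M"; simp)+
    then have \<theta>: "0 < \<theta>" using \<alpha> by (simp add: \<theta>_def)
    have "ereal \<theta> * upper_hausdorff_dim_measure M \<le> hausdorff_dim (\<Inter>n\<in>J. orbit_limsup_set T \<alpha> (x n))"
    proof (rule ereal_mult_le_of_dense [OF \<theta> hausdorff_dim_nonneg])
      fix d \<eta> assume d: "0 < d" "ereal d < upper_hausdorff_dim_measure M"
        and \<eta>: "0 < real_of_rat \<eta>" "real_of_rat \<eta> < \<theta>"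
      obtain q j where q: "d < real_of_rat q" "0 < measure M (local_dim_level M (real_of_rat q) j)"
        using d(2) by (rule M.local_dim_level_charged)
      have q0: "0 < real_of_rat q" using d(1) q(1) by linarith
      have \<eta>1: "real_of_rat \<eta> < 1" using \<theta>_pos \<theta> \<eta>(2) by linarith
      have "ereal (real_of_rat q * real_of_rat \<eta>) \<le> hausdorff_dim (\<Inter>n\<in>J. orbit_limsup_set T \<alpha> (x n))"
        by (rule hausdorff_dim_orbit_limsup_ge [OF q0 \<eta>(1) \<eta>1 q(2) J(1) good_level [OF A(4) [OF J(2)] \<eta>]])
      moreover have "d * real_of_rat \<eta> \<le> real_of_rat q * real_of_rat \<eta>"
        using q \<eta> by (intro mult_right_mono) auto
      ultimately show "ereal (d * real_of_rat \<eta>) \<le> hausdorff_dim (\<Inter>n\<in>J. orbit_limsup_set T \<alpha> (x n))"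
        by (meson ereal_less_eq(3) order_trans)
    qed
    also have "ereal \<theta> * upper_hausdorff_dim_measure M
      = ereal (1 / \<alpha>) * (upper_hausdorff_dim_measure M / spectrum_exponent M)"
      using \<sigma>(2) \<alpha> unfolding \<sigma>(1) \<theta>_def
      by (cases "upper_hausdorff_dim_measure M") (auto simp: divide_ereal_def divide_inverse)
    finally show ?thesis .
  qed
  have "AE x in \<mu>. orbit_limsup_set T \<alpha> x \<in> large_intersection_class P M \<theta>"
    using \<open>AE x in \<mu>. good x\<close> in_class by (auto elim: eventually_mono)
  then show ?thesis
    unfolding \<theta>_def \<sigma>_def using A(1-3) lower upper
    by (intro conjI exI [of _ A] allI impI) auto
qed

end
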